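(* Let $L=\{L_1,\dots,L_N\}$ be a directed acyclic linear network (DALN), let $\omega\in\Omega$, and let $\lambda^*$ be a conditional intensity function on $L$. Produce point patterns on $L_{\omega(1)},\dots,L_{\omega(N)}$ recursively, using on each segment either the inverse method or Ogata's modified thinning algorithm (both as specified in the context, in their unmarked or marked versions). Then the resulting simulation is a point process on $L$ with conditional intensity function $\lambda^*$. This holds in both the unmarked and the marked case.
   Context: **Directed linear network.** Let $d\ge 2$. $L_1,\dots,L_N\subseteq\mathbb R^d$ are non-overlapping open line segments of finite length $|L_i|$ (they may join at their endpoints). Each has a direction, from endpoint $\underline e_i$ to endpoint $\overline e_i$, and is parametrised by $u_i(t)=\underline e_i+t(\overline e_i-\underline e_i)/\|\overline e_i-\underline e_i\|$, $t\in(0,|L_i|)$. For $0\le t_1\le t_2\le|L_i|$, $L_i(t_1,t_2)=\{u_i(t):t\in(t_1,t_2)\}$. Write $L=\{L_1,\dots,L_N\}$ and $L^\cup=\bigcup_i L_i$. For measurable $A\subseteq L^\cup$, $\lambda_1(A)$ is the total length of $A$. **Order.** For $i\ne j$ write $L_i\to L_j$ if there are an index set $I\subseteq\{1,\dots,N\}$ with $i,j\in I$ and a bijection $\psi:\{1,\dots,|I|\}\to I$ with $\psi(1)=i$, $\psi(|I|)=j$ and $\underline e_{\psi(k)}=\overline e_{\psi(k-1)}$ for $k=2,\dots,|I|$. For points $u=u_i(t_1)$, $v=u_j(t_2)$ write $u\to v$ if $L_i\to L_j$ (when $i\neq j$) or $t_1<t_2$ (when $i=j$). $L$ is a *directed acyclic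 linear network (DALN)* if $u\to v$ implies $v\not\to u$ for all $u,v\in L^\cup$. $\Omega$ is the set of bijections $\omega$ of $\{1,\dots,N\}$ such that $L_{\omega(i)}\to L_{\omega(j)}$ implies $i<j$. Put $L^\cup_{\to i}=\bigcup_{j:L_j\to L_i}L_j$, and for $u=u_i(t)$ put $L^\cup_{\to u}=L_i(0,t)\cup L^\cup_{\to i}$. **Conditional intensity.** The conditional intensity function of a temporal point process $\tilde X$ is $\tilde\lambda^*(t)=\mathbb E[N([t,t+dt])\mid\tilde X_t]/dt$, i.e. the mean number of points per unit time in an infinitesimal interval $[t,t+dt]$, conditional on the process $\tilde X_t$ before time $t$. A point pattern on $L$ is a finite subset of $L^\cup$, and a point process on $L$ is a stochastic process whose realisations are point patterns. On a segment $L_i$, let $\tilde\lambda^*$ be the conditional intensity of a temporal point process restricted to $(0,|L_i|)$, allowed to depend also on the point pattern on $L^\cup_{\to i}$. The resulting pattern is mapped to $L_i$ by $u_i$; this is a point process on $L_i$ with conditional intensity $\lambda^*(u)=\tilde\lambda^*(t)$ for $u=u_i(t)$. A point process on $L$ with conditional intensity function $\lambda^*$ is obtained by doing this recursively on $L_{\omega(1)},\dots,L_{\omega(N)}$, $\omega\in\Omega$. In the *marked case* each point has a mark in a mark space $\mathbb M$. The conditional intensity is $\lambda^*(u,m)=\lambda^*(u)f^*(m\mid u)$, where $\lambda^*(u)$ may depend on the points and marks on $L^\cup_{\to u}$, and $f^*(\cdot\mid u)$ is the conditional density of the mark at $u$ given the points and marks on $L^\cup_{\to u}$. Both algorithms simulate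 the process on a segment $L_i$ conditionally on the points already simulated on $L^\cup_{\to i}$. **Inverse method on $L_i$ (unmarked).** For $u=u_i(t)$ let $\Lambda^*(u)=\int_{L_i(0,t)}\lambda^*(v)\,\mathrm d\lambda_1(v)$. The variables $Y_j$ below are IID. 1. Let $j=0$. 2. Repeat: (a) generate $Y_j\sim\mathrm{Exp}(1)$; (b) find $t$ such that $\Lambda^*(u_i(t))=\sum_{k=0}^jY_k$; (c) if $t<|L_i|$, let $j=j+1$ and $x_j=u_i(t)$; else end the repeat loop. 3. Output $(x_1,\dots,x_j)$. **Ogata's modified thinning algorithm on $L_i$ (unmarked).** It is assumed that for any $t\in(0,|L_i|)$ there exist functions $L^*(t)>0$ and $M^*(t)\ge\tilde\lambda^*(s)$ for any $s\in[t,t+L^*(t)]$. These may depend on the already simulated points on $L^\cup_{\to i}$ and on the simulated points in $L_i(0,t)$. 1. Let $t=0$ and $j=0$. 2. Repeat: (a) calculate $M^*(t)$ and $L^*(t)$; (b) generate independently $T\sim\mathrm{Exp}(M^*(t))$ and $U\sim\mathrm{Unif}([0,1])$; (c) if $t+T>|L_i|$, end the repeat loop; (d) else if $T>L^*(t)$, let $t=t+L^*(t)$; (e) else if $U>\tilde\lambda^*(t+T)/M^*(t)$, let $t=t+T$; (f) else let $j=j+1$, $t=t+T$ and $x_j=u_i(t)$. 3. Output $(x_1,\dots,x_j)$. **Marked versions.** Each time a point has been simulated (and kept, for Ogata's algorithm, or moved, for the inverse method), its mark is simulated using the mark density $f^*$; and any function with a star may depend on both points and marks, not just points.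
   Formalization: In Ogata's algorithm, step (c) ends the loop only if also t+L*(t) ≥ |L_i| (as printed it loses points when the intensity rises later), and the loop is assumed to end almost surely for every upstream pattern, since L*(t)>0 alone does not ensure an output. *)

theory Defs
  imports "HOL-Probability.Probability"
begin

section \<open>Directed acyclic linear networks\<close>

record 'a network =
  nseg :: nat
  lower :: "nat \<Rightarrow> 'a"
  upper :: "nat \<Rightarrow> 'a"

definition seg_len :: "'a::euclidean_space network \<Rightarrow> nat \<Rightarrow> real" where
  "seg_len L i = norm (upper L i - lower L i)"

definition seg_pt :: "'a::euclidean_space network \<Rightarrow> nat \<Rightarrow> real \<Rightarrow> 'a" where
  "seg_pt L i t = lower L i + (t / norm (upper L i - lower L i)) *\<^sub>R (upper L i - lower L i)"

definition seg_part :: "'a::euclidean_space network \<Rightarrow> nat \<Rightarrow> real \<Rightarrow> real \<Rightarrow> 'a set" where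
  "seg_part L i t1 t2 = seg_pt L i ` {t1<..<t2}"

definition seg :: "'a::euclidean_space network \<Rightarrow> nat \<Rightarrow> 'a set" where
  "seg L i = open_segment (lower L i) (upper L i)"

definition net :: "'a::euclidean_space network \<Rightarrow> 'a set" where
  "net L = (\<Union>i\<in>{1..nseg L}. seg L i)"

definition linear_network :: "'a::euclidean_space network \<Rightarrow> bool" where
  "linear_network L \<longleftrightarrow>
     (\<forall>i\<in>{1..nseg L}. lower L i \<noteq> upper L i) \<and> disjoint_family_on (seg L) {1..nseg L}"

definition length_measure :: "'a::euclidean_space network \<Rightarrow> 'a measure" where
  "length_measure L = measure_of (net L) (sets (restrict_space borel (net L)))
     (\<lambda>A. \<Sum>i=1..nseg L. emeasure lborel {t \<in> {0<..<seg_len L i}. seg_pt L i t \<in> A})"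

definition seg_before :: "'a::euclidean_space network \<Rightarrow> nat \<Rightarrow> nat \<Rightarrow> bool" where
  "seg_before L i j \<longleftrightarrow> i \<noteq> j \<and>
     (\<exists>I \<psi>. I \<subseteq> {1..nseg L} \<and> i \<in> I \<and> j \<in> I \<and> bij_betw \<psi> {1..card I} I \<and>
        \<psi> 1 = i \<and> \<psi> (card I) = j \<and> (\<forall>k\<in>{2..card I}. lower L (\<psi> k) = upper L (\<psi> (k - 1))))"

definition pt_before :: "'a::euclidean_space network \<Rightarrow> 'a \<Rightarrow> 'a \<Rightarrow> bool" where
  "pt_before L u v \<longleftrightarrow>
     (\<exists>i\<in>{1..nseg L}. \<exists>j\<in>{1..nseg L}. \<exists>t1\<in>{0<..<seg_len L i}. \<exists>t2\<in>{0<..<seg_len L j}.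
        u = seg_pt L i t1 \<and> v = seg_pt L j t2 \<and> (if i = j then t1 < t2 else seg_before L i j))"

definition daln :: "'a::euclidean_space network \<Rightarrow> bool" where
  "daln L \<longleftrightarrow> linear_network L \<and>
     (\<forall>u\<in>net L. \<forall>v\<in>net L. pt_before L u v \<longrightarrow> \<not> pt_before L v u)"

definition seg_orders :: "'a::euclidean_space network \<Rightarrow> (nat \<Rightarrow> nat) set" where
  "seg_orders L = {\<omega>. bij_betw \<omega> {1..nseg L} {1..nseg L} \<and>
     (\<forall>i\<in>{1..nseg L}. \<forall>j\<in>{1..nseg L}. seg_before L (\<omega> i) (\<omega> j) \<longrightarrow> i < j)}"

definition up_seg :: "'a::euclidean_space network \<Rightarrow> nat \<Rightarrow> 'a set" where
  "up_seg L i = (\<Union>j\<in>{j \<in> {1..nseg L}. seg_before L j i}. seg L j)"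

text \<open>On a linear network the pair \<open>(i, t)\<close> is determined by \<open>u\<close>; the set is empty off the network.\<close>

definition up_pt :: "'a::euclidean_space network \<Rightarrow> 'a \<Rightarrow> 'a set" where
  "up_pt L u = \<Union>{seg_part L i 0 t \<union> up_seg L i |i t.
     i \<in> {1..nseg L} \<and> 0 < t \<and> t < seg_len L i \<and> u = seg_pt L i t}"


section \<open>Point patterns, with or without marks\<close>

text \<open>A point of type \<open>'p\<close> sits at the place \<open>loc p\<close> of the network. \<open>pts\<close> turns a measure on
  places into the reference measure on points over these places: without marks the points are the
  places themselves, with marks they are pairs of a place and a mark, and the reference measure is
  the product with the measure \<open>\<nu>\<close> with respect to which the mark densities are taken.\<close>

record ('a, 'p) point_kind =
  loc :: "'p \<Rightarrow> 'a"
  pts :: "'a measure \<Rightarrow> 'p measure"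

definition unmarked :: "('a, 'a) point_kind" where
  "unmarked = \<lparr>loc = (\<lambda>u. u), pts = (\<lambda>\<mu>. \<mu>)\<rparr>"

definition marked :: "'m measure \<Rightarrow> ('a, 'a \<times> 'm) point_kind" where
  "marked \<nu> = \<lparr>loc = fst, pts = (\<lambda>\<mu>. \<mu> \<Otimes>\<^sub>M \<nu>)\<rparr>"

text \<open>A pattern carries at most one point (one mark) at each place. The sigma-algebra is the one
  generated by the numbers of points in measurable sets.\<close>

definition pattern_space :: "('p \<Rightarrow> 'a) \<Rightarrow> 'p measure \<Rightarrow> 'p set measure" where
  "pattern_space l B = sigma {X. finite X \<and> X \<subseteq> space B \<and> inj_on l X}
     {{X. finite X \<and> X \<subseteq> space B \<and> inj_on l X \<and> card (X \<inter> A) = n} |A n. A \<in> sets B}"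

definition points_on ::
    "'a::euclidean_space network \<Rightarrow> ('a, 'p) point_kind \<Rightarrow> 'a set \<Rightarrow> 'p measure" where
  "points_on L \<kappa> A = pts \<kappa> (restrict_space (length_measure L) A)"

definition patterns_on ::
    "'a::euclidean_space network \<Rightarrow> ('a, 'p) point_kind \<Rightarrow> 'a set \<Rightarrow> 'p set measure" where
  "patterns_on L \<kappa> A = pattern_space (loc \<kappa>) (points_on L \<kappa> A)"

definition past ::
    "'a::euclidean_space network \<Rightarrow> ('a, 'p) point_kind \<Rightarrow> 'a \<Rightarrow> 'p set \<Rightarrow> 'p set" where
  "past L \<kappa> u X = {q \<in> X. loc \<kappa> q \<in> up_pt L u}"


section \<open>Conditional intensities\<close>

text \<open>\<open>P\<close> is the law of a simple point process \<open>X\<close> of points with time coordinate \<open>tm\<close>. Its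
  conditional intensity \<open>g\<close> is the conditional mean number of points per unit of the reference
  measure \<open>B\<close> (Lebesgue measure in time, or its product with the reference measure on the marks)
  given the process \<open>X_t = {q \<in> X. tm q < t}\<close> before time \<open>t\<close>, i.e. \<open>E (N(dp) | X_t) = g p X_t B(dp)\<close>.
  A conditional mean is pinned down only up to null sets, so this is read in integrated form: for
  every measurable set \<open>D\<close> of pairs (point, earlier pattern), the mean number of points \<open>p\<close> with
  \<open>(p, X_t) \<in> D\<close> is the mean of the integral of \<open>g p X_t\<close> over the \<open>p\<close> with \<open>(p, X_t) \<in> D\<close>. Both
  sides may be infinite.\<close>

definition has_cond_intensity ::
    "('p \<Rightarrow> 'a) \<Rightarrow> 'p measure \<Rightarrow> ('p \<Rightarrow> real) \<Rightarrow> 'p set measure \<Rightarrow> ('p \<Rightarrow> 'p set \<Rightarrow> real) \<Rightarrow> bool" where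
  "has_cond_intensity l B tm P g \<longleftrightarrow>
     prob_space P \<and> sets P = sets (pattern_space l B) \<and>
     (\<forall>D \<in> sets (B \<Otimes>\<^sub>M pattern_space l B).
        (\<integral>\<^sup>+X. of_nat (card {p \<in> X. (p, {q \<in> X. tm q < tm p}) \<in> D}) \<partial>P) =
        (\<integral>\<^sup>+X. (\<integral>\<^sup>+p. indicator D (p, {q \<in> X. tm q < tm p}) *
                      ennreal (g p {q \<in> X. tm q < tm p}) \<partial>B) \<partial>P))"

text \<open>\<open>dist (lower L i) u = t\<close> for \<open>u = seg_pt L i t\<close> and \<open>t \<ge> 0\<close>. The intensity on the segment may also depend
  on the part upstream of the segment of the pattern \<open>H\<close> already given.\<close>

definition seg_process ::
    "'a::euclidean_space network \<Rightarrow> ('a, 'p) point_kind \<Rightarrow> ('p \<Rightarrow> 'p set \<Rightarrow> real) \<Rightarrow>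
     nat \<Rightarrow> 'p set \<Rightarrow> 'p set measure \<Rightarrow> bool" where
  "seg_process L \<kappa> g i H P \<longleftrightarrow>
     has_cond_intensity (loc \<kappa>) (points_on L \<kappa> (seg L i)) (\<lambda>p. dist (lower L i) (loc \<kappa> p)) P
       (\<lambda>p Y. g p (past L \<kappa> (loc \<kappa> p) (H \<union> Y)))"

definition cond_intensity_function ::
    "'a::euclidean_space network \<Rightarrow> ('a, 'p) point_kind \<Rightarrow> ('p \<Rightarrow> 'p set \<Rightarrow> real) \<Rightarrow> bool" where
  "cond_intensity_function L \<kappa> g \<longleftrightarrow>
     (\<forall>p \<in> space (points_on L \<kappa> (net L)). \<forall>X \<in> space (patterns_on L \<kappa> (up_pt L (loc \<kappa> p))). 0 \<le> g p X) \<and>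
     (\<lambda>(p, X). g p (past L \<kappa> (loc \<kappa> p) X))
       \<in> borel_measurable (points_on L \<kappa> (net L) \<Otimes>\<^sub>M patterns_on L \<kappa> (net L)) \<and>
     (\<forall>i\<in>{1..nseg L}. \<forall>H \<in> space (patterns_on L \<kappa> (up_seg L i)). \<exists>P. seg_process L \<kappa> g i H P)"

definition mark_density ::
    "'a::euclidean_space network \<Rightarrow> 'm measure \<Rightarrow> ('a \<Rightarrow> ('a \<times> 'm) set \<Rightarrow> 'm \<Rightarrow> real) \<Rightarrow> bool" where
  "mark_density L \<nu> f \<longleftrightarrow>
     (\<forall>u \<in> net L. \<forall>X \<in> space (patterns_on L (marked \<nu>) (up_pt L u)).
        (\<forall>m \<in> space \<nu>. 0 \<le> f u X m) \<and> (\<integral>\<^sup>+m. ennreal (f u X m) \<partial>\<nu>) = 1) \<and>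
     (\<lambda>((u, X), m). f u (past L (marked \<nu>) u X) m)
       \<in> borel_measurable ((restrict_space borel (net L) \<Otimes>\<^sub>M patterns_on L (marked \<nu>) (net L)) \<Otimes>\<^sub>M \<nu>)"

definition marked_intensity ::
    "('a \<Rightarrow> ('a \<times> 'm) set \<Rightarrow> real) \<Rightarrow> ('a \<Rightarrow> ('a \<times> 'm) set \<Rightarrow> 'm \<Rightarrow> real) \<Rightarrow>
     'a \<times> 'm \<Rightarrow> ('a \<times> 'm) set \<Rightarrow> real" where
  "marked_intensity lam f = (\<lambda>(u, m) X. lam u X * f u X m)"

definition first_segs :: "'a::euclidean_space network \<Rightarrow> (nat \<Rightarrow> nat) \<Rightarrow> nat \<Rightarrow> 'a set" where
  "first_segs L \<omega> k = (\<Union>j\<in>{1..k}. seg L (\<omega> j))"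

text \<open>The pattern \<open>H\<close> on the first \<open>k\<close> segments has law \<open>P\<close>; given \<open>H\<close>, the pattern on the next
  segment has law \<open>K H\<close>.\<close>

definition add_segment ::
    "'a::euclidean_space network \<Rightarrow> ('a, 'p) point_kind \<Rightarrow> (nat \<Rightarrow> nat) \<Rightarrow> nat \<Rightarrow>
     'p set measure \<Rightarrow> ('p set \<Rightarrow> 'p set measure) \<Rightarrow> 'p set measure" where
  "add_segment L \<kappa> \<omega> k P K =
     P \<bind> (\<lambda>H. K H \<bind> (\<lambda>Y. return (patterns_on L \<kappa> (first_segs L \<omega> (Suc k))) (H \<union> Y)))"

primrec process_upto ::
    "'a::euclidean_space network \<Rightarrow> ('a, 'p) point_kind \<Rightarrow> ('p \<Rightarrow> 'p set \<Rightarrow> real) \<Rightarrow>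
     (nat \<Rightarrow> nat) \<Rightarrow> nat \<Rightarrow> 'p set measure \<Rightarrow> bool" where
  "process_upto L \<kappa> g \<omega> 0 P \<longleftrightarrow> P = return (patterns_on L \<kappa> (first_segs L \<omega> 0)) {}"
| "process_upto L \<kappa> g \<omega> (Suc k) P \<longleftrightarrow>
     (\<exists>P0 K. process_upto L \<kappa> g \<omega> k P0 \<and>
        K \<in> patterns_on L \<kappa> (first_segs L \<omega> k) \<rightarrow>\<^sub>M prob_algebra (patterns_on L \<kappa> (seg L (\<omega> (Suc k)))) \<and>
        (\<forall>H \<in> space (patterns_on L \<kappa> (first_segs L \<omega> k)). seg_process L \<kappa> g (\<omega> (Suc k)) H (K H)) \<and>
        P = add_segment L \<kappa> \<omega> k P0 K)"

definition network_process ::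
    "'a::euclidean_space network \<Rightarrow> ('a, 'p) point_kind \<Rightarrow> ('p \<Rightarrow> 'p set \<Rightarrow> real) \<Rightarrow>
     (nat \<Rightarrow> nat) \<Rightarrow> 'p set measure \<Rightarrow> bool" where
  "network_process L \<kappa> g \<omega> P \<longleftrightarrow>
     prob_space P \<and> sets P = sets (patterns_on L \<kappa> (net L)) \<and>
     \<omega> \<in> seg_orders L \<and> process_upto L \<kappa> g \<omega> (nseg L) P"


section \<open>The algorithms\<close>

text \<open>The variables of a repeat loop: whether the loop has ended; the running sum of the
  exponential variables (inverse method) or the current time (thinning); the points simulated
  so far on the segment.\<close>

type_synonym 'p sim_state = "bool \<times> real \<times> 'p set"

definition state_space ::
    "'a::euclidean_space network \<Rightarrow> ('a, 'p) point_kind \<Rightarrow> nat \<Rightarrow> 'p sim_state measure" where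
  "state_space L \<kappa> i = count_space UNIV \<Otimes>\<^sub>M (borel \<Otimes>\<^sub>M patterns_on L \<kappa> (seg L i))"

text \<open>How a place \<open>u\<close> becomes a point, with the rest of the program as last argument.\<close>

type_synonym ('a, 'p) marking =
  "'a \<Rightarrow> 'p set \<Rightarrow> ('p \<Rightarrow> 'p sim_state measure) \<Rightarrow> 'p sim_state measure"

definition no_mark :: "('a, 'a) marking" where
  "no_mark u X rest = rest u"

definition draw_mark ::
    "'m measure \<Rightarrow> ('a \<Rightarrow> ('a \<times> 'm) set \<Rightarrow> 'm \<Rightarrow> real) \<Rightarrow> ('a, 'a \<times> 'm) marking" where
  "draw_mark \<nu> f u X rest = density \<nu> (\<lambda>m. ennreal (f u X m)) \<bind> (\<lambda>m. rest (u, m))"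

text \<open>The test fails only on null events of the algorithms (for instance when an exponential
  variable is \<open>0\<close>); it keeps \<open>Y\<close> a pattern on the segment.\<close>

definition put_point ::
    "'a::euclidean_space network \<Rightarrow> ('a, 'p) point_kind \<Rightarrow> ('a, 'p) marking \<Rightarrow>
     nat \<Rightarrow> 'p set \<Rightarrow> real \<Rightarrow> 'p set \<Rightarrow> ('p set \<Rightarrow> 'p sim_state measure) \<Rightarrow> 'p sim_state measure" where
  "put_point L \<kappa> mk i H t Y rest =
     (if 0 < t \<and> t < seg_len L i \<and> (\<forall>q\<in>Y. loc \<kappa> q \<in> seg_part L i 0 t)
      then mk (seg_pt L i t) (past L \<kappa> (seg_pt L i t) (H \<union> Y)) (\<lambda>p. rest (insert p Y))
      else rest Y)"

definition exp_law :: "real \<Rightarrow> real measure" where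
  "exp_law r = density lborel (\<lambda>x. ennreal (exponential_density r x))"

definition cum_intensity ::
    "'a::euclidean_space network \<Rightarrow> ('a, 'p) point_kind \<Rightarrow> ('a \<Rightarrow> 'p set \<Rightarrow> real) \<Rightarrow>
     nat \<Rightarrow> 'p set \<Rightarrow> real \<Rightarrow> ennreal" where
  "cum_intensity L \<kappa> lam i X t =
     (\<integral>\<^sup>+v\<in>seg_part L i 0 t. ennreal (lam v (past L \<kappa> v X)) \<partial>length_measure L)"

text \<open>If a solution \<open>t\<close> exists on the segment it is almost surely unique, and the least one is
  taken; if there is none the loop ends.\<close>

definition inverse_step ::
    "'a::euclidean_space network \<Rightarrow> ('a, 'p) point_kind \<Rightarrow> ('a, 'p) marking \<Rightarrow> ('a \<Rightarrow> 'p set \<Rightarrow> real) \<Rightarrow>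
     nat \<Rightarrow> 'p set \<Rightarrow> 'p sim_state \<Rightarrow> 'p sim_state measure" where
  "inverse_step L \<kappa> mk lam i H = (\<lambda>(ended, s, Y).
     if ended then return (state_space L \<kappa> i) (ended, s, Y)
     else exp_law 1 \<bind> (\<lambda>y.
       let sol = {t \<in> {0<..<seg_len L i}. cum_intensity L \<kappa> lam i (H \<union> Y) t = ennreal (s + y)}
       in if sol \<noteq> {}
          then put_point L \<kappa> mk i H (Inf sol) Y (\<lambda>Y'. return (state_space L \<kappa> i) (False, s + y, Y'))
          else return (state_space L \<kappa> i) (True, s + y, Y)))"

text \<open>The intensity in the time coordinate of the segment, \<open>0\<close> outside of \<open>(0, |L_i|)\<close>.\<close>

definition seg_rate ::
    "'a::euclidean_space network \<Rightarrow> ('a, 'p) point_kind \<Rightarrow> ('a \<Rightarrow> 'p set \<Rightarrow> real) \<Rightarrow>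
     nat \<Rightarrow> 'p set \<Rightarrow> real \<Rightarrow> real" where
  "seg_rate L \<kappa> lam i X t =
     (if 0 < t \<and> t < seg_len L i then lam (seg_pt L i t) (past L \<kappa> (seg_pt L i t) X) else 0)"

definition up_part ::
    "'a::euclidean_space network \<Rightarrow> ('a, 'p) point_kind \<Rightarrow> nat \<Rightarrow> 'p set \<Rightarrow> 'p set" where
  "up_part L \<kappa> i H = {q \<in> H. loc \<kappa> q \<in> up_seg L i}"

text \<open>The candidate \<open>t + T > |L_i|\<close> may end the loop only if the bound \<open>Ms\<close> on which it rests is
  valid up to the end of the segment, i.e. \<open>t + Ls \<ge> |L_i|\<close>. Otherwise \<open>T > Ls\<close>, and the simulation
  has to go on from \<open>t + Ls\<close>: ending it there would lose points, for instance if the intensity is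
  small near the start of the segment and large near its end.\<close>

definition ogata_step ::
    "'a::euclidean_space network \<Rightarrow> ('a, 'p) point_kind \<Rightarrow> ('a, 'p) marking \<Rightarrow> ('a \<Rightarrow> 'p set \<Rightarrow> real) \<Rightarrow>
     (real \<Rightarrow> 'p set \<Rightarrow> real) \<Rightarrow> (real \<Rightarrow> 'p set \<Rightarrow> real) \<Rightarrow>
     nat \<Rightarrow> 'p set \<Rightarrow> 'p sim_state \<Rightarrow> 'p sim_state measure" where
  "ogata_step L \<kappa> mk lam Ls Ms i H = (\<lambda>(ended, t, Y).
     if ended then return (state_space L \<kappa> i) (ended, t, Y)
     else
       let l = Ls t (up_part L \<kappa> i H \<union> Y); m = Ms t (up_part L \<kappa> i H \<union> Y)
       in exp_law m \<bind> (\<lambda>T. uniform_measure lborel {0..1} \<bind> (\<lambda>U.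
            if t + T > seg_len L i \<and> t + l \<ge> seg_len L i
              then return (state_space L \<kappa> i) (True, t, Y)
            else if T > l
              then return (state_space L \<kappa> i) (False, t + l, Y)
            else if U > seg_rate L \<kappa> lam i (H \<union> Y) (t + T) / m
              then return (state_space L \<kappa> i) (False, t + T, Y)
            else put_point L \<kappa> mk i H (t + T) Y (\<lambda>Y'. return (state_space L \<kappa> i) (False, t + T, Y')))))"

text \<open>\<open>loop_law S step s n\<close> is the law of the state after \<open>n\<close> iterations. Ended states are kept by
  the steps, so the supremum below is the limit of the probabilities that the loop has ended
  within \<open>n\<close> iterations with output in \<open>A\<close>.\<close>

primrec loop_law :: "'s measure \<Rightarrow> ('s \<Rightarrow> 's measure) \<Rightarrow> 's \<Rightarrow> nat \<Rightarrow> 's measure" where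
  "loop_law S step s 0 = return S s"
| "loop_law S step s (Suc n) = loop_law S step s n \<bind> step"

definition loop_output ::
    "'a::euclidean_space network \<Rightarrow> ('a, 'p) point_kind \<Rightarrow> nat \<Rightarrow>
     ('p sim_state \<Rightarrow> 'p sim_state measure) \<Rightarrow> 'p set measure" where
  "loop_output L \<kappa> i step =
     measure_of (space (patterns_on L \<kappa> (seg L i))) (sets (patterns_on L \<kappa> (seg L i)))
       (\<lambda>A. SUP n. emeasure (loop_law (state_space L \<kappa> i) step (False, 0, {}) n) ({True} \<times> UNIV \<times> A))"

definition loop_ends ::
    "'a::euclidean_space network \<Rightarrow> ('a, 'p) point_kind \<Rightarrow> nat \<Rightarrow>
     ('p sim_state \<Rightarrow> 'p sim_state measure) \<Rightarrow> bool" where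
  "loop_ends L \<kappa> i step \<longleftrightarrow>
     (SUP n. emeasure (loop_law (state_space L \<kappa> i) step (False, 0, {}) n)
        ({True} \<times> UNIV \<times> space (patterns_on L \<kappa> (seg L i)))) = 1"

text \<open>\<open>Ogata Ls Ms\<close>: the arguments of \<open>Ls\<close> and \<open>Ms\<close> are the time and the points simulated so far,
  upstream and on the segment; the latter include a point just accepted at the current time.\<close>

datatype 'p sim_alg =
    Inverse
  | Ogata "real \<Rightarrow> 'p set \<Rightarrow> real" "real \<Rightarrow> 'p set \<Rightarrow> real"

definition alg_step ::
    "'a::euclidean_space network \<Rightarrow> ('a, 'p) point_kind \<Rightarrow> ('a, 'p) marking \<Rightarrow> ('a \<Rightarrow> 'p set \<Rightarrow> real) \<Rightarrow>
     'p sim_alg \<Rightarrow> nat \<Rightarrow> 'p set \<Rightarrow> 'p sim_state \<Rightarrow> 'p sim_state measure" where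
  "alg_step L \<kappa> mk lam alg i H =
     (case alg of Inverse \<Rightarrow> inverse_step L \<kappa> mk lam i H
        | Ogata Ls Ms \<Rightarrow> ogata_step L \<kappa> mk lam Ls Ms i H)"

text \<open>The standing assumption on \<open>Ls\<close> and \<open>Ms\<close>. As \<open>Ms\<close> is the rate of an exponential
  distribution, it is positive.\<close>

definition ogata_bounds ::
    "'a::euclidean_space network \<Rightarrow> ('a, 'p) point_kind \<Rightarrow> ('a \<Rightarrow> 'p set \<Rightarrow> real) \<Rightarrow> nat \<Rightarrow>
     (real \<Rightarrow> 'p set \<Rightarrow> real) \<Rightarrow> (real \<Rightarrow> 'p set \<Rightarrow> real) \<Rightarrow> bool" where
  "ogata_bounds L \<kappa> lam i Ls Ms \<longleftrightarrow>
     (\<lambda>(t, X). Ls t X) \<in> borel_measurable (borel \<Otimes>\<^sub>M patterns_on L \<kappa> (up_seg L i \<union> seg L i)) \<and>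
     (\<lambda>(t, X). Ms t X) \<in> borel_measurable (borel \<Otimes>\<^sub>M patterns_on L \<kappa> (up_seg L i \<union> seg L i)) \<and>
     (\<forall>H \<in> space (patterns_on L \<kappa> (up_seg L i)). \<forall>t\<in>{0..<seg_len L i}.
        \<forall>Y \<in> space (patterns_on L \<kappa> (seg L i)). loc \<kappa> ` Y \<subseteq> seg_pt L i ` {0<..t} \<longrightarrow>
          0 < Ls t (H \<union> Y) \<and> 0 < Ms t (H \<union> Y) \<and>
          (\<forall>s\<in>{t..t + Ls t (H \<union> Y)}. seg_rate L \<kappa> lam i (H \<union> Y) s \<le> Ms t (H \<union> Y)))"

definition alg_applicable ::
    "'a::euclidean_space network \<Rightarrow> ('a, 'p) point_kind \<Rightarrow> ('a, 'p) marking \<Rightarrow> ('a \<Rightarrow> 'p set \<Rightarrow> real) \<Rightarrow>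
     'p sim_alg \<Rightarrow> nat \<Rightarrow> bool" where
  "alg_applicable L \<kappa> mk lam alg i \<longleftrightarrow>
     (case alg of Inverse \<Rightarrow> True
        | Ogata Ls Ms \<Rightarrow> ogata_bounds L \<kappa> lam i Ls Ms \<and>
            (\<forall>H \<in> space (patterns_on L \<kappa> (up_seg L i)).
               loop_ends L \<kappa> i (ogata_step L \<kappa> mk lam Ls Ms i H)))"

primrec simulate_upto ::
    "'a::euclidean_space network \<Rightarrow> ('a, 'p) point_kind \<Rightarrow> ('a, 'p) marking \<Rightarrow> ('a \<Rightarrow> 'p set \<Rightarrow> real) \<Rightarrow>
     (nat \<Rightarrow> 'p sim_alg) \<Rightarrow> (nat \<Rightarrow> nat) \<Rightarrow> nat \<Rightarrow> 'p set measure" where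
  "simulate_upto L \<kappa> mk lam alg \<omega> 0 = return (patterns_on L \<kappa> (first_segs L \<omega> 0)) {}"
| "simulate_upto L \<kappa> mk lam alg \<omega> (Suc k) =
     add_segment L \<kappa> \<omega> k (simulate_upto L \<kappa> mk lam alg \<omega> k)
       (\<lambda>H. loop_output L \<kappa> (\<omega> (Suc k))
              (alg_step L \<kappa> mk lam (alg (\<omega> (Suc k))) (\<omega> (Suc k)) H))"

definition simulation ::
    "'a::euclidean_space network \<Rightarrow> ('a, 'p) point_kind \<Rightarrow> ('a, 'p) marking \<Rightarrow> ('a \<Rightarrow> 'p set \<Rightarrow> real) \<Rightarrow>
     (nat \<Rightarrow> 'p sim_alg) \<Rightarrow> (nat \<Rightarrow> nat) \<Rightarrow> 'p set measure" where
  "simulation L \<kappa> mk lam alg \<omega> = simulate_upto L \<kappa> mk lam alg \<omega> (nseg L)"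

end

theory Submission
  imports Defs
begin

text \<open>On each segment there is, by assumption, a law \<open>P\<close> with the prescribed conditional intensity.
  The output law of either loop is \<open>P\<close>; this gives the intensity of the output, and also that the
  inverse method ends. For a test function \<open>\<psi> \<le> 1\<close> that vanishes on patterns with more than \<open>N\<close>
  points, let \<open>v(Y, t)\<close> be the mean of \<open>\<psi>\<close> over the continuations of the pattern \<open>Y\<close> after time \<open>t\<close>,
  computed from the rates and the exponential survival probabilities. Along a pattern \<open>X\<close> the
  increments of \<open>v\<close> at the points of \<open>X\<close> balance its drift between them, and the intensity of \<open>P\<close>
  turns sums over the points into time integrals; hence the mean of \<open>\<psi>\<close> under \<open>P\<close> is \<open>v({}, 0)\<close>. On
  the other hand, the mean of \<open>v\<close> after one iteration of a loop is at least \<open>v\<close> before it. So every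
  event is at least as likely under the output law as under \<open>P\<close>, and since \<open>P\<close> has mass \<open>1\<close>, the two
  laws agree.\<close>

section \<open>Cumulative rates on the real line\<close>

text \<open>Two obstacles shape the argument. The mean number of points of \<open>P\<close> may be
  infinite, so sums over points cannot be cancelled freely; the cap on the number of points leaves
  at most \<open>N + 1\<close> nonzero terms in each sum, each at most 1. And the rate may have an
  infinite integral over the segment, so \<open>val\<close> is a supremum of iterates in
  \<open>ennreal\<close> and every identity is arranged without subtraction. Where the cumulative
  rate jumps from a finite value to infinity, \<open>val\<close> loses probability; this is why only
  lower bounds are claimed for the loops, and why the existence of \<open>P\<close>, which brings
  the full mass 1, is what turns them into equalities.

  The two loops differ in why no value remains in states that have not ended. An iteration of the
  inverse method that goes on adds a point almost surely, so after \<open>N + 1\<close> iterations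
  the cap has removed all value from such states. A rejected candidate adds no point; for thinning
  the almost sure end of the loop is an assumption, and it is used explicitly.\<close>

definition expn :: "ennreal \<Rightarrow> ennreal" where
  "expn x = (if x = \<top> then 0 else ennreal (exp (- enn2real x)))"

text \<open>Values in \<open>ennreal\<close>, since a rate may have an infinite integral. The
  condition sits in the integrand, so that measurability in variable endpoints is that of an
  integral with a parameter; for \<open>b < a\<close> the value is 0.\<close>

definition ivl :: "real \<Rightarrow> real \<Rightarrow> (real \<Rightarrow> ennreal) \<Rightarrow> ennreal" where
  "ivl a b h = (\<integral>\<^sup>+x. (if a \<le> x \<and> x \<le> b then h x else 0) \<partial>lborel)"

lemma measurable_expn[measurable]: "expn \<in> borel_measurable borel"
  unfolding expn_def by measurable

lemma expn_0[simp]: "expn 0 = 1"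
  by (simp add: expn_def)

lemma expn_top[simp]: "expn \<top> = 0"
  by (simp add: expn_def)

lemma expn_ennreal: "0 \<le> x \<Longrightarrow> expn (ennreal x) = ennreal (exp (- x))"
  by (simp add: expn_def)

lemma expn_add: "expn (x + y) = expn x * expn y"
  by (cases x; cases y)
     (auto simp: expn_ennreal mult_exp_exp simp flip: ennreal_plus ennreal_mult)

lemma ivl_split:
  assumes [measurable]: "h \<in> borel_measurable borel" and "a \<le> b" "b \<le> c"
  shows "ivl a c h = ivl a b h + ivl b c h"
  unfolding ivl_def using assms(2,3) AE_lborel_singleton[of b]
  by (subst nn_integral_add[symmetric]) (auto intro!: nn_integral_cong_AE)

lemma ivl_point[simp]: "ivl a a h = 0"
proof -
  have "ivl a a h = (\<integral>\<^sup>+x. 0 \<partial>(lborel :: real measure))"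
    unfolding ivl_def using AE_lborel_singleton[of a] by (intro nn_integral_cong_AE) auto
  then show ?thesis by simp
qed

lemma ivl_cong_less:
  assumes "\<And>x. a < x \<Longrightarrow> x < b \<Longrightarrow> g x = h x"
  shows "ivl a b g = ivl a b h"
  unfolding ivl_def using AE_lborel_singleton[of a] AE_lborel_singleton[of b]
proof (intro nn_integral_cong_AE, eventually_elim)
  fix x assume "x \<noteq> a" "x \<noteq> b"
  then show "(if a \<le> x \<and> x \<le> b then g x else 0) = (if a \<le> x \<and> x \<le> b then h x else 0)"
    using assms[of x] by auto
qed

lemma ivl_mono: "(\<And>x. a \<le> x \<Longrightarrow> x \<le> b \<Longrightarrow> g x \<le> h x) \<Longrightarrow> ivl a b g \<le> ivl a b h"
  unfolding ivl_def by (intro nn_integral_mono) auto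

lemma ivl_mono_bound: "b \<le> c \<Longrightarrow> ivl a b h \<le> ivl a c h"
  unfolding ivl_def by (intro nn_integral_mono) auto

lemma ivl_cmult:
  "h \<in> borel_measurable borel \<Longrightarrow> ivl a b (\<lambda>x. c * h x) = c * ivl a b h"
  unfolding ivl_def
  by (subst nn_integral_cmult[symmetric]) (auto intro!: nn_integral_cong)

lemma ivl_add:
  "g \<in> borel_measurable borel \<Longrightarrow> h \<in> borel_measurable borel \<Longrightarrow>
   ivl a b (\<lambda>x. g x + h x) = ivl a b g + ivl a b h"
  unfolding ivl_def
  by (subst nn_integral_add[symmetric]) (auto intro!: nn_integral_cong)

lemma measurable_ivl[measurable (raw)]:
  assumes [measurable]: "a \<in> borel_measurable M" "b \<in> borel_measurable M"
    "(\<lambda>(y, x). h y x) \<in> borel_measurable (M \<Otimes>\<^sub>M borel)"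
  shows "(\<lambda>y. ivl (a y) (b y) (h y)) \<in> borel_measurable M"
  unfolding ivl_def by measurable

section \<open>Generalised inverse of the cumulative rate and change of time\<close>

definition least_level :: "real \<Rightarrow> real \<Rightarrow> (real \<Rightarrow> ennreal) \<Rightarrow> real \<Rightarrow> real" where
  "least_level a b h y = Inf {x \<in> {a..b}. ennreal y \<le> ivl a x h}"

context
  fixes a b :: real and h :: "real \<Rightarrow> ennreal"
  assumes h[measurable]: "h \<in> borel_measurable borel" and ab: "a \<le> b" and fin: "ivl a b h < \<top>"
begin

text \<open>The cumulative rate is the distribution function of this finite measure. The absence of
  atoms gives its continuity, and uniqueness of measures with a given distribution function gives
  the change of time.\<close>

definition ivl_density :: "real measure" where
  "ivl_density = density lborel (\<lambda>x. if a \<le> x \<and> x \<le> b then h x else 0)"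

lemma emeasure_ivl_density: "emeasure ivl_density {..x} = ivl a (min x b) h"
  unfolding ivl_density_def ivl_def
  by (subst emeasure_density) (auto intro!: nn_integral_cong simp: indicator_def)

lemma finite_borel_measure_ivl_density: "finite_borel_measure ivl_density"
proof (intro finite_borel_measure.intro finite_measureI)
  have "emeasure ivl_density (space ivl_density) = ivl a b h"
    unfolding ivl_density_def ivl_def by (subst emeasure_density) (auto intro!: nn_integral_cong)
  then show "emeasure ivl_density (space ivl_density) \<noteq> \<infinity>" using fin by simp
qed (simp add: ivl_density_def finite_borel_measure_axioms_def)

lemma cdf_ivl_density: "x \<le> b \<Longrightarrow> cdf ivl_density x = enn2real (ivl a x h)"
  by (simp add: cdf_def measure_def emeasure_ivl_density min_def)

lemma isCont_ivl_density: "isCont (cdf ivl_density) x"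
proof -
  interpret finite_borel_measure ivl_density by (rule finite_borel_measure_ivl_density)
  have "emeasure ivl_density {x} = 0"
    unfolding ivl_density_def using AE_lborel_singleton[of x]
    by (subst emeasure_density) (auto simp: nn_integral_0_iff_AE indicator_def elim!: eventually_mono)
  then show ?thesis by (simp add: isCont_cdf measure_def)
qed

lemma ivl_continuous: "continuous_on {a..b} (\<lambda>x. enn2real (ivl a x h))"
proof -
  have "continuous_on {a..b} (cdf ivl_density)"
    using isCont_ivl_density by (simp add: continuous_at_imp_continuous_on)
  then show ?thesis
    by (rule continuous_on_eq) (simp add: cdf_ivl_density)
qed

lemma ivl_finite: "x \<le> b \<Longrightarrow> ivl a x h < \<top>"
  using ivl_mono_bound[of x b a h] fin by (simp add: order_le_less_trans)

text \<open>By continuity the set in the infimum is closed, so its minimum is attained, and the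
  intermediate value theorem excludes that the level is overshot there. The last claim is the Galois
  connection between a monotone function and its generalised inverse, the form that fits
  distribution functions.\<close>

lemma least_level:
  assumes y: "0 \<le> y" "ennreal y \<le> ivl a b h"
  shows "a \<le> least_level a b h y" "least_level a b h y \<le> b"
    "ivl a (least_level a b h y) h = ennreal y"
    "\<And>x. a \<le> x \<Longrightarrow> x \<le> b \<Longrightarrow> ennreal y \<le> ivl a x h \<longleftrightarrow> least_level a b h y \<le> x"
proof -
  let ?H = "\<lambda>x. enn2real (ivl a x h)"
  let ?A = "{x \<in> {a..b}. ennreal y \<le> ivl a x h}"
  let ?z = "least_level a b h y"
  have iff: "ennreal y \<le> ivl a x h \<longleftrightarrow> y \<le> ?H x" if "x \<le> b" for x
    using ivl_finite[OF that] y(1) by (cases "ivl a x h") auto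
  have A: "?A = {x \<in> {a..b}. y \<le> ?H x}" using iff by auto
  have "closed ?A" unfolding A
    by (intro continuous_on_closed_Collect_le continuous_on_const ivl_continuous closed_atLeastAtMost)
  moreover have bdd: "bdd_below ?A" by (auto intro: bdd_belowI[of _ a])
  moreover have ne: "b \<in> ?A" using ab y by auto
  ultimately have z: "?z \<in> ?A"
    unfolding least_level_def by (intro closed_contains_Inf) auto
  then show z1: "a \<le> ?z" "?z \<le> b" by auto
  show "ivl a ?z h = ennreal y"
  proof (rule ccontr)
    assume *: "ivl a ?z h \<noteq> ennreal y"
    then have "y < ?H ?z"
      using z iff[of ?z] ivl_finite[of ?z] y(1) by (cases "ivl a ?z h") auto
    moreover have "?H a \<le> y" using y by simp
    moreover have "continuous_on {a..?z} ?H"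
      by (rule continuous_on_subset[OF ivl_continuous]) (use z1 in auto)
    ultimately obtain x where x: "a \<le> x" "x \<le> ?z" "?H x = y"
      using IVT'[of ?H a y ?z] z1 by auto
    then have "x \<in> ?A" using z1 A by auto
    then have "?z \<le> x" unfolding least_level_def using bdd by (intro cInf_lower)
    with x \<open>y < ?H ?z\<close> show False by simp
  qed
  then show "ennreal y \<le> ivl a x h \<longleftrightarrow> ?z \<le> x" if "a \<le> x" "x \<le> b" for x
    using that bdd ivl_mono_bound[of ?z x a h]
    by (auto simp: least_level_def intro!: cInf_lower)
qed

text \<open>Substitution of the cumulative rate for time, without differentiating it: the image of
  Lebesgue measure on \<open>(0, C)\<close> under \<open>least_level\<close> and the measure with
  density \<open>h\<close> have the same distribution function by the Galois connection, hence are
  equal.\<close>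

lemma time_change:
  assumes G[measurable]: "G \<in> borel_measurable borel" and C: "0 \<le> C" "ivl a b h = ennreal C"
  shows "ivl a b (\<lambda>x. h x * G x) = (\<integral>\<^sup>+y. G (least_level a b h y) * indicator {0<..<C} y \<partial>lborel)"
proof -
  let ?s = "least_level a b h"
  let ?R = "restrict_space lborel {0<..<C}"
  have le: "y \<in> {0<..<C} \<Longrightarrow> ennreal y \<le> ivl a b h" for y
    using C by (simp add: ennreal_leI)
  have "mono_on {0<..<C} ?s"
  proof (rule mono_onI)
    fix r s assume rs: "r \<in> {0<..<C}" "s \<in> {0<..<C}" "r \<le> s"
    have r: "0 \<le> r" "ennreal r \<le> ivl a b h" and s: "0 \<le> s" "ennreal s \<le> ivl a b h"
      using rs le by auto
    have "ennreal r \<le> ivl a (?s s) h"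
      using rs by (simp add: least_level(3)[OF s] ennreal_leI)
    then show "?s r \<le> ?s s"
      by (simp add: least_level(4)[OF r least_level(1)[OF s] least_level(2)[OF s]])
  qed
  from borel_measurable_mono_on_fnc[OF this] have s[measurable]: "?s \<in> borel_measurable ?R"
    by (simp cong: measurable_cong_sets sets_restrict_space_cong)
  have fin_R: "finite_measure ?R"
    using C by (intro finite_measureI) (simp add: space_restrict_space emeasure_restrict_space)
  have eq: "distr ?R borel ?s = ivl_density"
  proof (rule cdf_unique')
    show "finite_borel_measure (distr ?R borel ?s)"
      by (intro finite_borel_measure.intro finite_measure.finite_measure_distr fin_R s)
         (simp add: finite_borel_measure_axioms_def)
    show "finite_borel_measure ivl_density" by (rule finite_borel_measure_ivl_density)
    show "cdf (distr ?R borel ?s) = cdf ivl_density"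
    proof
      fix x
      have "emeasure (distr ?R borel ?s) {..x} = emeasure lborel {y \<in> {0<..<C}. ?s y \<le> x}"
        by (subst emeasure_distr)
           (auto simp: space_restrict_space emeasure_restrict_space intro!: arg_cong[where f="emeasure lborel"])
      also have "\<dots> = ivl a (min x b) h"
      proof (cases "a \<le> x")
        case False
        then have e: "{y \<in> {0<..<C}. ?s y \<le> x} = {}"
          using least_level(1)[OF _ le] by (force simp: not_le)
        have "ivl a (min x b) h = (\<integral>\<^sup>+x. 0 \<partial>(lborel::real measure))"
          unfolding ivl_def using False by (intro nn_integral_cong) auto
        then show ?thesis unfolding e by simp
      next
        case True
        let ?m = "min x b"
        obtain c where c: "0 \<le> c" "ivl a ?m h = ennreal c"
          using ivl_finite[of ?m] by (cases "ivl a ?m h") auto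
        have cC: "c \<le> C"
          using ivl_mono_bound[of ?m b a h] c C by (simp add: min_le_iff_disj)
        have "?s y \<le> x \<longleftrightarrow> y \<le> c" if "y \<in> {0<..<C}" for y
        proof -
          have "?s y \<le> x \<longleftrightarrow> ?s y \<le> ?m" using least_level(2)[of y] that le[of y] by auto
          also have "\<dots> \<longleftrightarrow> ennreal y \<le> ivl a ?m h"
            using least_level(4)[of y ?m] that le[of y] True ab by auto
          finally show ?thesis using c that by simp
        qed
        then have "{y \<in> {0<..<C}. ?s y \<le> x} = {0<..<C} \<inter> {..c}" by auto
        also have "emeasure lborel \<dots> = ennreal c"
        proof (cases "c = C")
          case True
          then have "{0<..<C} \<inter> {..c} = {0<..<C}" by auto
          then show ?thesis using True C by simp
        next
          case False
          then have "{0<..<C} \<inter> {..c} = {0<..c}" using cC by auto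
          then show ?thesis using c by simp
        qed
        finally show ?thesis using c by simp
      qed
      finally show "cdf (distr ?R borel ?s) x = cdf ivl_density x"
        by (simp add: cdf_def measure_def emeasure_ivl_density)
    qed
  qed
  have "ivl a b (\<lambda>x. h x * G x) = (\<integral>\<^sup>+x. G x \<partial>ivl_density)"
    unfolding ivl_def ivl_density_def
    by (subst nn_integral_density) (auto intro!: nn_integral_cong)
  also have "\<dots> = (\<integral>\<^sup>+y. G (?s y) \<partial>?R)"
    unfolding eq[symmetric] by (subst nn_integral_distr) auto
  also have "\<dots> = (\<integral>\<^sup>+y. G (?s y) * indicator {0<..<C} y \<partial>lborel)"
    by (subst nn_integral_restrict_space) auto
  finally show ?thesis .
qed

lemma ivl_finiteE:
  assumes "x \<le> b" obtains c where "0 \<le> c" "ivl a x h = ennreal c"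
  using ivl_finite[OF assms] by (cases "ivl a x h") auto

text \<open>With the cumulative rate as new time the integral is that of exp(- y) over (0, C). In
  terms of points of rate \<open>h\<close>: the first point after \<open>a\<close> comes before
  \<open>b\<close>, or there is none.\<close>

lemma expn_forward: "ivl a b (\<lambda>x. h x * expn (ivl a x h)) + expn (ivl a b h) = 1"
proof -
  obtain C where C: "0 \<le> C" "ivl a b h = ennreal C" using ivl_finiteE[of b] by auto
  have le: "y \<in> {0<..<C} \<Longrightarrow> ennreal y \<le> ivl a b h" for y
    using C by (simp add: ennreal_leI)
  have "ivl a b (\<lambda>x. h x * expn (ivl a x h)) =
      (\<integral>\<^sup>+y. expn (ivl a (least_level a b h y) h) * indicator {0<..<C} y \<partial>lborel)"
    by (rule time_change[OF _ C]) measurable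
  also have "\<dots> = (\<integral>\<^sup>+y. ennreal (exp (- y)) * indicator {0..C} y \<partial>lborel)"
    using AE_lborel_singleton[of 0] AE_lborel_singleton[of C]
  proof (intro nn_integral_cong_AE, eventually_elim)
    fix y :: real assume "y \<noteq> 0" "y \<noteq> C"
    then show "expn (ivl a (least_level a b h y) h) * indicator {0<..<C} y = ennreal (exp (- y)) * indicator {0..C} y"
      using le[of y] least_level(3)[of y] by (auto simp: indicator_def expn_ennreal)
  qed
  also have "\<dots> = ennreal (- exp (- C) - (- exp (- 0)))"
    using C by (intro nn_integral_FTC_Icc) (auto intro!: derivative_eq_intros)
  also have "\<dots> = ennreal (1 - exp (- C))" by simp
  finally show ?thesis using C
    by (simp add: expn_ennreal flip: ennreal_plus)
qed

text \<open>The same change of time with exp(y - C). Here the decomposition is by the last point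
  before \<open>b\<close> instead of the first one after \<open>a\<close>.\<close>

lemma expn_backward: "ivl a b (\<lambda>x. h x * expn (ivl x b h)) + expn (ivl a b h) = 1"
proof -
  obtain C where C: "0 \<le> C" "ivl a b h = ennreal C" using ivl_finiteE[of b] by auto
  have le: "y \<in> {0<..<C} \<Longrightarrow> ennreal y \<le> ivl a b h" for y
    using C by (simp add: ennreal_leI)
  have "ivl a b (\<lambda>x. h x * expn (ivl x b h)) =
      (\<integral>\<^sup>+y. expn (ivl (least_level a b h y) b h) * indicator {0<..<C} y \<partial>lborel)"
    by (rule time_change[OF _ C]) measurable
  also have "\<dots> = (\<integral>\<^sup>+y. ennreal (exp (y - C)) * indicator {0..C} y \<partial>lborel)"
    using AE_lborel_singleton[of 0] AE_lborel_singleton[of C]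
  proof (intro nn_integral_cong_AE, eventually_elim)
    fix y :: real assume y: "y \<noteq> 0" "y \<noteq> C"
    have "ivl (least_level a b h y) b h = ennreal (C - y)" if "y \<in> {0<..<C}"
    proof -
      let ?z = "least_level a b h y"
      have "ennreal y + ivl ?z b h = ennreal C"
        using that le[of y] least_level[of y] C ivl_split[OF h, of a ?z b] by auto
      then show ?thesis using that
        by (cases "ivl ?z b h") (auto simp flip: ennreal_plus)
    qed
    then show "expn (ivl (least_level a b h y) b h) * indicator {0<..<C} y = ennreal (exp (y - C)) * indicator {0..C} y"
      using y by (auto simp: indicator_def expn_ennreal)
  qed
  also have "\<dots> = ennreal (exp (C - C) - exp (0 - C))"
    using C by (intro nn_integral_FTC_Icc) (auto intro!: derivative_eq_intros)
  also have "\<dots> = ennreal (1 - exp (- C))" by simp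
  finally show ?thesis using C
    by (simp add: expn_ennreal flip: ennreal_plus)
qed

end

text \<open>Monotone convergence up to the time \<open>z\<close> where the cumulative rate ceases to
  be finite; beyond it the integrand vanishes by the last hypothesis.\<close>

lemma ivl_le_finite_part:
  assumes [measurable]: "h \<in> borel_measurable borel" "G \<in> borel_measurable borel" and ab: "a \<le> b"
    and K: "\<And>c. a \<le> c \<Longrightarrow> c \<le> b \<Longrightarrow> ivl a c h < \<top> \<Longrightarrow> ivl a c G \<le> K"
    and G: "\<And>x. ivl a x h = \<top> \<Longrightarrow> G x = 0"
  shows "ivl a b G \<le> K"
proof (cases "ivl a b h < \<top>")
  case True
  then show ?thesis using K[of b] ab by simp
next
  case False
  define S where "S = {x. a \<le> x \<and> x \<le> b \<and> ivl a x h < \<top>}"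
  define z where "z = Sup S"
  have aS: "a \<in> S" using ab by (simp add: S_def)
  have bdd: "bdd_above S" by (auto simp: S_def intro: bdd_aboveI[of _ b])
  have az: "a \<le> z" unfolding z_def by (intro cSup_upper aS bdd)
  have zb: "z \<le> b" unfolding z_def using aS by (intro cSup_least) (auto simp: S_def)
  have above: "G x = 0" if "z < x" "x \<le> b" for x
  proof (rule G, rule ccontr)
    assume "ivl a x h \<noteq> \<top>"
    then have "x \<in> S" using that az by (simp add: S_def less_top)
    then have "x \<le> z" unfolding z_def by (intro cSup_upper bdd)
    with that show False by simp
  qed
  \<comment> \<open>Increases to \<open>z\<close> but stays below it when \<open>a < z\<close>,
    since the cumulative rate may already be infinite at \<open>z\<close> itself.\<close>
  define c where "c = (\<lambda>n. z - (z - a) * inverse (real (Suc n)))"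
  have c_inc: "incseq c"
    unfolding c_def incseq_def using az by (auto intro!: mult_left_mono le_imp_inverse_le)
  have ca: "a \<le> c n" for n
    unfolding c_def using az mult_left_mono[of "inverse (real (Suc n))" 1 "z - a"] by (simp add: inverse_le_1_iff)
  have cz: "c n \<le> z" for n unfolding c_def using az by simp
  have cfin: "ivl a (c n) h < \<top>" for n
  proof (cases "a = z")
    case True
    then show ?thesis by (simp add: c_def)
  next
    case False
    then have "c n < z" unfolding c_def using az by simp
    then obtain x where "x \<in> S" "c n < x"
      unfolding z_def using less_cSupD[of S "c n"] aS by auto
    then show ?thesis
      using ivl_mono_bound[of "c n" x a h] by (auto simp: S_def order_le_less_trans)
  qed
  have c_lim: "c \<longlonglongrightarrow> z"
  proof -
    have "c \<longlonglongrightarrow> z - (z - a) * 0"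
      unfolding c_def by (intro tendsto_intros LIMSEQ_inverse_real_of_nat)
    then show ?thesis by simp
  qed
  have "ivl a b G \<le> (\<integral>\<^sup>+x. (SUP n. if a \<le> x \<and> x \<le> c n then G x else 0) \<partial>lborel)"
    unfolding ivl_def using AE_lborel_singleton[of z]
  proof (intro nn_integral_mono_AE, eventually_elim)
    fix x assume "x \<noteq> z"
    show "(if a \<le> x \<and> x \<le> b then G x else 0) \<le> (SUP n. if a \<le> x \<and> x \<le> c n then G x else 0)"
    proof (cases "a \<le> x \<and> x < z")
      case True
      then obtain n where "x < c n"
        using order_tendstoD(1)[OF c_lim, of x] by (auto dest!: eventually_happens)
      then show ?thesis using True by (intro SUP_upper2[of n]) auto
    qed (use above[of x] \<open>x \<noteq> z\<close> in auto)
  qed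
  also have "\<dots> = (SUP n. ivl a (c n) G)"
    unfolding ivl_def
    by (rule nn_integral_monotone_convergence_SUP)
       (auto simp: incseq_def le_fun_def intro: order_trans[OF _ incseqD[OF c_inc]])
  also have "\<dots> \<le> K"
    using ca cz zb cfin by (intro SUP_least K) (auto intro: order_trans)
  finally show ?thesis .
qed

text \<open>Equality can fail: if the cumulative rate jumps from a finite value to infinity, the
  survival probability drops to 0 without a matching contribution to the integral.\<close>

lemma expn_forward_le:
  assumes h[measurable]: "h \<in> borel_measurable borel" and ab: "a \<le> b"
  shows "ivl a b (\<lambda>x. h x * expn (ivl a x h)) + expn (ivl a b h) \<le> 1"
proof (cases "ivl a b h < \<top>")
  case True
  then show ?thesis using expn_forward[OF h ab] by simp
next
  case False
  then have "ivl a b h = \<top>" by (simp add: less_top[symmetric])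
  moreover have "ivl a b (\<lambda>x. h x * expn (ivl a x h)) \<le> 1"
  proof (rule ivl_le_finite_part[OF h _ ab])
    fix c assume c: "a \<le> c" "ivl a c h < \<top>"
    have "ivl a c (\<lambda>x. h x * expn (ivl a x h)) \<le> ivl a c (\<lambda>x. h x * expn (ivl a x h)) + expn (ivl a c h)"
      by simp
    then show "ivl a c (\<lambda>x. h x * expn (ivl a x h)) \<le> 1"
      using expn_forward[OF h c] by simp
  qed auto
  ultimately show ?thesis by simp
qed

text \<open>The mean payoff from time \<open>s\<close> on, when the next point has hazard
  \<open>h\<close>: \<open>c\<close> is paid if no point comes before \<open>b\<close>, and
  \<open>G\<close> is the mean payoff at a point, already multiplied by the hazard.\<close>

definition renewal :: "(real \<Rightarrow> ennreal) \<Rightarrow> (real \<Rightarrow> ennreal) \<Rightarrow> ennreal \<Rightarrow> real \<Rightarrow> real \<Rightarrow> ennreal" where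
  "renewal h G c b s = ivl s b (\<lambda>r. G r * expn (ivl s r h)) + expn (ivl s b h) * c"

lemma ivl_cong: "(\<And>x. a \<le> x \<Longrightarrow> x \<le> b \<Longrightarrow> g x = h x) \<Longrightarrow> ivl a b g = ivl a b h"
  by (rule ivl_cong_less) auto

text \<open>Fubini on the triangle a \<le> s \<le> r \<le> b.\<close>

lemma ivl_renewal:
  assumes [measurable]: "w \<in> borel_measurable borel" "h \<in> borel_measurable borel" "G \<in> borel_measurable borel"
  shows "ivl a b (\<lambda>s. w s * renewal h G c b s) =
    ivl a b (\<lambda>r. G r * ivl a r (\<lambda>s. w s * expn (ivl s r h))) + ivl a b (\<lambda>s. w s * expn (ivl s b h)) * c"
proof -
  have "ivl a b (\<lambda>s. w s * ivl s b (\<lambda>r. G r * expn (ivl s r h))) =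
    (\<integral>\<^sup>+s. (\<integral>\<^sup>+r. (if a \<le> s \<and> s \<le> r \<and> r \<le> b then w s * (G r * expn (ivl s r h)) else 0) \<partial>lborel) \<partial>lborel)"
    unfolding ivl_def[of a b] ivl_def[of _ b "\<lambda>r. G r * _ r"]
  proof (intro nn_integral_cong)
    fix s
    show "(if a \<le> s \<and> s \<le> b then w s * (\<integral>\<^sup>+r. (if s \<le> r \<and> r \<le> b then G r * expn (ivl s r h) else 0) \<partial>lborel) else 0)
      = (\<integral>\<^sup>+r. (if a \<le> s \<and> s \<le> r \<and> r \<le> b then w s * (G r * expn (ivl s r h)) else 0) \<partial>lborel)"
    proof (cases "a \<le> s \<and> s \<le> b")
      case True
      then show ?thesis by (auto intro!: nn_integral_cong simp flip: nn_integral_cmult)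
    next
      case False
      then have "(\<integral>\<^sup>+r. (if a \<le> s \<and> s \<le> r \<and> r \<le> b then w s * (G r * expn (ivl s r h)) else 0) \<partial>lborel)
          = (\<integral>\<^sup>+r. 0 \<partial>(lborel::real measure))"
        by (intro nn_integral_cong) auto
      then show ?thesis using False by auto
    qed
  qed
  also have "\<dots> =
    (\<integral>\<^sup>+r. (\<integral>\<^sup>+s. (if a \<le> s \<and> s \<le> r \<and> r \<le> b then w s * (G r * expn (ivl s r h)) else 0) \<partial>lborel) \<partial>lborel)"
    by (rule lborel_pair.Fubini') measurable
  also have "\<dots> = ivl a b (\<lambda>r. G r * ivl a r (\<lambda>s. w s * expn (ivl s r h)))"
  proof -
    have "(\<integral>\<^sup>+s. (if a \<le> s \<and> s \<le> r \<and> r \<le> b then w s * (G r * expn (ivl s r h)) else 0) \<partial>lborel)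
        = (if a \<le> r \<and> r \<le> b then G r * ivl a r (\<lambda>s. w s * expn (ivl s r h)) else 0)" for r
    proof (cases "a \<le> r \<and> r \<le> b")
      case True
      then show ?thesis
        unfolding ivl_def[of a r]
        by (auto intro!: nn_integral_cong simp: mult_ac simp flip: nn_integral_cmult)
    next
      case False
      then have e: "(\<integral>\<^sup>+s. (if a \<le> s \<and> s \<le> r \<and> r \<le> b then w s * (G r * expn (ivl s r h)) else 0) \<partial>lborel)
          = (\<integral>\<^sup>+s. 0 \<partial>(lborel::real measure))"
        by (intro nn_integral_cong) auto
      show ?thesis unfolding e using False by auto
    qed
    then show ?thesis by (simp add: ivl_def[of a b])
  qed
  finally have *: "ivl a b (\<lambda>s. w s * ivl s b (\<lambda>r. G r * expn (ivl s r h))) =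
    ivl a b (\<lambda>r. G r * ivl a r (\<lambda>s. w s * expn (ivl s r h)))" .
  have "ivl a b (\<lambda>s. w s * renewal h G c b s) =
    ivl a b (\<lambda>s. w s * ivl s b (\<lambda>r. G r * expn (ivl s r h))) + ivl a b (\<lambda>s. c * (w s * expn (ivl s b h)))"
    unfolding renewal_def
    by (subst ivl_add[symmetric]) (auto simp: distrib_left mult_ac)
  also have "ivl a b (\<lambda>s. c * (w s * expn (ivl s b h))) = ivl a b (\<lambda>s. w s * expn (ivl s b h)) * c"
    by (subst ivl_cmult) (auto simp: mult_ac)
  finally show ?thesis unfolding * .
qed

text \<open>The integrated form of the backward equation v' = h v - G with v(b) = c, arranged
  without subtraction. After the interchange of the integrals, the terms with \<open>G\<close> and
  those with \<open>c\<close> both collapse by \<open>expn_backward\<close>, which needs a finite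
  cumulative rate.\<close>

lemma renewal_balance:
  assumes h[measurable]: "h \<in> borel_measurable borel" and G[measurable]: "G \<in> borel_measurable borel"
    and ab: "a \<le> b" and fin: "ivl a b h < \<top>"
  shows "renewal h G c b a + ivl a b (\<lambda>s. h s * renewal h G c b s) = c + ivl a b G"
proof -
  have "ivl a b (\<lambda>r. G r * expn (ivl a r h)) + ivl a b (\<lambda>r. G r * ivl a r (\<lambda>s. h s * expn (ivl s r h)))
      = ivl a b (\<lambda>r. G r * expn (ivl a r h) + G r * ivl a r (\<lambda>s. h s * expn (ivl s r h)))"
    by (subst ivl_add) auto
  also have "\<dots> = ivl a b G"
  proof (rule ivl_cong)
    fix r assume r: "a \<le> r" "r \<le> b"
    have "ivl a r h < \<top>" using ivl_mono_bound[OF r(2)] fin by (rule order_le_less_trans)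
    from expn_backward[OF h r(1) this]
    have "G r * (ivl a r (\<lambda>s. h s * expn (ivl s r h)) + expn (ivl a r h)) = G r" by simp
    then show "G r * expn (ivl a r h) + G r * ivl a r (\<lambda>s. h s * expn (ivl s r h)) = G r"
      by (simp add: distrib_left add.commute)
  qed
  finally have 1: "ivl a b (\<lambda>r. G r * expn (ivl a r h)) +
      ivl a b (\<lambda>r. G r * ivl a r (\<lambda>s. h s * expn (ivl s r h))) = ivl a b G" .
  have 2: "(expn (ivl a b h) + ivl a b (\<lambda>s. h s * expn (ivl s b h))) * c = c"
    using expn_backward[OF h ab fin] by (simp add: add.commute)
  have "renewal h G c b a + ivl a b (\<lambda>s. h s * renewal h G c b s) =
     (ivl a b (\<lambda>r. G r * expn (ivl a r h)) + ivl a b (\<lambda>r. G r * ivl a r (\<lambda>s. h s * expn (ivl s r h))))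
     + (expn (ivl a b h) + ivl a b (\<lambda>s. h s * expn (ivl s b h))) * c"
    unfolding ivl_renewal[OF h h G] unfolding renewal_def by (simp add: distrib_right add_ac)
  then show ?thesis unfolding 1 2 by (simp add: add.commute)
qed

text \<open>Thinning: the candidates of rate \<open>k + h\<close> are rejected at rate \<open>k\<close>.\<close>

lemma renewal_thinning:
  assumes k[measurable]: "k \<in> borel_measurable borel" and h[measurable]: "h \<in> borel_measurable borel"
    and G[measurable]: "G \<in> borel_measurable borel" and ab: "a \<le> b" and fin: "ivl a b k < \<top>"
  shows "renewal h G c b a = expn (ivl a b (\<lambda>x. k x + h x)) * c +
    ivl a b (\<lambda>s. expn (ivl a s (\<lambda>x. k x + h x)) * (k s * renewal h G c b s + G s))"
proof -
  \<comment> \<open>The density of a first candidate at \<open>s\<close> that is rejected. Followed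
    by survival under \<open>h\<close> from \<open>s\<close> to \<open>r\<close> it leaves survival
    under \<open>h\<close> from \<open>a\<close> to \<open>r\<close>, so the time of rejection
    integrates out by the forward identity for \<open>k\<close>.\<close>
  define w where "w s = expn (ivl a s k) * expn (ivl a s h) * k s" for s
  have [measurable]: "w \<in> borel_measurable borel" unfolding w_def by measurable
  have kh: "expn (ivl a s (\<lambda>x. k x + h x)) = expn (ivl a s k) * expn (ivl a s h)" for s
    by (simp add: ivl_add expn_add)
  have w: "ivl a r (\<lambda>s. w s * expn (ivl s r h)) = expn (ivl a r h) * ivl a r (\<lambda>s. k s * expn (ivl a s k))"
    for r
    by (subst ivl_cmult[symmetric])
       (auto intro!: ivl_cong simp: w_def ivl_split[of h a _ r] expn_add mult_ac)
  have fwd: "ivl a r (\<lambda>s. k s * expn (ivl a s k)) + expn (ivl a r k) = 1" if "a \<le> r" "r \<le> b" for r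
    by (rule expn_forward[OF k that(1)]) (use ivl_mono_bound[OF that(2)] fin in \<open>rule order_le_less_trans\<close>)
  have "ivl a b (\<lambda>s. expn (ivl a s (\<lambda>x. k x + h x)) * (k s * renewal h G c b s + G s)) =
    ivl a b (\<lambda>s. w s * renewal h G c b s) + ivl a b (\<lambda>s. expn (ivl a s k) * expn (ivl a s h) * G s)"
    unfolding kh w_def renewal_def by (subst ivl_add[symmetric]) (auto simp: distrib_left mult_ac)
  also have "ivl a b (\<lambda>s. w s * renewal h G c b s) =
    ivl a b (\<lambda>r. G r * (expn (ivl a r h) * ivl a r (\<lambda>s. k s * expn (ivl a s k)))) +
    expn (ivl a b h) * ivl a b (\<lambda>s. k s * expn (ivl a s k)) * c"
    by (subst ivl_renewal) (simp_all add: w)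
  finally have "expn (ivl a b (\<lambda>x. k x + h x)) * c +
    ivl a b (\<lambda>s. expn (ivl a s (\<lambda>x. k x + h x)) * (k s * renewal h G c b s + G s)) =
    expn (ivl a b h) * (ivl a b (\<lambda>s. k s * expn (ivl a s k)) + expn (ivl a b k)) * c +
    (ivl a b (\<lambda>r. G r * (expn (ivl a r h) * ivl a r (\<lambda>s. k s * expn (ivl a s k)))) +
     ivl a b (\<lambda>s. expn (ivl a s k) * expn (ivl a s h) * G s))"
    unfolding kh by (simp add: algebra_simps)
  also have "ivl a b (\<lambda>r. G r * (expn (ivl a r h) * ivl a r (\<lambda>s. k s * expn (ivl a s k)))) +
     ivl a b (\<lambda>s. expn (ivl a s k) * expn (ivl a s h) * G s) =
     ivl a b (\<lambda>r. G r * (expn (ivl a r h) * ivl a r (\<lambda>s. k s * expn (ivl a s k))) +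
       expn (ivl a r k) * expn (ivl a r h) * G r)"
    by (subst ivl_add) auto
  also have "\<dots> = ivl a b (\<lambda>r. G r * expn (ivl a r h))"
  proof (rule ivl_cong)
    fix r assume "a \<le> r" "r \<le> b"
    from fwd[OF this]
    have "G r * expn (ivl a r h) * (ivl a r (\<lambda>s. k s * expn (ivl a s k)) + expn (ivl a r k)) = G r * expn (ivl a r h)"
      by simp
    then show "G r * (expn (ivl a r h) * ivl a r (\<lambda>s. k s * expn (ivl a s k))) +
       expn (ivl a r k) * expn (ivl a r h) * G r = G r * expn (ivl a r h)"
      by (simp add: algebra_simps)
  qed
  finally show ?thesis
    unfolding fwd[OF ab order_refl] renewal_def by (simp add: add.commute)
qed

section \<open>Measurability on pattern spaces\<close>

lemma space_pattern_space:
  "space (pattern_space l B) = {X. finite X \<and> X \<subseteq> space B \<and> inj_on l X}"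
  unfolding pattern_space_def by (rule space_measure_of) auto

lemma measurable_card_Int:
  assumes "A \<in> sets B"
  shows "(\<lambda>X. card (X \<inter> A)) \<in> pattern_space l B \<rightarrow>\<^sub>M count_space UNIV"
proof (subst measurable_count_space_eq2_countable, safe)
  fix n :: nat
  have "(\<lambda>X. card (X \<inter> A)) -` {n} \<inter> space (pattern_space l B) =
      {X. finite X \<and> X \<subseteq> space B \<and> inj_on l X \<and> card (X \<inter> A) = n}"
    by (auto simp: space_pattern_space)
  also have "\<dots> \<in> sets (pattern_space l B)"
    unfolding pattern_space_def using assms by (intro in_measure_of) auto
  finally show "(\<lambda>X. card (X \<inter> A)) -` {n} \<inter> space (pattern_space l B) \<in> sets (pattern_space l B)" .
qed auto

lemma measurable_pattern_spaceI:
  assumes "\<And>x. x \<in> space M \<Longrightarrow> f x \<in> space (pattern_space l B)"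
    and "\<And>A. A \<in> sets B \<Longrightarrow> (\<lambda>x. card (f x \<inter> A)) \<in> M \<rightarrow>\<^sub>M count_space UNIV"
  shows "f \<in> M \<rightarrow>\<^sub>M pattern_space l B"
  unfolding pattern_space_def
proof (rule measurable_measure_of)
  show "f \<in> space M \<rightarrow> {X. finite X \<and> X \<subseteq> space B \<and> inj_on l X}"
    using assms(1) by (auto simp: space_pattern_space)
  fix Z assume "Z \<in> {{X. finite X \<and> X \<subseteq> space B \<and> inj_on l X \<and> card (X \<inter> A) = n} |A n. A \<in> sets B}"
  then obtain A n where A: "A \<in> sets B"
    and Z: "Z = {X. finite X \<and> X \<subseteq> space B \<and> inj_on l X \<and> card (X \<inter> A) = n}" by auto
  have "f -` Z \<inter> space M = (\<lambda>x. card (f x \<inter> A)) -` {n} \<inter> space M"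
    using assms(1) by (auto simp: Z space_pattern_space)
  then show "f -` Z \<inter> space M \<in> sets M"
    using measurable_sets[OF assms(2)[OF A], of "{n}"] by simp
qed auto

text \<open>The sigma-algebra of patterns only knows counts. Seen as its normalised counting
  measure, a pattern becomes a subprobability kernel, measurable because its values are quotients of
  counts. Integrals against such kernels are measurable, and multiplying by the number of points
  gives the sum back. Subprobability measures need a nonempty space, hence the separate first
  case.\<close>

lemma measurable_pattern_sum:
  fixes \<phi> :: "'y \<Rightarrow> 'p \<Rightarrow> ennreal"
  assumes \<phi>: "(\<lambda>(y, p). \<phi> y p) \<in> borel_measurable (M \<Otimes>\<^sub>M B)" and X: "X \<in> M \<rightarrow>\<^sub>M pattern_space l B"
  shows "(\<lambda>y. \<Sum>p\<in>X y. \<phi> y p) \<in> borel_measurable M"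
proof (cases "space B = {}")
  case True
  then have "X y = {}" if "y \<in> space M" for y
    using measurable_space[OF X that] by (auto simp: space_pattern_space)
  then show ?thesis by (subst measurable_cong[of M _ "\<lambda>_. 0"]) auto
next
  case False
  \<comment> \<open>For an empty pattern the weight is 1 / 0 = 0, and the result is the null
    measure.\<close>
  define U where "U Z = distr (point_measure Z (\<lambda>_. ennreal (1 / card Z))) B (\<lambda>p. p)" for Z
  have m: "(\<lambda>p. p) \<in> point_measure Z (\<lambda>_. ennreal (1 / card Z)) \<rightarrow>\<^sub>M B" if "Z \<subseteq> space B" for Z
    using that by (auto simp: measurable_def space_point_measure sets_point_measure)
  have Un: "integral\<^sup>N (U Z) f = (\<Sum>p\<in>Z. f p) * ennreal (1 / card Z)"
    if "finite Z" "Z \<subseteq> space B" "f \<in> borel_measurable B" for Z f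
    using that by (simp add: U_def nn_integral_distr[OF m] nn_integral_point_measure_finite sum_distrib_right mult.commute)
  have Ue: "emeasure (U Z) A = ennreal (card (Z \<inter> A) / card Z)"
    if "finite Z" "Z \<subseteq> space B" "A \<in> sets B" for Z A
  proof -
    have "emeasure (U Z) A = integral\<^sup>N (U Z) (indicator A)"
      using that(3) by (simp add: U_def)
    also have "\<dots> = (\<Sum>p\<in>Z. if p \<in> A then 1 else 0) * ennreal (1 / card Z)"
      using that by (subst Un) (auto simp: indicator_def of_bool_def)
    finally show ?thesis
      using that by (simp add: sum.If_cases Int_def ennreal_of_nat_eq_real_of_nat flip: ennreal_mult)
  qed
  have XX: "finite (X y)" "X y \<subseteq> space B" if "y \<in> space M" for y
    using measurable_space[OF X that] by (auto simp: space_pattern_space)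
  have "(\<lambda>y. U (X y)) \<in> M \<rightarrow>\<^sub>M subprob_algebra B"
  proof (rule measurable_subprob_algebra)
    fix y assume y: "y \<in> space M"
    have "emeasure (U (X y)) (space B) \<le> 1"
      unfolding Ue[OF XX[OF y] sets.top]
      by (cases "card (X y) = 0") (auto simp: divide_le_eq card_mono XX[OF y])
    then show "subprob_space (U (X y))"
      using False by (intro subprob_spaceI) (auto simp: U_def)
    show "sets (U (X y)) = sets B" by (simp add: U_def)
  next
    fix A assume A: "A \<in> sets B"
    note [measurable] = measurable_compose[OF X measurable_card_Int] 
    have "(\<lambda>y. ennreal (real (card (X y \<inter> A)) / real (card (X y \<inter> space B)))) \<in> borel_measurable M"
      using A by measurable
    then show "(\<lambda>y. emeasure (U (X y)) A) \<in> borel_measurable M"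
      by (subst measurable_cong[OF Ue[OF XX A]]) (auto simp: Int_absorb2 XX cong: measurable_cong)
  qed
  from nn_integral_measurable_subprob_algebra2[OF \<phi> this]
  have [measurable]: "(\<lambda>y. integral\<^sup>N (U (X y)) (\<phi> y)) \<in> borel_measurable M" .
  have [measurable]: "(\<lambda>y. card (X y)) \<in> M \<rightarrow>\<^sub>M count_space UNIV"
    using measurable_compose[OF X measurable_card_Int[OF sets.top]]
    by (subst measurable_cong[where g="\<lambda>y. card (X y \<inter> space B)"]) (auto simp: Int_absorb2 XX)
  have "(\<lambda>y. of_nat (card (X y)) * integral\<^sup>N (U (X y)) (\<phi> y)) \<in> borel_measurable M"
    by measurable
  moreover have "of_nat (card (X y)) * integral\<^sup>N (U (X y)) (\<phi> y) = (\<Sum>p\<in>X y. \<phi> y p)" if y: "y \<in> space M" for y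
  proof (cases "X y = {}")
    case False
    then have "of_nat (card (X y)) * ennreal (1 / card (X y)) = 1"
      using XX[OF y] by (simp add: ennreal_of_nat_eq_real_of_nat flip: ennreal_mult)
    moreover have "\<phi> y \<in> borel_measurable B"
      using measurable_compose[OF measurable_Pair1'[OF y] \<phi>] by simp
    ultimately show ?thesis
      by (simp add: Un[OF XX[OF y]] mult.left_commute[of "of_nat _"])
  qed simp
  ultimately show ?thesis by (simp cong: measurable_cong)
qed

text \<open>The count is a sum of zeros and ones over the pattern; unlike in the generators of the
  sigma-algebra, the condition may depend on the parameter.\<close>

lemma measurable_card_filter:
  assumes P: "Measurable.pred (M \<Otimes>\<^sub>M B) (\<lambda>(y, p). P y p)" and X: "X \<in> M \<rightarrow>\<^sub>M pattern_space l B"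
  shows "(\<lambda>y. card {p \<in> X y. P y p}) \<in> M \<rightarrow>\<^sub>M count_space UNIV"
proof -
  have eq: "(\<Sum>p\<in>X y. if P y p then 1 else 0) = (of_nat (card {p \<in> X y. P y p}) :: ennreal)" if "y \<in> space M" for y
    using measurable_space[OF X that] by (simp add: space_pattern_space sum.If_cases Int_def)
  have "(\<lambda>(y, p). if P y p then 1 else (0::ennreal)) \<in> borel_measurable (M \<Otimes>\<^sub>M B)"
    using P by (simp add: split_beta')
  from measurable_pattern_sum[OF this X]
  have m: "(\<lambda>y. of_nat (card {p \<in> X y. P y p}) :: ennreal) \<in> borel_measurable M"
    by (simp add: eq cong: measurable_cong)
  show ?thesis
  proof (subst measurable_count_space_eq2_countable, safe)
    fix n
    have "(\<lambda>y. card {p \<in> X y. P y p}) -` {n} \<inter> space M =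
      (\<lambda>y. of_nat (card {p \<in> X y. P y p}) :: ennreal) -` {of_nat n} \<inter> space M"
      by (auto simp: ennreal_of_nat_eq_real_of_nat)
    also have "\<dots> \<in> sets M" using m by (rule measurable_sets) simp
    finally show "(\<lambda>y. card {p \<in> X y. P y p}) -` {n} \<inter> space M \<in> sets M" .
  qed auto
qed

lemma measurable_pattern_filter:
  assumes P: "Measurable.pred (M \<Otimes>\<^sub>M B) (\<lambda>(y, p). P y p)" and X: "X \<in> M \<rightarrow>\<^sub>M pattern_space l B"
  shows "(\<lambda>y. {p \<in> X y. P y p}) \<in> M \<rightarrow>\<^sub>M pattern_space l B"
proof (rule measurable_pattern_spaceI)
  show "{p \<in> X y. P y p} \<in> space (pattern_space l B)" if "y \<in> space M" for y
    using measurable_space[OF X that] by (auto simp: space_pattern_space intro: inj_on_subset)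
  fix A assume A[measurable]: "A \<in> sets B"
  have "(\<lambda>y. card {p \<in> X y. P y p \<and> p \<in> A}) \<in> M \<rightarrow>\<^sub>M count_space UNIV"
    by (rule measurable_card_filter[OF _ X]) (use P in \<open>simp add: split_beta'\<close>)
  then show "(\<lambda>y. card ({p \<in> X y. P y p} \<inter> A)) \<in> M \<rightarrow>\<^sub>M count_space UNIV"
    by (simp add: Collect_conj_eq Int_assoc)
qed

lemma pred_pattern_Ball:
  assumes P: "Measurable.pred (M \<Otimes>\<^sub>M B) (\<lambda>(y, p). P y p)" and X: "X \<in> M \<rightarrow>\<^sub>M pattern_space l B"
  shows "Measurable.pred M (\<lambda>y. \<forall>p\<in>X y. P y p)"
proof -
  have [measurable]: "(\<lambda>y. card {p \<in> X y. \<not> P y p}) \<in> M \<rightarrow>\<^sub>M count_space UNIV"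
    by (rule measurable_card_filter[OF _ X]) (use P in \<open>simp add: split_beta'\<close>)
  have "Measurable.pred M (\<lambda>y. card {p \<in> X y. \<not> P y p} = 0)" by measurable
  moreover have "card {p \<in> X y. \<not> P y p} = 0 \<longleftrightarrow> (\<forall>p\<in>X y. P y p)" if "y \<in> space M" for y
    using measurable_space[OF X that] by (auto simp: space_pattern_space)
  ultimately show ?thesis by (simp cong: measurable_cong)
qed

lemma measurable_pattern_card:
  assumes X: "X \<in> M \<rightarrow>\<^sub>M pattern_space l B"
  shows "(\<lambda>y. card (X y)) \<in> M \<rightarrow>\<^sub>M count_space UNIV"
  using measurable_card_filter[OF _ X, of "\<lambda>_ _. True"] by simp

section \<open>Time-ordered patterns and sums over their points\<close>

definition before :: "('p \<Rightarrow> real) \<Rightarrow> real \<Rightarrow> 'p set \<Rightarrow> 'p set" where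
  "before tm t X = {q \<in> X. tm q < t}"

text \<open>The guard makes the operation total: the result is a pattern for every \<open>p\<close>,
  with no two points at the same time.\<close>

definition add_last :: "('p \<Rightarrow> real) \<Rightarrow> 'p \<Rightarrow> 'p set \<Rightarrow> 'p set" where
  "add_last tm p Y = (if \<forall>q\<in>Y. tm q < tm p then insert p Y else Y)"

text \<open>The inserted 0 lets the empty pattern start at the beginning of the segment.\<close>

definition last_time :: "('p \<Rightarrow> real) \<Rightarrow> 'p set \<Rightarrow> real" where
  "last_time tm Y = Max (insert 0 (tm ` Y))"

lemma last_time_le_iff: "finite Y \<Longrightarrow> last_time tm Y \<le> t \<longleftrightarrow> 0 \<le> t \<and> (\<forall>q\<in>Y. tm q \<le> t)"
  by (simp add: last_time_def)

text \<open>Time determines the place and conversely, so that simple patterns are those whose points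
  have distinct times.\<close>

locale timed_points =
  fixes l :: "'p \<Rightarrow> 'a" and B :: "'p measure" and tm :: "'p \<Rightarrow> real"
  assumes tm[measurable]: "tm \<in> borel_measurable B"
    and inj_tm: "\<And>p q. p \<in> space B \<Longrightarrow> q \<in> space B \<Longrightarrow> l p = l q \<longleftrightarrow> tm p = tm q"
begin

abbreviation S :: "'p set measure" where "S \<equiv> pattern_space l B"

lemma space_S_D: "X \<in> space S \<Longrightarrow> finite X" "X \<in> space S \<Longrightarrow> X \<subseteq> space B"
    "X \<in> space S \<Longrightarrow> inj_on tm X"
  by (auto simp: space_pattern_space inj_on_def subset_eq inj_tm)

lemma empty_in_S[simp]: "{} \<in> space S"
  by (simp add: space_pattern_space)

lemma subset_in_S: "X \<in> space S \<Longrightarrow> Y \<subseteq> X \<Longrightarrow> Y \<in> space S"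
  by (auto simp: space_pattern_space intro: finite_subset inj_on_subset)

lemma before_in_S: "X \<in> space S \<Longrightarrow> before tm t X \<in> space S"
  by (rule subset_in_S) (auto simp: before_def)

lemma insert_in_S: "p \<in> space B \<Longrightarrow> Y \<in> space S \<Longrightarrow> (\<And>q. q \<in> Y \<Longrightarrow> tm q < tm p) \<Longrightarrow> insert p Y \<in> space S"
  by (force simp: space_pattern_space inj_tm subset_eq)

lemma add_last_in_S: "p \<in> space B \<Longrightarrow> Y \<in> space S \<Longrightarrow> add_last tm p Y \<in> space S"
  by (simp add: add_last_def insert_in_S)

lemma measurable_before[measurable (raw)]:
  assumes [measurable]: "t \<in> borel_measurable M" and X: "X \<in> M \<rightarrow>\<^sub>M S"
  shows "(\<lambda>y. before tm (t y) (X y)) \<in> M \<rightarrow>\<^sub>M S"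
  unfolding before_def by (rule measurable_pattern_filter[OF _ X]) (simp add: split_beta')

lemma pred_all_before[measurable (raw)]:
  assumes [measurable]: "t \<in> borel_measurable M" and X: "X \<in> M \<rightarrow>\<^sub>M S"
  shows "Measurable.pred M (\<lambda>y. \<forall>q\<in>X y. tm q < t y)"
  by (rule pred_pattern_Ball[OF _ X]) (simp add: split_beta')

lemma measurable_last_time[measurable (raw)]:
  assumes X: "X \<in> M \<rightarrow>\<^sub>M S"
  shows "(\<lambda>y. last_time tm (X y)) \<in> borel_measurable M"
proof (rule borel_measurableI_le)
  fix c :: real
  have [measurable]: "Measurable.pred M (\<lambda>y. \<forall>q\<in>X y. tm q \<le> c)"
    by (rule pred_pattern_Ball[OF _ X]) (simp add: split_beta')
  have "{y \<in> space M. last_time tm (X y) \<le> c} = {y \<in> space M. 0 \<le> c \<and> (\<forall>q\<in>X y. tm q \<le> c)}"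
    using measurable_space[OF X] by (auto simp: last_time_le_iff space_S_D)
  then show "{y \<in> space M. last_time tm (X y) \<le> c} \<in> sets M" by simp
qed

lemma measurable_card_S[measurable (raw)]:
  "X \<in> M \<rightarrow>\<^sub>M S \<Longrightarrow> (\<lambda>y. card (X y)) \<in> M \<rightarrow>\<^sub>M count_space UNIV"
  by (rule measurable_pattern_card)

lemma measurable_add_last[measurable (raw)]:
  assumes p[measurable]: "p \<in> M \<rightarrow>\<^sub>M B" and X[measurable]: "X \<in> M \<rightarrow>\<^sub>M S"
  shows "(\<lambda>y. add_last tm (p y) (X y)) \<in> M \<rightarrow>\<^sub>M S"
proof (rule measurable_pattern_spaceI)
  fix y assume y: "y \<in> space M"
  show "add_last tm (p y) (X y) \<in> space S"
    using measurable_space[OF p y] measurable_space[OF X y] by (rule add_last_in_S)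
next
  fix A assume A[measurable]: "A \<in> sets B"
  have [measurable]: "(\<lambda>y. card (X y \<inter> A)) \<in> M \<rightarrow>\<^sub>M count_space UNIV"
    by (rule measurable_compose[OF X measurable_card_Int]) simp
  have "(\<lambda>y. card (X y \<inter> A) + (if (\<forall>q\<in>X y. tm q < tm (p y)) \<and> p y \<in> A then 1 else 0)) \<in> M \<rightarrow>\<^sub>M count_space UNIV"
    by measurable
  moreover have "card (add_last tm (p y) (X y) \<inter> A) =
      card (X y \<inter> A) + (if (\<forall>q\<in>X y. tm q < tm (p y)) \<and> p y \<in> A then 1 else 0)" if "y \<in> space M" for y
  proof -
    have "finite (X y)" using measurable_space[OF X that] by (rule space_S_D)
    moreover have "p y \<notin> X y" if "\<forall>q\<in>X y. tm q < tm (p y)" using that by auto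
    ultimately show ?thesis by (auto simp: add_last_def)
  qed
  ultimately show "(\<lambda>y. card (add_last tm (p y) (X y) \<inter> A)) \<in> M \<rightarrow>\<^sub>M count_space UNIV"
    by (simp cong: measurable_cong)
qed

text \<open>The defining property of the intensity is the case where \<phi> is the indicator of a
  set; linear combinations and monotone limits extend it to all nonnegative integrands. This is a
  Campbell formula in which the integrand also sees the past of the point.\<close>

lemma cond_intensity_sum:
  fixes \<phi> :: "'p \<times> 'p set \<Rightarrow> ennreal"
  assumes P: "has_cond_intensity l B tm P g" and B: "sigma_finite_measure B"
    and g[measurable]: "(\<lambda>(p, Y). g p Y) \<in> borel_measurable (B \<Otimes>\<^sub>M S)"
    and \<phi>: "\<phi> \<in> borel_measurable (B \<Otimes>\<^sub>M S)"
  shows "(\<integral>\<^sup>+X. (\<Sum>p\<in>X. \<phi> (p, before tm (tm p) X)) \<partial>P) =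
    (\<integral>\<^sup>+X. (\<integral>\<^sup>+p. \<phi> (p, before tm (tm p) X) * ennreal (g p (before tm (tm p) X)) \<partial>B) \<partial>P)"
proof -
  interpret sigma_finite_measure B by fact
  have [measurable_cong]: "sets P = sets S" using P by (simp add: has_cond_intensity_def)
  then have sp: "space P = space S" by (rule sets_eq_imp_space_eq)
  have meas_sum: "(\<lambda>X. \<Sum>p\<in>X. u (p, before tm (tm p) X)) \<in> borel_measurable P"
    if [measurable]: "u \<in> borel_measurable (B \<Otimes>\<^sub>M S)" for u :: "'p \<times> 'p set \<Rightarrow> ennreal"
  proof (rule measurable_pattern_sum)
    show "(\<lambda>(X, p). u (p, before tm (tm p) X)) \<in> borel_measurable (P \<Otimes>\<^sub>M B)" by measurable
  qed measurable
  have meas_in: "(\<lambda>X. \<integral>\<^sup>+p. u (p, before tm (tm p) X) * ennreal (g p (before tm (tm p) X)) \<partial>B) \<in> borel_measurable P"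
    if [measurable]: "u \<in> borel_measurable (B \<Otimes>\<^sub>M S)" for u :: "'p \<times> 'p set \<Rightarrow> ennreal"
    by measurable
  have meas_in': "(\<lambda>p. u (p, before tm (tm p) X) * ennreal (g p (before tm (tm p) X))) \<in> borel_measurable B"
    if [measurable]: "u \<in> borel_measurable (B \<Otimes>\<^sub>M S)" "X \<in> space S" for u :: "'p \<times> 'p set \<Rightarrow> ennreal" and X
    using that by measurable
  show ?thesis
    using \<phi>
  proof (induction rule: borel_measurable_induct)
    case (cong u v)
    have "u (p, before tm (tm p) X) = v (p, before tm (tm p) X)" if "X \<in> space P" "p \<in> space B" for p X
      using cong(3) that by (simp add: space_pair_measure before_in_S sp)
    then have "(\<integral>\<^sup>+X. (\<Sum>p\<in>X. u (p, before tm (tm p) X)) \<partial>P) = (\<integral>\<^sup>+X. (\<Sum>p\<in>X. v (p, before tm (tm p) X)) \<partial>P)"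
      "(\<integral>\<^sup>+X. (\<integral>\<^sup>+p. u (p, before tm (tm p) X) * ennreal (g p (before tm (tm p) X)) \<partial>B) \<partial>P)
      = (\<integral>\<^sup>+X. (\<integral>\<^sup>+p. v (p, before tm (tm p) X) * ennreal (g p (before tm (tm p) X)) \<partial>B) \<partial>P)"
      using space_S_D(2) sp
      by (auto intro!: nn_integral_cong sum.cong dest!: subsetD)
    then show ?case using cong by simp
  next
    case (set D)
    have "(\<Sum>p\<in>X. indicator D (p, before tm (tm p) X)) = (of_nat (card {p \<in> X. (p, {q \<in> X. tm q < tm p}) \<in> D}) :: ennreal)"
      if "X \<in> space P" for X
      using that space_S_D(1)[of X] by (simp add: sp before_def indicator_def sum.If_cases Int_def)
    then show ?case
      using P set by (simp add: has_cond_intensity_def before_def cong: nn_integral_cong)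
  next
    case (mult u c)
    have "(\<integral>\<^sup>+X. (\<Sum>p\<in>X. c * u (p, before tm (tm p) X)) \<partial>P) = c * (\<integral>\<^sup>+X. (\<Sum>p\<in>X. u (p, before tm (tm p) X)) \<partial>P)"
      by (simp add: sum_distrib_left[symmetric] nn_integral_cmult meas_sum mult.hyps)
    also have "\<dots> = (\<integral>\<^sup>+X. c * (\<integral>\<^sup>+p. u (p, before tm (tm p) X) * ennreal (g p (before tm (tm p) X)) \<partial>B) \<partial>P)"
      unfolding mult.IH by (simp add: nn_integral_cmult meas_in mult.hyps)
    also have "\<dots> = (\<integral>\<^sup>+X. (\<integral>\<^sup>+p. c * u (p, before tm (tm p) X) * ennreal (g p (before tm (tm p) X)) \<partial>B) \<partial>P)"
      by (intro nn_integral_cong) (simp add: mult.assoc nn_integral_cmult meas_in' mult.hyps sp)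
    finally show ?case .
  next
    case (add v u)
    have "(\<integral>\<^sup>+X. (\<Sum>p\<in>X. u (p, before tm (tm p) X) + v (p, before tm (tm p) X)) \<partial>P) =
       (\<integral>\<^sup>+X. (\<Sum>p\<in>X. u (p, before tm (tm p) X)) \<partial>P) + (\<integral>\<^sup>+X. (\<Sum>p\<in>X. v (p, before tm (tm p) X)) \<partial>P)"
      by (simp add: sum.distrib nn_integral_add meas_sum add.hyps)
    also have "\<dots> = (\<integral>\<^sup>+X. (\<integral>\<^sup>+p. u (p, before tm (tm p) X) * ennreal (g p (before tm (tm p) X)) \<partial>B) +
        (\<integral>\<^sup>+p. v (p, before tm (tm p) X) * ennreal (g p (before tm (tm p) X)) \<partial>B) \<partial>P)"
      unfolding add.IH by (simp add: nn_integral_add meas_in add.hyps)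
    also have "\<dots> = (\<integral>\<^sup>+X. (\<integral>\<^sup>+p. (u (p, before tm (tm p) X) + v (p, before tm (tm p) X)) *
        ennreal (g p (before tm (tm p) X)) \<partial>B) \<partial>P)"
      by (intro nn_integral_cong) (simp add: distrib_right nn_integral_add meas_in' add.hyps sp)
    finally show ?case .
  next
    case (seq U)
    have inc: "incseq (\<lambda>i. U i x)" for x using seq(3) unfolding incseq_def le_fun_def by blast
    have "(\<integral>\<^sup>+X. (\<Sum>p\<in>X. (SUP i. U i) (p, before tm (tm p) X)) \<partial>P) =
      (\<integral>\<^sup>+X. (SUP i. \<Sum>p\<in>X. U i (p, before tm (tm p) X)) \<partial>P)"
      by (simp add: ennreal_SUP_sum inc image_comp)
    also have "\<dots> = (SUP i. \<integral>\<^sup>+X. (\<Sum>p\<in>X. U i (p, before tm (tm p) X)) \<partial>P)"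
      by (intro nn_integral_monotone_convergence_SUP meas_sum seq.hyps)
         (auto simp: incseq_def le_fun_def intro!: sum_mono incseqD[OF inc])
    also have "\<dots> = (SUP i. \<integral>\<^sup>+X. (\<integral>\<^sup>+p. U i (p, before tm (tm p) X) * ennreal (g p (before tm (tm p) X)) \<partial>B) \<partial>P)"
      by (simp add: seq.IH)
    also have "\<dots> = (\<integral>\<^sup>+X. (SUP i. \<integral>\<^sup>+p. U i (p, before tm (tm p) X) * ennreal (g p (before tm (tm p) X)) \<partial>B) \<partial>P)"
      by (intro nn_integral_monotone_convergence_SUP[symmetric] meas_in seq.hyps)
         (auto simp: incseq_def le_fun_def intro!: nn_integral_mono mult_right_mono incseqD[OF inc])
    also have "\<dots> = (\<integral>\<^sup>+X. (\<integral>\<^sup>+p. (SUP i. U i (p, before tm (tm p) X) * ennreal (g p (before tm (tm p) X))) \<partial>B) \<partial>P)"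
      by (intro nn_integral_cong nn_integral_monotone_convergence_SUP[symmetric] meas_in' seq.hyps)
         (auto simp: sp incseq_def le_fun_def intro!: mult_right_mono incseqD[OF inc])
    also have "\<dots> = (\<integral>\<^sup>+X. (\<integral>\<^sup>+p. (SUP i. U i) (p, before tm (tm p) X) * ennreal (g p (before tm (tm p) X)) \<partial>B) \<partial>P)"
      by (simp add: image_comp SUP_mult_right_ennreal)
    finally show ?case .
  qed
qed

end

section \<open>The value function of a conditional intensity\<close>

lemma ivl_SUP:
  assumes "\<And>n. f n \<in> borel_measurable borel" and "\<And>x. incseq (\<lambda>n. f n x)"
  shows "ivl a b (\<lambda>x. SUP n. f n x) = (SUP n. ivl a b (f n))"
proof -
  have "ivl a b (\<lambda>x. SUP n. f n x) = (\<integral>\<^sup>+x. (SUP n. if a \<le> x \<and> x \<le> b then f n x else 0) \<partial>lborel)"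
    unfolding ivl_def by (intro nn_integral_cong) auto
  also have "\<dots> = (SUP n. ivl a b (f n))"
    unfolding ivl_def using assms
    by (intro nn_integral_monotone_convergence_SUP) (auto simp: incseq_def le_fun_def)
  finally show ?thesis .
qed

lemma ivl_0[simp]: "ivl a b (\<lambda>_. 0) = 0"
  by (simp add: ivl_def)

text \<open>The Markov property at \<open>b\<close>: survival from \<open>a\<close> past
  \<open>b\<close> is a product, and its second factor together with the later payoffs is the value
  at \<open>b\<close>.\<close>

lemma renewal_restart:
  assumes [measurable]: "h \<in> borel_measurable borel" "G \<in> borel_measurable borel" and ab: "a \<le> b" "b \<le> c"
  shows "renewal h G x c a = renewal h G (renewal h G x c b) b a"
proof -
  have "ivl b c (\<lambda>r. G r * expn (ivl a r h)) = ivl b c (\<lambda>r. expn (ivl a b h) * (G r * expn (ivl b r h)))"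
  proof (rule ivl_cong)
    fix r assume "b \<le> r"
    with ab have "ivl a r h = ivl a b h + ivl b r h" by (intro ivl_split) auto
    then show "G r * expn (ivl a r h) = expn (ivl a b h) * (G r * expn (ivl b r h))"
      by (simp add: expn_add mult_ac)
  qed
  also have "\<dots> = expn (ivl a b h) * ivl b c (\<lambda>r. G r * expn (ivl b r h))"
    by (rule ivl_cmult) measurable
  finally have *: "ivl b c (\<lambda>r. G r * expn (ivl a r h)) = expn (ivl a b h) * ivl b c (\<lambda>r. G r * expn (ivl b r h))" .
  have "ivl a c (\<lambda>r. G r * expn (ivl a r h)) =
      ivl a b (\<lambda>r. G r * expn (ivl a r h)) + ivl b c (\<lambda>r. G r * expn (ivl a r h))"
    using ab by (intro ivl_split) auto
  moreover have "ivl a c h = ivl a b h + ivl b c h" using ab by (intro ivl_split) auto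
  ultimately show ?thesis
    unfolding renewal_def * by (simp add: expn_add distrib_left add_ac mult_ac)
qed

lemma measurable_renewal[measurable (raw)]:
  assumes [measurable]: "(\<lambda>(y, x). h y x) \<in> borel_measurable (M \<Otimes>\<^sub>M borel)"
    "(\<lambda>(y, x). G y x) \<in> borel_measurable (M \<Otimes>\<^sub>M borel)"
    "c \<in> borel_measurable M" "t \<in> borel_measurable M"
  shows "(\<lambda>y. renewal (h y) (G y) (c y) b (t y)) \<in> borel_measurable M"
  unfolding renewal_def by measurable

text \<open>One segment in its time coordinate, with the upstream pattern fixed and hidden in
  \<open>rate\<close> and \<open>mk\<close>. By \<open>integral_B\<close> the reference measure on
  points is the image under \<open>pt\<close> of Lebesgue measure on \<open>(0, len)\<close> times
  \<nu>.\<close>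

locale marked_line = timed_points l B tm + sigma_finite_measure \<nu>
  for l :: "'p \<Rightarrow> 'a" and B :: "'p measure" and tm :: "'p \<Rightarrow> real" and \<nu> :: "'m measure" +
  fixes len :: real and pt :: "real \<Rightarrow> 'm \<Rightarrow> 'p"
    and rate :: "'p set \<Rightarrow> real \<Rightarrow> ennreal" and mk :: "'p set \<Rightarrow> real \<Rightarrow> 'm \<Rightarrow> ennreal"
  assumes len_pos: "0 < len"
    and tm_range: "\<And>p. p \<in> space B \<Longrightarrow> 0 < tm p \<and> tm p < len"
    and tm_pt: "\<And>t m. 0 < t \<Longrightarrow> t < len \<Longrightarrow> m \<in> space \<nu> \<Longrightarrow> tm (pt t m) = t"
    and pt_measurable: "(\<lambda>(t, m). pt t m) \<in> restrict_space borel {0<..<len} \<Otimes>\<^sub>M \<nu> \<rightarrow>\<^sub>M B"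
    and rate_measurable: "(\<lambda>(Y, t). rate Y t) \<in> borel_measurable (S \<Otimes>\<^sub>M borel)"
    and mk_measurable: "(\<lambda>((Y, t), m). mk Y t m) \<in> borel_measurable ((S \<Otimes>\<^sub>M borel) \<Otimes>\<^sub>M \<nu>)"
    and mk_prob: "\<And>Y t. Y \<in> space S \<Longrightarrow> 0 < t \<Longrightarrow> t < len \<Longrightarrow> (\<integral>\<^sup>+m. mk Y t m \<partial>\<nu>) = 1"
    and integral_B: "\<And>h. h \<in> borel_measurable B \<Longrightarrow>
      integral\<^sup>N B h = (\<integral>\<^sup>+t. (if 0 < t \<and> t < len then \<integral>\<^sup>+m. h (pt t m) \<partial>\<nu> else 0) \<partial>lborel)"
begin

lemma measurable_rate[measurable (raw)]:
  assumes [measurable]: "X \<in> M \<rightarrow>\<^sub>M S" "t \<in> borel_measurable M"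
  shows "(\<lambda>y. rate (X y) (t y)) \<in> borel_measurable M"
  using measurable_compose[OF _ rate_measurable, of "\<lambda>y. (X y, t y)" M] by simp

lemma measurable_mk[measurable (raw)]:
  assumes [measurable]: "X \<in> M \<rightarrow>\<^sub>M S" "t \<in> borel_measurable M" "m \<in> M \<rightarrow>\<^sub>M \<nu>"
  shows "(\<lambda>y. mk (X y) (t y) (m y)) \<in> borel_measurable M"
  using measurable_compose[OF _ mk_measurable, of "\<lambda>y. ((X y, t y), m y)" M] by simp

text \<open>Total in \<open>t\<close>, since \<open>pt\<close> is under control only inside of
  \<open>(0, len)\<close>.\<close>

definition add_pt :: "real \<Rightarrow> 'm \<Rightarrow> 'p set \<Rightarrow> 'p set" where
  "add_pt t m Y = (if 0 < t \<and> t < len then add_last tm (pt t m) Y else Y)"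

lemma pt_in_B: "0 < t \<Longrightarrow> t < len \<Longrightarrow> m \<in> space \<nu> \<Longrightarrow> pt t m \<in> space B"
  using measurable_space[OF pt_measurable, of "(t, m)"]
  by (auto simp: space_pair_measure space_restrict_space)

lemma add_pt_in_S: "m \<in> space \<nu> \<Longrightarrow> Y \<in> space S \<Longrightarrow> add_pt t m Y \<in> space S"
  by (simp add: add_pt_def add_last_in_S pt_in_B)

lemma measurable_add_pt[measurable (raw)]:
  assumes [measurable]: "t \<in> borel_measurable M" "m \<in> M \<rightarrow>\<^sub>M \<nu>" "X \<in> M \<rightarrow>\<^sub>M S"
  shows "(\<lambda>y. add_pt (t y) (m y) (X y)) \<in> M \<rightarrow>\<^sub>M S"
  unfolding add_pt_def
proof (subst measurable_If_restrict_space_iff, measurable, safe)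
  let ?R = "restrict_space M {y. 0 < t y \<and> t y < len}"
  have "(\<lambda>y. (t y, m y)) \<in> ?R \<rightarrow>\<^sub>M restrict_space borel {0<..<len} \<Otimes>\<^sub>M \<nu>"
    by (intro measurable_Pair measurable_restrict_space2 measurable_restrict_space1)
       (auto simp: space_restrict_space)
  from measurable_compose[OF this pt_measurable]
  have [measurable]: "(\<lambda>y. pt (t y) (m y)) \<in> ?R \<rightarrow>\<^sub>M B" by simp
  have [measurable]: "X \<in> ?R \<rightarrow>\<^sub>M S" by (rule measurable_restrict_space1) fact
  show "(\<lambda>y. add_last tm (pt (t y) (m y)) (X y)) \<in> ?R \<rightarrow>\<^sub>M S" by measurable
qed (rule measurable_restrict_space1, fact)

text \<open>The payoff density \<open>G\<close> for \<open>renewal\<close>: a point comes at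
  \<open>s\<close>, its mark is averaged out, and \<phi> is paid for the extended pattern.\<close>

definition mix :: "('p set \<Rightarrow> real \<Rightarrow> ennreal) \<Rightarrow> 'p set \<Rightarrow> real \<Rightarrow> ennreal" where
  "mix \<phi> Y s = rate Y s * (\<integral>\<^sup>+m. mk Y s m * \<phi> (add_pt s m Y) s \<partial>\<nu>)"

text \<open>\<open>val_upto \<psi> n Y t\<close> is the mean of \<open>\<psi>\<close> over the patterns that extend \<open>Y\<close> after time \<open>t\<close> by
  fewer than \<open>n\<close> points.\<close>

primrec val_upto :: "('p set \<Rightarrow> ennreal) \<Rightarrow> nat \<Rightarrow> 'p set \<Rightarrow> real \<Rightarrow> ennreal" where
  "val_upto \<psi> 0 = (\<lambda>Y t. 0)"
| "val_upto \<psi> (Suc n) = (\<lambda>Y t. renewal (rate Y) (mix (val_upto \<psi> n) Y) (\<psi> Y) len t)"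

text \<open>The limit of the iteration from 0, hence the minimal solution of the renewal equation:
  continuations with infinitely many points contribute nothing.\<close>

definition val :: "('p set \<Rightarrow> ennreal) \<Rightarrow> 'p set \<Rightarrow> real \<Rightarrow> ennreal" where
  "val \<psi> Y t = (SUP n. val_upto \<psi> n Y t)"

lemma measurable_mix[measurable (raw)]:
  assumes \<phi>: "(\<lambda>(Y, t). \<phi> Y t) \<in> borel_measurable (S \<Otimes>\<^sub>M borel)"
    and [measurable]: "X \<in> M \<rightarrow>\<^sub>M S" "s \<in> borel_measurable M"
  shows "(\<lambda>y. mix \<phi> (X y) (s y)) \<in> borel_measurable M"
proof -
  have [measurable]: "(\<lambda>(y, m). \<phi> (add_pt (s y) m (X y)) (s y)) \<in> borel_measurable (M \<Otimes>\<^sub>M \<nu>)"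
    using measurable_compose[OF _ \<phi>, of "\<lambda>(y, m). (add_pt (s y) m (X y), s y)" "M \<Otimes>\<^sub>M \<nu>"]
    by (simp add: split_beta')
  show ?thesis unfolding mix_def by measurable
qed

lemma val_upto_measurable:
  assumes [measurable]: "\<psi> \<in> borel_measurable S"
  shows "(\<lambda>(Y, t). val_upto \<psi> n Y t) \<in> borel_measurable (S \<Otimes>\<^sub>M borel)"
proof (induction n)
  case (Suc n)
  note [measurable] = measurable_mix[OF Suc]
  show ?case by simp measurable
qed simp

lemma val_measurable:
  assumes [measurable]: "\<psi> \<in> borel_measurable S"
  shows "(\<lambda>(Y, t). val \<psi> Y t) \<in> borel_measurable (S \<Otimes>\<^sub>M borel)"
  using val_upto_measurable[OF assms] unfolding val_def split_beta' by measurable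

lemma measurable_val[measurable (raw)]:
  assumes "\<psi> \<in> borel_measurable S" "X \<in> M \<rightarrow>\<^sub>M S" "t \<in> borel_measurable M"
  shows "(\<lambda>y. val \<psi> (X y) (t y)) \<in> borel_measurable M"
  using measurable_compose[OF _ val_measurable[OF assms(1)], of "\<lambda>y. (X y, t y)" M] assms(2,3) by simp

lemma renewal_mono: "(\<And>r. G r \<le> G' r) \<Longrightarrow> renewal h G c b s \<le> renewal h G' c b s"
  unfolding renewal_def by (intro add_mono ivl_mono mult_right_mono) auto

lemma mix_mono: "(\<And>m. \<phi> (add_pt s m Y) s \<le> \<phi>' (add_pt s m Y) s) \<Longrightarrow> mix \<phi> Y s \<le> mix \<phi>' Y s"
  unfolding mix_def by (intro mult_left_mono nn_integral_mono) auto

lemma val_upto_Suc_mono: "val_upto \<psi> n Y t \<le> val_upto \<psi> (Suc n) Y t"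
proof (induction n arbitrary: Y t)
  case (Suc n)
  then show ?case unfolding val_upto.simps(2)[of \<psi> n] val_upto.simps(2)[of \<psi> "Suc n"] by (intro renewal_mono mix_mono)
qed simp

lemma val_upto_incseq: "incseq (\<lambda>n. val_upto \<psi> n Y t)"
  by (intro incseq_SucI val_upto_Suc_mono)

text \<open>Monotone convergence takes the supremum through the integral over marks and the integral
  over time; a shift of the index does the rest.\<close>

lemma val_renewal:
  assumes \<psi>[measurable]: "\<psi> \<in> borel_measurable S" and Y[measurable]: "Y \<in> space S"
  shows "val \<psi> Y t = renewal (rate Y) (mix (val \<psi>) Y) (\<psi> Y) len t"
proof -
  note [measurable] = measurable_mix[OF val_upto_measurable[OF \<psi>]]
  have val_upto': "(\<lambda>m. val_upto \<psi> n (add_pt s m Y) s) \<in> borel_measurable \<nu>" for n s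
    using measurable_compose[OF _ val_upto_measurable[OF \<psi>], of "\<lambda>m. (add_pt s m Y, s)" \<nu>] by simp
  have mix: "mix (val \<psi>) Y s = (SUP n. mix (val_upto \<psi> n) Y s)" for s
  proof -
    have "(\<integral>\<^sup>+m. mk Y s m * val \<psi> (add_pt s m Y) s \<partial>\<nu>) = (\<integral>\<^sup>+m. (SUP n. mk Y s m * val_upto \<psi> n (add_pt s m Y) s) \<partial>\<nu>)"
      by (simp add: val_def SUP_mult_left_ennreal)
    also have "\<dots> = (SUP n. \<integral>\<^sup>+m. mk Y s m * val_upto \<psi> n (add_pt s m Y) s \<partial>\<nu>)"
      using val_upto' by (intro nn_integral_monotone_convergence_SUP)
         (auto simp: incseq_def le_fun_def intro!: mult_left_mono incseqD[OF val_upto_incseq])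
    finally show ?thesis by (simp add: mix_def SUP_mult_left_ennreal)
  qed
  have inc: "incseq (\<lambda>n. mix (val_upto \<psi> n) Y r)" for r
    by (intro incseq_SucI mix_mono val_upto_Suc_mono)
  have inc': "incseq (\<lambda>n. mix (val_upto \<psi> n) Y r * expn (ivl t r (rate Y)))" for r
    using inc[of r] by (auto simp: incseq_def intro!: mult_right_mono)
  have "val \<psi> Y t = (SUP n. val_upto \<psi> (Suc n) Y t)"
    unfolding val_def
  proof (intro antisym SUP_mono)
    show "\<exists>m\<in>UNIV. val_upto \<psi> n Y t \<le> val_upto \<psi> (Suc m) Y t" for n
      by (intro bexI[of _ n] val_upto_Suc_mono) simp
    show "\<exists>m\<in>UNIV. val_upto \<psi> (Suc n) Y t \<le> val_upto \<psi> m Y t" for n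
      by (intro bexI[of _ "Suc n"]) simp_all
  qed
  also have "\<dots> = (SUP n. ivl t len (\<lambda>r. mix (val_upto \<psi> n) Y r * expn (ivl t r (rate Y)))) + expn (ivl t len (rate Y)) * \<psi> Y"
    by (simp add: renewal_def ennreal_SUP_add_left)
  also have "(SUP n. ivl t len (\<lambda>r. mix (val_upto \<psi> n) Y r * expn (ivl t r (rate Y)))) =
     ivl t len (\<lambda>r. mix (val \<psi>) Y r * expn (ivl t r (rate Y)))"
    by (subst ivl_SUP[symmetric]) (auto simp: mix SUP_mult_right_ennreal inc')
  finally show ?thesis by (simp add: renewal_def)
qed

lemma val_restart:
  assumes \<psi>[measurable]: "\<psi> \<in> borel_measurable S" and Y[measurable]: "Y \<in> space S" and t: "t \<le> t'" "t' \<le> len"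
  shows "val \<psi> Y t = renewal (rate Y) (mix (val \<psi>) Y) (val \<psi> Y t') t' t"
proof -
  note [measurable] = measurable_mix[OF val_measurable[OF \<psi>]]
  show ?thesis
    unfolding val_renewal[OF \<psi> Y, of t] val_renewal[OF \<psi> Y, of t'] by (rule renewal_restart[OF _ _ t]) measurable
qed

lemma val_len: "\<psi> \<in> borel_measurable S \<Longrightarrow> Y \<in> space S \<Longrightarrow> val \<psi> Y len = \<psi> Y"
  by (subst val_renewal) (auto simp: renewal_def)

lemma mix_le_rate:
  assumes Y[measurable]: "Y \<in> space S" and s: "0 < s" "s < len"
    and "\<And>m. m \<in> space \<nu> \<Longrightarrow> \<phi> (add_pt s m Y) s \<le> 1"
  shows "mix \<phi> Y s \<le> rate Y s"
proof -
  have "(\<integral>\<^sup>+m. mk Y s m * \<phi> (add_pt s m Y) s \<partial>\<nu>) \<le> (\<integral>\<^sup>+m. mk Y s m * 1 \<partial>\<nu>)"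
    using assms(4) by (intro nn_integral_mono mult_left_mono) auto
  also have "\<dots> = 1" using mk_prob[OF Y s] by simp
  finally show ?thesis
    unfolding mix_def by (metis mult.right_neutral mult_left_mono zero_le)
qed

text \<open>By induction the payoff after the next point is at most 1, and the probabilities of a
  next point and of none add up to at most 1 by \<open>expn_forward_le\<close>.\<close>

lemma val_le_1:
  assumes \<psi>: "\<And>Y. Y \<in> space S \<Longrightarrow> \<psi> Y \<le> 1" and Y: "Y \<in> space S" and t: "0 \<le> t" "t \<le> len"
  shows "val \<psi> Y t \<le> 1"
proof -
  have "val_upto \<psi> n Y t \<le> 1" for n
    using Y t
  proof (induction n arbitrary: Y t)
    case (Suc n)
    note [measurable] = Suc.prems(1)
    have "ivl t len (\<lambda>r. mix (val_upto \<psi> n) Y r * expn (ivl t r (rate Y))) \<le>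
        ivl t len (\<lambda>r. if r = 0 \<or> r = len then mix (val_upto \<psi> n) Y r * expn (ivl t r (rate Y)) else rate Y r * expn (ivl t r (rate Y)))"
      using Suc.prems by (intro ivl_mono) (auto intro!: mult_right_mono mix_le_rate Suc.IH add_pt_in_S)
    also have "\<dots> = ivl t len (\<lambda>r. rate Y r * expn (ivl t r (rate Y)))"
      using Suc.prems by (intro ivl_cong_less) auto
    finally have "val_upto \<psi> (Suc n) Y t \<le> ivl t len (\<lambda>r. rate Y r * expn (ivl t r (rate Y))) + expn (ivl t len (rate Y)) * 1"
      unfolding val_upto.simps renewal_def using \<psi>[OF Suc.prems(1)] by (intro add_mono mult_left_mono) auto
    also have "\<dots> \<le> 1"
      using expn_forward_le[of "rate Y" t len] Suc.prems by simp
    finally show ?case .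
  qed simp
  then show ?thesis unfolding val_def by (intro SUP_least)
qed

lemma card_add_pt: "Y \<in> space S \<Longrightarrow> card Y \<le> card (add_pt s m Y)"
  by (auto simp: add_pt_def add_last_def space_S_D intro!: card_mono)

text \<open>Continuations only add points, so a pattern beyond the cap never returns below
  it.\<close>

lemma val_eq_0:
  assumes \<psi>: "\<And>Y. Y \<in> space S \<Longrightarrow> N < card Y \<Longrightarrow> \<psi> Y = 0" and Y: "Y \<in> space S" "N < card Y"
  shows "val \<psi> Y t = 0"
proof -
  have "val_upto \<psi> n Y t = 0" for n
    using Y
  proof (induction n arbitrary: Y t)
    case (Suc n)
    have "mix (val_upto \<psi> n) Y r = 0" for r
    proof -
      have "(\<integral>\<^sup>+m. mk Y r m * val_upto \<psi> n (add_pt r m Y) r \<partial>\<nu>) = (\<integral>\<^sup>+m. 0 \<partial>\<nu>)"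
        using Suc.prems card_add_pt[OF Suc.prems(1), of r]
        by (intro nn_integral_cong) (simp add: Suc.IH add_pt_in_S less_le_trans)
      then show ?thesis by (simp add: mix_def)
    qed
    then show ?case using \<psi>[OF Suc.prems] by (simp add: renewal_def)
  qed simp
  then show ?thesis by (simp add: val_def)
qed

section \<open>Balance of jumps and drift along a pattern\<close>

lemma val_balance:
  assumes \<psi>[measurable]: "\<psi> \<in> borel_measurable S" and Y[measurable]: "Y \<in> space S"
    and t: "t \<le> t'" "t' \<le> len" and fin: "ivl t t' (rate Y) < \<top>"
  shows "val \<psi> Y t + ivl t t' (\<lambda>s. rate Y s * val \<psi> Y s) = val \<psi> Y t' + ivl t t' (mix (val \<psi>) Y)"
proof -
  note [measurable] = measurable_mix[OF val_measurable[OF \<psi>]]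
  have "ivl t t' (\<lambda>s. rate Y s * val \<psi> Y s) =
     ivl t t' (\<lambda>s. rate Y s * renewal (rate Y) (mix (val \<psi>) Y) (val \<psi> Y t') t' s)"
    using t by (intro ivl_cong) (simp add: val_restart[OF \<psi> Y, symmetric])
  moreover have "renewal (rate Y) (mix (val \<psi>) Y) (val \<psi> Y t') t' t +
      ivl t t' (\<lambda>s. rate Y s * renewal (rate Y) (mix (val \<psi>) Y) (val \<psi> Y t') t' s) =
      val \<psi> Y t' + ivl t t' (mix (val \<psi>) Y)"
    by (rule renewal_balance[OF _ _ t(1) fin]) measurable
  ultimately show ?thesis
    using val_restart[OF \<psi> Y t] by simp
qed

text \<open>A telescoping sum over the points. Between two of them the pattern is constant and
  \<open>val_balance\<close> applies; at a point \<open>p\<close> the value changes from that of the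
  pattern without \<open>p\<close> to that of the pattern with \<open>p\<close>, so these two values
  stand on opposite sides.\<close>

lemma path_identity:
  assumes \<psi>[measurable]: "\<psi> \<in> borel_measurable S" and X: "X \<in> space S"
    and t: "0 \<le> t" "t \<le> len" "\<And>q. q \<in> X \<Longrightarrow> tm q \<le> t"
    and fin: "ivl 0 t (\<lambda>s. rate (before tm s X) s) < \<top>"
  shows "val \<psi> {} 0 + (\<Sum>p\<in>X. val \<psi> (insert p (before tm (tm p) X)) (tm p)) +
      ivl 0 t (\<lambda>s. rate (before tm s X) s * val \<psi> (before tm s X) s) =
    (\<Sum>p\<in>X. val \<psi> (before tm (tm p) X) (tm p)) + val \<psi> X t + ivl 0 t (\<lambda>s. mix (val \<psi>) (before tm s X) s)"
  using space_S_D(1)[OF X] X t fin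
\<comment> \<open>The induction adds points in the order of time: before the new point the history
  is that of the old pattern, after it the history no longer changes.\<close>
proof (induction X arbitrary: t rule: finite_ranking_induct[where f = tm])
  case empty
  have "before tm s {} = {}" for s by (simp add: before_def)
  then show ?case using val_balance[OF \<psi> empty_in_S empty(2,3)] empty by simp
next
  case (insert x X)
  note [measurable] = measurable_mix[OF val_measurable[OF \<psi>]] insert.prems(1)
  show ?case
  proof (cases "x \<in> X")
    case True
    then show ?thesis using insert.IH[of t] insert.prems by (simp add: insert_absorb)
  next
    case False
    let ?Y = "insert x X"
    have X: "X \<in> space S" using insert.prems(1) by (rule subset_in_S) auto
    have less: "tm q < tm x" if "q \<in> X" for q
    proof -
      have "tm q \<noteq> tm x" using space_S_D(3)[OF insert.prems(1)] that False by (auto simp: inj_on_def)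
      then show ?thesis using insert.hyps(2)[OF that] by simp
    qed
    have x: "0 < tm x" "tm x < len" using space_S_D(2)[OF insert.prems(1)] tm_range by auto
    have xt: "tm x \<le> t" using insert.prems(4) by auto
    have early: "before tm s ?Y = before tm s X" if "s \<le> tm x" for s
      using that by (auto simp: before_def)
    have late: "before tm s ?Y = ?Y" if "tm x < s" for s
      using that less by (force simp: before_def)
    have bX: "before tm (tm x) X = X" using less by (auto simp: before_def)
    have split: "ivl 0 t F = ivl 0 (tm x) F + ivl (tm x) t F" if "F \<in> borel_measurable borel" for F
      using that x xt by (intro ivl_split) auto
    have e: "ivl 0 (tm x) (\<lambda>s. H (before tm s ?Y) s) = ivl 0 (tm x) (\<lambda>s. H (before tm s X) s)"
      "ivl (tm x) t (\<lambda>s. H (before tm s ?Y) s) = ivl (tm x) t (\<lambda>s. H ?Y s)" for H :: "'p set \<Rightarrow> real \<Rightarrow> ennreal"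
      by (auto intro!: ivl_cong_less simp: early late)
    have fin: "ivl 0 (tm x) (\<lambda>s. rate (before tm s X) s) < \<top>" "ivl (tm x) t (rate ?Y) < \<top>"
      using insert.prems(5) split[of "\<lambda>s. rate (before tm s ?Y) s"] e[of rate] by auto
    have IH: "val \<psi> {} 0 + (\<Sum>p\<in>X. val \<psi> (insert p (before tm (tm p) X)) (tm p)) +
        ivl 0 (tm x) (\<lambda>s. rate (before tm s X) s * val \<psi> (before tm s X) s) =
      (\<Sum>p\<in>X. val \<psi> (before tm (tm p) X) (tm p)) + val \<psi> X (tm x) +
        ivl 0 (tm x) (\<lambda>s. mix (val \<psi>) (before tm s X) s)"
      using insert.IH[OF X _ _ _ fin(1)] x insert.hyps(2) by simp
    have bal: "val \<psi> ?Y (tm x) + ivl (tm x) t (\<lambda>s. rate ?Y s * val \<psi> ?Y s) =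
        val \<psi> ?Y t + ivl (tm x) t (mix (val \<psi>) ?Y)"
      using val_balance[OF \<psi> insert.prems(1) xt insert.prems(3) fin(2)] .
    have sums: "(\<Sum>p\<in>?Y. F (before tm (tm p) ?Y) p) = F X x + (\<Sum>p\<in>X. F (before tm (tm p) X) p)"
      for F :: "'p set \<Rightarrow> 'p \<Rightarrow> ennreal"
    proof -
      have "(\<Sum>p\<in>X. F (before tm (tm p) ?Y) p) = (\<Sum>p\<in>X. F (before tm (tm p) X) p)"
        using insert.hyps(2) by (intro sum.cong) (auto simp: early)
      then show ?thesis using False insert.hyps(1) by (simp add: early bX)
    qed
    have I: "ivl 0 t (\<lambda>s. rate (before tm s ?Y) s * val \<psi> (before tm s ?Y) s) =
        ivl 0 (tm x) (\<lambda>s. rate (before tm s X) s * val \<psi> (before tm s X) s) +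
        ivl (tm x) t (\<lambda>s. rate ?Y s * val \<psi> ?Y s)"
      using e[of "\<lambda>Z s. rate Z s * val \<psi> Z s"] by (subst split) auto
    have G: "ivl 0 t (\<lambda>s. mix (val \<psi>) (before tm s ?Y) s) =
        ivl 0 (tm x) (\<lambda>s. mix (val \<psi>) (before tm s X) s) + ivl (tm x) t (mix (val \<psi>) ?Y)"
      using e[of "mix (val \<psi>)"] by (subst split) auto
    have "val \<psi> {} 0 + (val \<psi> ?Y (tm x) + (\<Sum>p\<in>X. val \<psi> (insert p (before tm (tm p) X)) (tm p))) +
        (ivl 0 (tm x) (\<lambda>s. rate (before tm s X) s * val \<psi> (before tm s X) s) +
        ivl (tm x) t (\<lambda>s. rate ?Y s * val \<psi> ?Y s)) =
      (val \<psi> {} 0 + (\<Sum>p\<in>X. val \<psi> (insert p (before tm (tm p) X)) (tm p)) +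
        ivl 0 (tm x) (\<lambda>s. rate (before tm s X) s * val \<psi> (before tm s X) s)) +
      (val \<psi> ?Y (tm x) + ivl (tm x) t (\<lambda>s. rate ?Y s * val \<psi> ?Y s))"
      by (simp add: add_ac)
    also have "\<dots> = (val \<psi> X (tm x) + (\<Sum>p\<in>X. val \<psi> (before tm (tm p) X) (tm p))) + val \<psi> ?Y t +
        (ivl 0 (tm x) (\<lambda>s. mix (val \<psi>) (before tm s X) s) + ivl (tm x) t (mix (val \<psi>) ?Y))"
      unfolding IH bal by (simp add: add_ac)
    finally show ?thesis
      unfolding I G sums[of "\<lambda>Z p. val \<psi> (insert p Z) (tm p)"] sums[of "\<lambda>Z p. val \<psi> Z (tm p)"] .
  qed
qed

lemma measurable_pt:
  assumes "0 < t" "t < len"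
  shows "pt t \<in> \<nu> \<rightarrow>\<^sub>M B"
proof -
  have "(\<lambda>m. (t, m)) \<in> \<nu> \<rightarrow>\<^sub>M restrict_space borel {0<..<len} \<Otimes>\<^sub>M \<nu>"
    using assms by (intro measurable_Pair1') (auto simp: space_restrict_space)
  from measurable_compose[OF this pt_measurable] show ?thesis by simp
qed

lemma card_before_le:
  assumes X: "X \<in> space S"
  shows "card {p \<in> X. card (before tm (tm p) X) \<le> n} \<le> Suc n"
proof -
  have fin: "finite X" using X by (rule space_S_D)
  have less: "card (before tm (tm p) X) < card (before tm (tm q) X)" if "p \<in> X" "tm p < tm q" for p q
    using that fin by (intro psubset_card_mono) (auto simp: before_def)
  have "inj_on (\<lambda>p. card (before tm (tm p) X)) X"
  proof (rule inj_onI)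
    fix p q assume pq: "p \<in> X" "q \<in> X" and "card (before tm (tm p) X) = card (before tm (tm q) X)"
    then have "tm p = tm q" using less[of p q] less[of q p] by (cases "tm p" "tm q" rule: linorder_cases) auto
    then show "p = q" using space_S_D(3)[OF X] pq by (simp add: inj_on_def)
  qed
  then have "card {p \<in> X. card (before tm (tm p) X) \<le> n} \<le> card {..n}"
    by (intro card_inj_on_le) (auto intro: inj_on_subset)
  then show ?thesis by simp
qed

text \<open>Take the mean under \<open>P\<close> of \<open>path_identity\<close> at the end of the
  segment. By the intensity the sum of the values before the points has the same mean as the drift
  integral with \<open>rate\<close> (\<open>AI\<close>), and the sum of the values after the points
  the same mean as the integral of \<open>mix\<close> (\<open>AG\<close>). These terms stand on
  opposite sides and cancel, since the cap \<open>N\<close> makes their means finite; what remains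
  is the claim. In particular the tested means depend on \<open>P\<close> only through its
  intensity.\<close>

theorem integral_intensity:
  assumes P: "has_cond_intensity l B tm P g" and B: "sigma_finite_measure B"
    and g: "(\<lambda>(p, Y). g p Y) \<in> borel_measurable (B \<Otimes>\<^sub>M S)"
    and g_eq: "\<And>Y t m. Y \<in> space S \<Longrightarrow> 0 < t \<Longrightarrow> t < len \<Longrightarrow> m \<in> space \<nu> \<Longrightarrow> (\<forall>q\<in>Y. tm q < t) \<Longrightarrow>
      ennreal (g (pt t m) Y) = rate Y t * mk Y t m"
    and \<psi>[measurable]: "\<psi> \<in> borel_measurable S" and \<psi>1: "\<And>Y. Y \<in> space S \<Longrightarrow> \<psi> Y \<le> 1"
    and \<psi>0: "\<And>Y. Y \<in> space S \<Longrightarrow> N < card Y \<Longrightarrow> \<psi> Y = 0"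
  shows "(\<integral>\<^sup>+X. \<psi> X \<partial>P) = val \<psi> {} 0"
proof -
  have sets_P[measurable_cong]: "sets P = sets S" and prob: "prob_space P"
    using P by (auto simp: has_cond_intensity_def)
  have sp: "space P = space S" using sets_P by (rule sets_eq_imp_space_eq)
  interpret P: prob_space P by fact
  note [measurable] = measurable_mix[OF val_measurable[OF \<psi>]]
  \<comment> \<open>The Campbell formula in time coordinates, with the intensity split into rate and
    mark density.\<close>
  have main: "(\<integral>\<^sup>+X. (\<Sum>p\<in>X. u (p, before tm (tm p) X)) \<partial>P) =
      (\<integral>\<^sup>+X. ivl 0 len (\<lambda>t. rate (before tm t X) t * (\<integral>\<^sup>+m. mk (before tm t X) t m * u (pt t m, before tm t X) \<partial>\<nu>)) \<partial>P)"
    if u[measurable]: "u \<in> borel_measurable (B \<Otimes>\<^sub>M S)" for u :: "'p \<times> 'p set \<Rightarrow> ennreal"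
  proof -
    have "(\<integral>\<^sup>+p. u (p, before tm (tm p) X) * ennreal (g p (before tm (tm p) X)) \<partial>B) =
       ivl 0 len (\<lambda>t. rate (before tm t X) t * (\<integral>\<^sup>+m. mk (before tm t X) t m * u (pt t m, before tm t X) \<partial>\<nu>))"
      if X[measurable]: "X \<in> space S" for X
    proof -
      note [measurable] = g
      have "(\<integral>\<^sup>+p. u (p, before tm (tm p) X) * ennreal (g p (before tm (tm p) X)) \<partial>B) =
        (\<integral>\<^sup>+t. (if 0 < t \<and> t < len then \<integral>\<^sup>+m. u (pt t m, before tm (tm (pt t m)) X) *
           ennreal (g (pt t m) (before tm (tm (pt t m)) X)) \<partial>\<nu> else 0) \<partial>lborel)"
        by (rule integral_B) measurable
      also have "\<dots> = ivl 0 len (\<lambda>t. rate (before tm t X) t * (\<integral>\<^sup>+m. mk (before tm t X) t m * u (pt t m, before tm t X) \<partial>\<nu>))"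
        unfolding ivl_def using AE_lborel_singleton[of 0] AE_lborel_singleton[of len]
      proof (intro nn_integral_cong_AE, eventually_elim)
        fix t :: real assume t: "t \<noteq> 0" "t \<noteq> len"
        show "(if 0 < t \<and> t < len then \<integral>\<^sup>+m. u (pt t m, before tm (tm (pt t m)) X) *
             ennreal (g (pt t m) (before tm (tm (pt t m)) X)) \<partial>\<nu> else 0) =
          (if 0 \<le> t \<and> t \<le> len then rate (before tm t X) t * (\<integral>\<^sup>+m. mk (before tm t X) t m * u (pt t m, before tm t X) \<partial>\<nu>) else 0)"
        proof (cases "0 < t \<and> t < len")
          case True
          then have [measurable]: "pt t \<in> \<nu> \<rightarrow>\<^sub>M B" by (intro measurable_pt) auto
          have [measurable]: "before tm t X \<in> space S" by (rule before_in_S[OF X])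
          have "(\<integral>\<^sup>+m. u (pt t m, before tm (tm (pt t m)) X) * ennreal (g (pt t m) (before tm (tm (pt t m)) X)) \<partial>\<nu>) =
             (\<integral>\<^sup>+m. rate (before tm t X) t * (mk (before tm t X) t m * u (pt t m, before tm t X)) \<partial>\<nu>)"
          proof (intro nn_integral_cong)
            fix m assume m: "m \<in> space \<nu>"
            have "\<forall>q\<in>before tm t X. tm q < t" by (simp add: before_def)
            with True m have "ennreal (g (pt t m) (before tm t X)) = rate (before tm t X) t * mk (before tm t X) t m"
              by (intro g_eq before_in_S[OF X]) auto
            then show "u (pt t m, before tm (tm (pt t m)) X) * ennreal (g (pt t m) (before tm (tm (pt t m)) X)) =
              rate (before tm t X) t * (mk (before tm t X) t m * u (pt t m, before tm t X))"
              using True m by (simp add: tm_pt mult_ac)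
          qed
          also have "\<dots> = rate (before tm t X) t * (\<integral>\<^sup>+m. mk (before tm t X) t m * u (pt t m, before tm t X) \<partial>\<nu>)"
            by (rule nn_integral_cmult) measurable
          finally show ?thesis using True by simp
        qed (use t in auto)
      qed
      finally show ?thesis .
    qed
    then show ?thesis
      unfolding cond_intensity_sum[OF P B g u] by (intro nn_integral_cong) (simp add: sp)
  qed
  have before_S: "before tm t X \<in> space S" if "X \<in> space P" for t X
    using that before_in_S by (simp add: sp)
  have mk1: "(\<integral>\<^sup>+m. mk (before tm t X) t m * c \<partial>\<nu>) = c" if "X \<in> space P" "0 < t" "t < len" for t X c
  proof -
    note [measurable] = before_S[OF that(1)]
    show ?thesis using mk_prob[OF before_S[OF that(1)] that(2,3)] by (simp add: nn_integral_multc)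
  qed

  \<comment> \<open>The mean of the rate accumulated while there are at most \<open>n\<close> points
    is the mean number of points with at most \<open>n\<close> predecessors, hence at most
    \<open>Suc n\<close>. As patterns are finite, taking \<open>n = card X\<close> afterwards shows
    that the whole cumulative rate is almost surely finite, although its mean need not be.\<close>
  have fin_n: "AE X in P. ivl 0 len (\<lambda>t. rate (before tm t X) t * (if card (before tm t X) \<le> n then 1 else 0)) < \<top>" for n
  proof -
    let ?u = "\<lambda>(p :: 'p, Y). if card Y \<le> n then 1 else (0::ennreal)"
    have "(\<integral>\<^sup>+X. ivl 0 len (\<lambda>t. rate (before tm t X) t * (if card (before tm t X) \<le> n then 1 else 0)) \<partial>P) =
       (\<integral>\<^sup>+X. ivl 0 len (\<lambda>t. rate (before tm t X) t *
         (\<integral>\<^sup>+m. mk (before tm t X) t m * ?u (pt t m, before tm t X) \<partial>\<nu>)) \<partial>P)"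
      by (intro nn_integral_cong ivl_cong_less) (simp only: mk1 prod.case)
    also have "\<dots> = (\<integral>\<^sup>+X. (\<Sum>p\<in>X. ?u (p, before tm (tm p) X)) \<partial>P)"
      by (rule main[symmetric]) measurable
    also have "\<dots> \<le> (\<integral>\<^sup>+X. of_nat (Suc n) \<partial>P)"
    proof (rule nn_integral_mono)
      fix X assume "X \<in> space P"
      then have "X \<in> space S" by (simp add: sp)
      then show "(\<Sum>p\<in>X. ?u (p, before tm (tm p) X)) \<le> of_nat (Suc n)"
        using card_before_le[of X n] space_S_D(1)[of X]
        by (simp add: sum.If_cases Int_def of_nat_mono del: of_nat_Suc)
    qed
    also have "\<dots> < \<top>" by (simp add: P.emeasure_space_1 of_nat_less_top del: of_nat_Suc)
    finally have "AE X in P. ivl 0 len (\<lambda>t. rate (before tm t X) t * (if card (before tm t X) \<le> n then 1 else 0)) \<noteq> \<infinity>"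
      by (intro nn_integral_noteq_infinite) auto
    then show ?thesis by (simp add: less_top)
  qed
  have fin: "AE X in P. ivl 0 len (\<lambda>t. rate (before tm t X) t) < \<top>"
  proof -
    have "AE X in P. \<forall>n. ivl 0 len (\<lambda>t. rate (before tm t X) t * (if card (before tm t X) \<le> n then 1 else 0)) < \<top>"
      using fin_n by (subst AE_all_countable) auto
    then show ?thesis
    proof (rule AE_mp, intro AE_I2 impI)
      fix X assume X: "X \<in> space P"
        and *: "\<forall>n. ivl 0 len (\<lambda>t. rate (before tm t X) t * (if card (before tm t X) \<le> n then 1 else 0)) < \<top>"
      have "card (before tm t X) \<le> card X" for t
        using X space_S_D(1)[of X] by (intro card_mono) (auto simp: sp before_def)
      then show "ivl 0 len (\<lambda>t. rate (before tm t X) t) < \<top>" using *[rule_format, of "card X"] by simp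
    qed
  qed

  \<comment> \<open>Written with \<open>add_last\<close> because it is measurable on all pairs; on a
    point and its own past it is insertion.\<close>
  let ?A1 = "\<lambda>X. \<Sum>p\<in>X. val \<psi> (add_last tm p (before tm (tm p) X)) (tm p)"
  let ?A2 = "\<lambda>X. \<Sum>p\<in>X. val \<psi> (before tm (tm p) X) (tm p)"
  let ?I = "\<lambda>X. ivl 0 len (\<lambda>s. rate (before tm s X) s * val \<psi> (before tm s X) s)"
  let ?G = "\<lambda>X. ivl 0 len (\<lambda>s. mix (val \<psi>) (before tm s X) s)"
  have AI: "(\<integral>\<^sup>+X. ?A2 X \<partial>P) = (\<integral>\<^sup>+X. ?I X \<partial>P)"
  proof -
    have "(\<integral>\<^sup>+X. ?A2 X \<partial>P) = (\<integral>\<^sup>+X. (\<Sum>p\<in>X. (\<lambda>(p, Y). val \<psi> Y (tm p)) (p, before tm (tm p) X)) \<partial>P)"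
      by simp
    also have "\<dots> = (\<integral>\<^sup>+X. ivl 0 len (\<lambda>t. rate (before tm t X) t *
        (\<integral>\<^sup>+m. mk (before tm t X) t m * (\<lambda>(p, Y). val \<psi> Y (tm p)) (pt t m, before tm t X) \<partial>\<nu>)) \<partial>P)"
      by (rule main) measurable
    also have "\<dots> = (\<integral>\<^sup>+X. ?I X \<partial>P)"
    proof (intro nn_integral_cong ivl_cong_less)
      fix X t assume X: "X \<in> space P" and t: "0 < t" "t < len"
      have "(\<integral>\<^sup>+m. mk (before tm t X) t m * (\<lambda>(p, Y). val \<psi> Y (tm p)) (pt t m, before tm t X) \<partial>\<nu>) =
         (\<integral>\<^sup>+m. mk (before tm t X) t m * val \<psi> (before tm t X) t \<partial>\<nu>)"
        using t by (intro nn_integral_cong) (simp add: tm_pt)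
      then show "rate (before tm t X) t * (\<integral>\<^sup>+m. mk (before tm t X) t m *
          (\<lambda>(p, Y). val \<psi> Y (tm p)) (pt t m, before tm t X) \<partial>\<nu>) = rate (before tm t X) t * val \<psi> (before tm t X) t"
        using mk1[OF X t] by simp
    qed
    finally show ?thesis .
  qed
  have AG: "(\<integral>\<^sup>+X. ?A1 X \<partial>P) = (\<integral>\<^sup>+X. ?G X \<partial>P)"
  proof -
    have "(\<integral>\<^sup>+X. ?A1 X \<partial>P) = (\<integral>\<^sup>+X. (\<Sum>p\<in>X. (\<lambda>(p, Y). val \<psi> (add_last tm p Y) (tm p)) (p, before tm (tm p) X)) \<partial>P)"
      by simp
    also have "\<dots> = (\<integral>\<^sup>+X. ivl 0 len (\<lambda>t. rate (before tm t X) t *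
        (\<integral>\<^sup>+m. mk (before tm t X) t m * (\<lambda>(p, Y). val \<psi> (add_last tm p Y) (tm p)) (pt t m, before tm t X) \<partial>\<nu>)) \<partial>P)"
      by (rule main) measurable
    also have "\<dots> = (\<integral>\<^sup>+X. ?G X \<partial>P)"
      by (intro nn_integral_cong ivl_cong_less)
         (auto simp: mix_def add_pt_def tm_pt intro!: arg_cong2[where f="(*)"] nn_integral_cong)
    finally show ?thesis .
  qed
  have bound: "(\<Sum>p\<in>X. val \<psi> (Z p) (tm p)) \<le> of_nat (Suc N)"
    if X: "X \<in> space S" and Z: "\<And>p. p \<in> X \<Longrightarrow> Z p \<in> space S" "\<And>p. p \<in> X \<Longrightarrow> card (before tm (tm p) X) \<le> card (Z p)" for X Z
  proof -
    have "(\<Sum>p\<in>X. val \<psi> (Z p) (tm p)) \<le> (\<Sum>p\<in>X. if card (before tm (tm p) X) \<le> N then 1 else 0)"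
    proof (rule sum_mono)
      fix p assume p: "p \<in> X"
      have "p \<in> space B" using p X space_S_D(2) by auto
      from tm_range[OF this] have "val \<psi> (Z p) (tm p) \<le> 1"
        by (intro val_le_1 \<psi>1 Z p) auto
      moreover have "val \<psi> (Z p) (tm p) = 0" if "N < card (before tm (tm p) X)"
        using that Z(2)[OF p] by (intro val_eq_0[of N] \<psi>0 Z p) auto
      ultimately show "val \<psi> (Z p) (tm p) \<le> (if card (before tm (tm p) X) \<le> N then 1 else 0)" by auto
    qed
    also have "\<dots> \<le> of_nat (Suc N)"
      using card_before_le[OF X, of N] space_S_D(1)[OF X]
      by (simp add: sum.If_cases Int_def of_nat_mono del: of_nat_Suc)
    finally show ?thesis .
  qed
  have N: "(\<integral>\<^sup>+X. of_nat (Suc N) \<partial>P) < \<top>"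
    by (simp add: P.emeasure_space_1 of_nat_less_top del: of_nat_Suc)
  have A1_eq: "?A1 X = (\<Sum>p\<in>X. val \<psi> (insert p (before tm (tm p) X)) (tm p))" for X
    by (simp add: add_last_def before_def)
  have "(\<integral>\<^sup>+X. ?A2 X \<partial>P) \<le> (\<integral>\<^sup>+X. of_nat (Suc N) \<partial>P)"
    by (intro nn_integral_mono bound) (auto simp: sp before_in_S)
  with N have A2_fin: "(\<integral>\<^sup>+X. ?A2 X \<partial>P) < \<top>" by (rule order_le_less_trans[rotated])
  have "(\<integral>\<^sup>+X. ?A1 X \<partial>P) \<le> (\<integral>\<^sup>+X. of_nat (Suc N) \<partial>P)"
  proof (rule nn_integral_mono)
    fix X assume "X \<in> space P"
    then have X: "X \<in> space S" by (simp add: sp)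
    show "?A1 X \<le> of_nat (Suc N)"
    proof (rule bound[OF X])
      fix p assume p: "p \<in> X"
      show "add_last tm p (before tm (tm p) X) \<in> space S"
        using p space_S_D(2)[OF X] by (intro add_last_in_S before_in_S X) auto
      show "card (before tm (tm p) X) \<le> card (add_last tm p (before tm (tm p) X))"
        using space_S_D(1)[OF before_in_S[OF X]] by (intro card_mono) (auto simp: add_last_def)
    qed
  qed
  with N have A1_fin: "(\<integral>\<^sup>+X. ?A1 X \<partial>P) < \<top>" by (rule order_le_less_trans[rotated])
  have A1m: "?A1 \<in> borel_measurable P" and A2m: "?A2 \<in> borel_measurable P"
    by (auto intro!: measurable_pattern_sum[where B=B and l=l] simp: split_beta' sets_P cong: measurable_cong_sets)
  have balance: "(\<integral>\<^sup>+X. val \<psi> {} 0 + ?A1 X + ?I X \<partial>P) = (\<integral>\<^sup>+X. ?A2 X + \<psi> X + ?G X \<partial>P)"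
  proof (intro nn_integral_cong_AE)
    show "AE X in P. val \<psi> {} 0 + ?A1 X + ?I X = ?A2 X + \<psi> X + ?G X"
      using fin AE_space
    proof eventually_elim
      case (elim X)
      then have X: "X \<in> space S" by (simp add: sp)
      show ?case
        unfolding A1_eq val_len[OF \<psi> X, symmetric]
        using len_pos tm_range space_S_D(2)[OF X] elim(1)
        by (intro path_identity[OF \<psi> X]) (auto simp: less_imp_le dest!: subsetD)
    qed
  qed
  note [measurable] = A1m A2m
  have "(\<integral>\<^sup>+X. val \<psi> {} 0 + ?A1 X + ?I X \<partial>P) = (\<integral>\<^sup>+X. val \<psi> {} 0 + ?A1 X \<partial>P) + (\<integral>\<^sup>+X. ?I X \<partial>P)"
    by (rule nn_integral_add) measurable
  also have "(\<integral>\<^sup>+X. val \<psi> {} 0 + ?A1 X \<partial>P) = val \<psi> {} 0 + (\<integral>\<^sup>+X. ?A1 X \<partial>P)"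
    by (subst nn_integral_add) (measurable, simp add: P.emeasure_space_1)
  finally have 1: "(\<integral>\<^sup>+X. val \<psi> {} 0 + ?A1 X + ?I X \<partial>P) =
      val \<psi> {} 0 + (\<integral>\<^sup>+X. ?A1 X \<partial>P) + (\<integral>\<^sup>+X. ?A2 X \<partial>P)"
    by (simp only: AI)
  have "(\<integral>\<^sup>+X. ?A2 X + \<psi> X + ?G X \<partial>P) = (\<integral>\<^sup>+X. ?A2 X + \<psi> X \<partial>P) + (\<integral>\<^sup>+X. ?G X \<partial>P)"
    by (rule nn_integral_add) measurable
  also have "(\<integral>\<^sup>+X. ?A2 X + \<psi> X \<partial>P) = (\<integral>\<^sup>+X. ?A2 X \<partial>P) + (\<integral>\<^sup>+X. \<psi> X \<partial>P)"
    by (rule nn_integral_add) measurable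
  finally have 2: "(\<integral>\<^sup>+X. ?A2 X + \<psi> X + ?G X \<partial>P) =
      (\<integral>\<^sup>+X. ?A2 X \<partial>P) + (\<integral>\<^sup>+X. \<psi> X \<partial>P) + (\<integral>\<^sup>+X. ?A1 X \<partial>P)"
    by (simp only: AG)
  from balance have "val \<psi> {} 0 + (\<integral>\<^sup>+X. ?A1 X \<partial>P) + (\<integral>\<^sup>+X. ?A2 X \<partial>P) =
      (\<integral>\<^sup>+X. ?A2 X \<partial>P) + (\<integral>\<^sup>+X. \<psi> X \<partial>P) + (\<integral>\<^sup>+X. ?A1 X \<partial>P)"
    unfolding 1 2 .
  then have "((\<integral>\<^sup>+X. ?A1 X \<partial>P) + (\<integral>\<^sup>+X. ?A2 X \<partial>P)) + val \<psi> {} 0 =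
     ((\<integral>\<^sup>+X. ?A1 X \<partial>P) + (\<integral>\<^sup>+X. ?A2 X \<partial>P)) + (\<integral>\<^sup>+X. \<psi> X \<partial>P)"
    by (simp add: add_ac)
  then show ?thesis
    using A1_fin A2_fin by (subst (asm) ennreal_add_left_cancel) auto
qed

end

section \<open>Loops\<close>

context
  fixes SS :: "'s measure" and step :: "'s \<Rightarrow> 's measure" and s0 :: 's
  assumes step[measurable]: "step \<in> SS \<rightarrow>\<^sub>M subprob_algebra SS" and s0: "s0 \<in> space SS"
begin

lemma loop_law_subprob: "loop_law SS step s0 n \<in> space (subprob_algebra SS)"
proof (induction n)
  case 0
  show ?case using s0 by (simp add: space_subprob_algebra prob_space_return prob_space_imp_subprob_space)
next
  case (Suc n)
  then have "(\<lambda>_. loop_law SS step s0 n) \<in> count_space UNIV \<rightarrow>\<^sub>M subprob_algebra SS" by simp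
  from measurable_space[OF measurable_bind2[OF this step], of undefined] show ?case by simp
qed

lemma sets_loop_law: "sets (loop_law SS step s0 n) = sets SS"
  using loop_law_subprob by (simp add: space_subprob_algebra)

lemma measurable_step_loop_law: "step \<in> loop_law SS step s0 n \<rightarrow>\<^sub>M subprob_algebra SS"
  using step by (simp add: sets_loop_law cong: measurable_cong_sets)

lemma nn_integral_loop_law_Suc:
  "w \<in> borel_measurable SS \<Longrightarrow>
   (\<integral>\<^sup>+x. w x \<partial>loop_law SS step s0 (Suc n)) = (\<integral>\<^sup>+x. \<integral>\<^sup>+y. w y \<partial>step x \<partial>loop_law SS step s0 n)"
  by (simp add: nn_integral_bind[OF _ measurable_step_loop_law])

text \<open>The submartingale inequality. The test function may depend on the number of iterations,
  so that it can record how many points a state must have by then.\<close>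

lemma loop_law_ge:
  assumes w: "\<And>n. w n \<in> borel_measurable SS"
    and le: "\<And>n x. x \<in> space SS \<Longrightarrow> w n x \<le> (\<integral>\<^sup>+y. w (Suc n) y \<partial>step x)"
  shows "w 0 s0 \<le> (\<integral>\<^sup>+x. w n x \<partial>loop_law SS step s0 n)"
proof (induction n)
  case 0
  show ?case using w s0 by (simp add: nn_integral_return)
next
  case (Suc n)
  also have "(\<integral>\<^sup>+x. w n x \<partial>loop_law SS step s0 n) \<le> (\<integral>\<^sup>+x. \<integral>\<^sup>+y. w (Suc n) y \<partial>step x \<partial>loop_law SS step s0 n)"
    using le sets_eq_imp_space_eq[OF sets_loop_law] by (intro nn_integral_mono) auto
  finally show ?case unfolding nn_integral_loop_law_Suc[OF w] .
qed

end

lemma measurable_loop_law: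
  assumes "(\<lambda>(H, s). step H s) \<in> M \<Otimes>\<^sub>M SS \<rightarrow>\<^sub>M subprob_algebra SS" and "s0 \<in> space SS"
  shows "(\<lambda>H. loop_law SS (step H) s0 n) \<in> M \<rightarrow>\<^sub>M subprob_algebra SS"
proof (induction n)
  case 0
  then show ?case using assms(2) by simp
next
  case (Suc n)
  show ?case by simp (rule measurable_bind'[OF Suc], use assms(1) in \<open>simp add: split_beta'\<close>)
qed

text \<open>The limiting set function dominates \<open>P\<close> on every event and on its
  complement, while its total mass is at most 1, the mass of \<open>P\<close>; hence equality.
  Splitting the supremum over the two events is allowed because ended states stay as they are, so
  both sequences increase.\<close>

lemma
  fixes S :: "'q measure" and step :: "bool \<times> real \<times> 'q \<Rightarrow> (bool \<times> real \<times> 'q) measure"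
  defines "SS \<equiv> count_space UNIV \<Otimes>\<^sub>M (borel \<Otimes>\<^sub>M S)"
  assumes step[measurable]: "step \<in> SS \<rightarrow>\<^sub>M subprob_algebra SS" and s0: "s0 \<in> space SS"
    and stop: "\<And>r Y. Y \<in> space S \<Longrightarrow> step (True, r, Y) = return SS (True, r, Y)"
    and P: "prob_space P" "sets P = sets S"
    and ge: "\<And>A. A \<in> sets S \<Longrightarrow> emeasure P A \<le> (SUP n. emeasure (loop_law SS step s0 n) ({True} \<times> UNIV \<times> A))"
  shows loop_output_eq: "measure_of (space S) (sets S) (\<lambda>A. SUP n. emeasure (loop_law SS step s0 n) ({True} \<times> UNIV \<times> A)) = P"
    and loop_output_emeasure: "\<And>A. A \<in> sets S \<Longrightarrow> (SUP n. emeasure (loop_law SS step s0 n) ({True} \<times> UNIV \<times> A)) = emeasure P A"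
proof -
  let ?m = "\<lambda>n A. emeasure (loop_law SS step s0 n) ({True} \<times> UNIV \<times> A)"
  interpret P: prob_space P by fact
  have sp: "space P = space S" using P(2) by (rule sets_eq_imp_space_eq)
  note sets_l = sets_loop_law[OF step s0]
  have T[measurable]: "{True} \<times> UNIV \<times> A \<in> sets SS" if "A \<in> sets S" for A
    unfolding SS_def using that by (intro pair_measureI) auto
  have inc: "incseq (\<lambda>n. ?m n A)" if A: "A \<in> sets S" for A
  proof (rule incseq_SucI)
    fix n
    have ne: "space (loop_law SS step s0 n) \<noteq> {}"
      using s0 sets_eq_imp_space_eq[OF sets_l] by auto
    have "?m n A = (\<integral>\<^sup>+x. indicator ({True} \<times> UNIV \<times> A) x \<partial>loop_law SS step s0 n)"
      using T[OF A] by (simp add: sets_l)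
    also have "\<dots> \<le> (\<integral>\<^sup>+x. emeasure (step x) ({True} \<times> UNIV \<times> A) \<partial>loop_law SS step s0 n)"
    proof (rule nn_integral_mono)
      fix x assume "x \<in> space (loop_law SS step s0 n)"
      then have x: "x \<in> space SS" using sets_eq_imp_space_eq[OF sets_l] by simp
      show "indicator ({True} \<times> UNIV \<times> A) x \<le> emeasure (step x) ({True} \<times> UNIV \<times> A)"
      proof (cases "x \<in> {True} \<times> UNIV \<times> A")
        case True
        then obtain r Y where "x = (True, r, Y)" "Y \<in> A" by auto
        then show ?thesis using stop[of Y r] sets.sets_into_space[OF A] T[OF A] by auto
      qed simp
    qed
    also have "\<dots> = ?m (Suc n) A"
      using emeasure_bind[OF ne measurable_step_loop_law[OF step s0] T[OF A]] by simp
    finally show "?m n A \<le> ?m (Suc n) A" .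
  qed
  show eq: "(SUP n. ?m n A) = emeasure P A" if A: "A \<in> sets S" for A
  proof (rule antisym)
    have A': "space S - A \<in> sets S" using A by auto
    have sum: "?m n A + ?m n (space S - A) \<le> 1" for n
    proof -
      have sub: "subprob_space (loop_law SS step s0 n)"
        using loop_law_subprob[OF step s0, of n] by (simp add: space_subprob_algebra)
      have "?m n A + ?m n (space S - A) = emeasure (loop_law SS step s0 n) ({True} \<times> UNIV \<times> A \<union> {True} \<times> UNIV \<times> (space S - A))"
        using T[OF A] T[OF A'] by (intro plus_emeasure) (auto simp: sets_l)
      also have "\<dots> \<le> 1" by (rule subprob_space.subprob_emeasure_le_1[OF sub])
      finally show ?thesis .
    qed
    have "(SUP n. ?m n A) + (SUP n. ?m n (space S - A)) = (SUP n. ?m n A + ?m n (space S - A))"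
      by (rule ennreal_SUP_add[symmetric]) (rule inc[OF A], rule inc[OF A'])
    also have "\<dots> \<le> 1" using sum by (rule SUP_least)
    also have "1 = emeasure P A + emeasure P (space S - A)"
      using A A' P(2) plus_emeasure[of A P "space S - A"] P.emeasure_space_1 sets.sets_into_space[OF A]
      by (simp add: sp Un_absorb1)
    finally have "(SUP n. ?m n A) + (SUP n. ?m n (space S - A)) \<le> emeasure P A + emeasure P (space S - A)" .
    with ge[OF A'] have "(SUP n. ?m n A) + emeasure P (space S - A) \<le> emeasure P A + emeasure P (space S - A)"
      by (meson add_left_mono order_trans)
    then show "(SUP n. ?m n A) \<le> emeasure P A"
      unfolding add.commute[of _ "emeasure P (space S - A)"] ennreal_add_left_cancel_le by simp
  qed (rule ge[OF A])
  \<comment> \<open>Only the equality with \<open>P\<close> on events shows that the set function is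
    countably additive, so that \<open>measure_of\<close> returns it.\<close>
  have "measure_of (space S) (sets S) (\<lambda>A. SUP n. ?m n A) = measure_of (space P) (sets P) (emeasure P)"
    unfolding sp P(2)
    by (rule measure_of_eq) (auto simp: sets.space_closed eq sets.sigma_sets_eq)
  then show "measure_of (space S) (sets S) (\<lambda>A. SUP n. ?m n A) = P" by (simp add: measure_of_of_measure)
qed

section \<open>Solutions of the inverse method\<close>

definition level_set :: "real \<Rightarrow> (real \<Rightarrow> ennreal) \<Rightarrow> real \<Rightarrow> real set" where
  "level_set len h a = {t \<in> {0<..<len}. ivl 0 t h = ennreal a}"

lemma ivl_eq_0_mono: "ivl a t h = 0 \<Longrightarrow> s \<le> t \<Longrightarrow> ivl a s h = 0"
  using ivl_mono_bound[of s t a h] by simp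

text \<open>For \<open>0 < a\<close> the infimum is the \<open>least_level\<close> on an interval
  ending at any solution, and is itself a solution. For a \<le> 0 the level is 0 in
  \<open>ennreal\<close> and the solutions fill an interval that starts at 0 but does not contain
  it; hence the positivity assumption in the last claim.\<close>

lemma Inf_level_set:
  assumes h[measurable]: "h \<in> borel_measurable borel" and ne: "level_set len h a \<noteq> {}"
  defines "z \<equiv> Inf (level_set len h a)"
  shows "0 \<le> z" "z < len" "\<And>q. 0 < q \<Longrightarrow> ennreal a \<le> ivl 0 q h \<longleftrightarrow> z \<le> q"
    "0 < a \<Longrightarrow> z \<in> level_set len h a"
proof -
  obtain t where t: "0 < t" "t < len" "ivl 0 t h = ennreal a"
    using ne by (auto simp: level_set_def)
  have "0 \<le> z \<and> z < len \<and> (\<forall>q>0. ennreal a \<le> ivl 0 q h \<longleftrightarrow> z \<le> q) \<and> (0 < a \<longrightarrow> z \<in> level_set len h a)"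
  proof (cases "0 < a")
    case True
    let ?w = "least_level 0 t h a"
    have fin: "ivl 0 t h < \<top>" using t by simp
    note w = least_level[OF h less_imp_le[OF t(1)] fin, of a, unfolded t(3), OF less_imp_le[OF True] order_refl]
    have w0: "0 < ?w" using w True by (cases "?w = 0") auto
    then have mem: "?w \<in> level_set len h a" using w t by (simp add: level_set_def)
    have iff: "ennreal a \<le> ivl 0 q h \<longleftrightarrow> ?w \<le> q" if "0 < q" for q
    proof (cases "q \<le> t")
      case False
      then show ?thesis using w(2) ivl_mono_bound[of t q 0 h] t by simp
    qed (use w that in simp)
    have "z = ?w"
      unfolding z_def
    proof (rule cInf_eq_minimum[OF mem])
      fix r assume "r \<in> level_set len h a"
      then show "?w \<le> r" using iff[of r] by (simp add: level_set_def)
    qed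
    then show ?thesis using w0 w t mem iff by auto
  next
    case False
    then have a: "ennreal a = 0" by (simp add: ennreal_neg)
    have mem: "r \<in> level_set len h a" if "0 < r" "r \<le> t" for r
      using that t a ivl_eq_0_mono[of 0 t h r] by (simp add: level_set_def)
    have "z = 0"
    proof (rule antisym)
      have bdd: "bdd_below (level_set len h a)" by (auto simp: level_set_def intro: bdd_belowI[of _ 0])
      show "z \<le> 0"
      proof (rule field_le_epsilon)
        fix e :: real assume "0 < e"
        then have "z \<le> min e t" unfolding z_def using t by (intro cInf_lower bdd mem) auto
        then show "z \<le> 0 + e" by simp
      qed
      show "0 \<le> z" unfolding z_def using ne by (intro cInf_greatest) (auto simp: level_set_def)
    qed
    then show ?thesis using False a t by auto
  qed
  then show "0 \<le> z" "z < len" "\<And>q. 0 < q \<Longrightarrow> ennreal a \<le> ivl 0 q h \<longleftrightarrow> z \<le> q"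
    "0 < a \<Longrightarrow> z \<in> level_set len h a" by auto
qed

context
  fixes h :: "'y \<Rightarrow> real \<Rightarrow> ennreal" and a :: "'y \<Rightarrow> real" and len :: real and M :: "'y measure"
  assumes h[measurable]: "(\<lambda>(y, x). h y x) \<in> borel_measurable (M \<Otimes>\<^sub>M borel)"
    and a[measurable]: "a \<in> borel_measurable M" and len_pos: "0 < len"
begin

text \<open>A countable infimum, for the sake of measurability. The rationals below the level get
  the value \<open>len\<close>, which is above the infimum when there is a solution.\<close>

definition rat_level :: "'y \<Rightarrow> real" where
  "rat_level y = (INF q\<in>\<rat> \<inter> {0<..<len}. if ennreal (a y) \<le> ivl 0 q (h y) then q else len)"

lemma rat_level_measurable[measurable]: "rat_level \<in> borel_measurable M"
  unfolding rat_level_def by (intro borel_measurable_cINF_real) (auto simp: countable_rat)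

lemma rat_level_eq:
  assumes y: "y \<in> space M" and ne: "level_set len (h y) (a y) \<noteq> {}"
  shows "rat_level y = Inf (level_set len (h y) (a y))"
proof -
  have [measurable]: "h y \<in> borel_measurable borel"
    using measurable_compose[OF measurable_Pair1'[OF y] h] by simp
  let ?z = "Inf (level_set len (h y) (a y))"
  note z = Inf_level_set[OF _ ne, simplified]
  have "rat_level y = (INF q\<in>\<rat> \<inter> {0<..<len}. if ?z \<le> q then q else len)"
    unfolding rat_level_def using z(3) by (intro INF_cong) auto
  also have "\<dots> = ?z"
  proof (rule antisym)
    have rat: "\<exists>q\<in>\<rat> \<inter> {0<..<len}. ?z \<le> q \<and> q < e" if e: "?z < e" for e
    proof -
      obtain q where "q \<in> \<rat>" "?z < q" "q < min e len"
        using Rats_dense_in_real[of ?z "min e len"] e z(2) by auto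
      then show ?thesis using z(1) by (intro bexI[of _ q]) auto
    qed
    show "?z \<le> (INF q\<in>\<rat> \<inter> {0<..<len}. if ?z \<le> q then q else len)"
      using rat[OF z(2)] z(2) by (intro cINF_greatest) auto
    show "(INF q\<in>\<rat> \<inter> {0<..<len}. if ?z \<le> q then q else len) \<le> ?z"
    proof (rule dense_ge)
      fix e assume "?z < e"
      from rat[OF this] obtain q where q: "q \<in> \<rat> \<inter> {0<..<len}" "?z \<le> q" "q < e" by blast
      have "(INF q\<in>\<rat> \<inter> {0<..<len}. if ?z \<le> q then q else len) \<le> (if ?z \<le> q then q else len)"
        using q z(1) len_pos by (intro cINF_lower) (auto intro!: bdd_belowI[of _ 0])
      then show "(INF q\<in>\<rat> \<inter> {0<..<len}. if ?z \<le> q then q else len) \<le> e" using q by simp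
    qed
  qed
  finally show ?thesis .
qed

text \<open>For a positive level, solutions exist exactly if \<open>rat_level\<close> is one, a
  condition on measurable functions. For other levels the cumulative rate vanishes up to some time,
  hence up to a rational one.\<close>

lemma pred_level_set: "Measurable.pred M (\<lambda>y. level_set len (h y) (a y) \<noteq> {})"
proof -
  have "level_set len (h y) (a y) \<noteq> {} \<longleftrightarrow>
      (if a y \<le> 0 then \<exists>q\<in>\<rat> \<inter> {0<..<len}. ivl 0 q (h y) = 0
       else 0 < rat_level y \<and> rat_level y < len \<and> ivl 0 (rat_level y) (h y) = ennreal (a y))"
    if y: "y \<in> space M" for y
  proof (cases "a y \<le> 0")
    case True
    then have a0: "ennreal (a y) = 0" by (simp add: ennreal_neg)
    have "\<exists>q\<in>\<rat> \<inter> {0<..<len}. ivl 0 q (h y) = 0" if t: "t \<in> level_set len (h y) (a y)" for t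
    proof -
      obtain q where "q \<in> \<rat>" "0 < q" "q < t"
        using Rats_dense_in_real[of 0 t] t by (auto simp: level_set_def)
      then show ?thesis using t a0 ivl_eq_0_mono[of 0 t "h y" q] by (intro bexI[of _ q]) (auto simp: level_set_def)
    qed
    then show ?thesis using True a0 by (auto simp: level_set_def)
  next
    case False
    have [measurable]: "h y \<in> borel_measurable borel"
      using measurable_compose[OF measurable_Pair1'[OF y] h] by simp
    have "level_set len (h y) (a y) \<noteq> {} \<Longrightarrow> rat_level y \<in> level_set len (h y) (a y)"
      using False rat_level_eq[OF y] Inf_level_set(4)[of "h y" len "a y"] by simp
    moreover have "rat_level y \<in> level_set len (h y) (a y) \<longleftrightarrow>
        0 < rat_level y \<and> rat_level y < len \<and> ivl 0 (rat_level y) (h y) = ennreal (a y)"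
      by (simp add: level_set_def)
    ultimately show ?thesis using False by auto
  qed
  moreover have "Measurable.pred M (\<lambda>y. if a y \<le> 0 then \<exists>q\<in>\<rat> \<inter> {0<..<len}. ivl 0 q (h y) = 0
       else 0 < rat_level y \<and> rat_level y < len \<and> ivl 0 (rat_level y) (h y) = ennreal (a y))"
    by (intro pred_intros_logic pred_intros_countable_bounded measurable_If) (auto simp: countable_rat)
  ultimately show ?thesis by (simp cong: measurable_cong)
qed

end

lemma measurable_Inf_level_set:
  fixes h :: "'y \<Rightarrow> real \<Rightarrow> ennreal"
  assumes h: "(\<lambda>(y, x). h y x) \<in> borel_measurable (M \<Otimes>\<^sub>M borel)" and a: "a \<in> borel_measurable M" and len: "0 < len"
  shows "(\<lambda>y. Inf (level_set len (h y) (a y))) \<in> borel_measurable M"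
proof (subst measurable_cong)
  show "Inf (level_set len (h y) (a y)) =
      (if level_set len (h y) (a y) \<noteq> {} then rat_level h a len y else Inf {})" if "y \<in> space M" for y
    using rat_level_eq[OF h a len that] by auto
  note [measurable] = rat_level_measurable[OF h a len] pred_level_set[OF h a len]
  show "(\<lambda>y. if level_set len (h y) (a y) \<noteq> {} then rat_level h a len y else Inf {}) \<in> borel_measurable M"
    by measurable
qed

section \<open>One step of the algorithms\<close>

lemma ivl_const: "a \<le> b \<Longrightarrow> ivl a b (\<lambda>_. c) = c * ennreal (b - a)"
proof -
  assume "a \<le> b"
  have "ivl a b (\<lambda>_. c) = (\<integral>\<^sup>+x. c * indicator {a..b} x \<partial>lborel)"
    unfolding ivl_def by (intro nn_integral_cong) (auto simp: indicator_def)
  then show ?thesis using \<open>a \<le> b\<close> by (simp add: nn_integral_cmult)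
qed

lemma ivl_shift:
  assumes [measurable]: "h \<in> borel_measurable borel"
  shows "ivl (t + a) (t + b) h = ivl a b (\<lambda>x. h (t + x))"
  unfolding ivl_def by (subst nn_integral_real_affine[of _ 1 t]) (auto cong: if_cong)

lemma exp_tail:
  assumes "0 < m"
  shows "(\<integral>\<^sup>+x. (if D < x then ennreal (m * exp (- m * x)) else 0) \<partial>lborel) = ennreal (exp (- m * D))"
proof -
  have "(\<integral>\<^sup>+x. (if D < x then ennreal (m * exp (- m * x)) else 0) \<partial>lborel) =
      (\<integral>\<^sup>+x. ennreal (m * exp (- m * x)) * indicator {D..} x \<partial>lborel)"
    using AE_lborel_singleton[of D] by (intro nn_integral_cong_AE) (auto simp: indicator_def)
  also have "\<dots> = ennreal (0 - (- exp (- m * D)))"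
  proof (rule nn_integral_FTC_atLeast)
    show "((\<lambda>x. - exp (- m * x)) \<longlongrightarrow> 0) at_top"
    proof -
      have "filterlim (\<lambda>x. - m * x) at_bot at_top"
        using assms by (intro filterlim_tendsto_neg_mult_at_bot[OF tendsto_const _ filterlim_ident]) auto
      then have "((\<lambda>x. exp (- m * x)) \<longlongrightarrow> 0) at_top"
        by (rule filterlim_compose[OF exp_at_bot])
      then show ?thesis using tendsto_minus[of "\<lambda>x. exp (- m * x)" 0 at_top] by simp
    qed
  qed (use assms in \<open>auto intro!: derivative_eq_intros\<close>)
  finally show ?thesis by simp
qed

context marked_line
begin

text \<open>The factor of \<open>mix\<close> without the rate: both algorithms find the time of the
  point in one draw and the mark in a later one.\<close>

definition mean_after :: "('p set \<Rightarrow> ennreal) \<Rightarrow> 'p set \<Rightarrow> real \<Rightarrow> ennreal" where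
  "mean_after \<psi> Y s = (\<integral>\<^sup>+m. mk Y s m * val \<psi> (add_pt s m Y) s \<partial>\<nu>)"

lemma mix_val: "mix (val \<psi>) Y s = rate Y s * mean_after \<psi> Y s"
  by (simp add: mix_def mean_after_def)

lemma measurable_mean_after[measurable (raw)]:
  assumes [measurable]: "\<psi> \<in> borel_measurable S" "X \<in> M \<rightarrow>\<^sub>M S" "s \<in> borel_measurable M"
  shows "(\<lambda>y. mean_after \<psi> (X y) (s y)) \<in> borel_measurable M"
  unfolding mean_after_def by measurable

text \<open>This is \<open>renewal_thinning\<close> with k = m - rate: candidates then come at
  constant rate \<open>m\<close>, the waiting time is exponential, and a candidate is a point with
  probability rate / m. The value at \<open>t + D\<close> carries the tail, where no candidate falls
  into the window.\<close>

lemma val_thinning: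
  assumes \<psi>[measurable]: "\<psi> \<in> borel_measurable S" and Y[measurable]: "Y \<in> space S"
    and D: "0 < D" "t + D \<le> len" and m: "0 < m"
    and bound: "\<And>s. t \<le> s \<Longrightarrow> s \<le> t + D \<Longrightarrow> rate Y s \<le> ennreal m"
  shows "val \<psi> Y t = (\<integral>\<^sup>+x. ennreal (exponential_density m x) *
      (if x \<le> D then (1 - rate Y (t + x) / ennreal m) * val \<psi> Y (t + x) +
          rate Y (t + x) / ennreal m * mean_after \<psi> Y (t + x)
       else val \<psi> Y (t + D)) \<partial>lborel)"
proof -
  let ?c = "val \<psi> Y (t + D)"
  \<comment> \<open>Set to 0 outside of the window, where \<open>m\<close> need not bound the rate;
    inside, the truncated subtraction of \<open>ennreal\<close> is a true one.\<close>
  define k where "k s = (if t \<le> s \<and> s \<le> t + D then ennreal m - rate Y s else 0)" for s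
  define R where "R x = (1 - rate Y (t + x) / ennreal m) * val \<psi> Y (t + x) +
          rate Y (t + x) / ennreal m * mean_after \<psi> Y (t + x)" for x
  have [measurable]: "k \<in> borel_measurable borel" unfolding k_def by measurable
  have [measurable]: "R \<in> borel_measurable borel" unfolding R_def by measurable
  note [measurable] = measurable_mix[OF val_measurable[OF \<psi>]]
  have rest: "renewal (rate Y) (mix (val \<psi>) Y) ?c (t + D) s = val \<psi> Y s" if "t \<le> s" "s \<le> t + D" for s
    using val_restart[OF \<psi> Y that(2) D(2)] by simp
  have kr: "ivl t s (\<lambda>x. k x + rate Y x) = ennreal (m * (s - t))" if "t \<le> s" "s \<le> t + D" for s
  proof -
    have "ivl t s (\<lambda>x. k x + rate Y x) = ivl t s (\<lambda>x. ennreal m)"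
      using that bound by (intro ivl_cong) (simp add: k_def diff_add_cancel_ennreal)
    then show ?thesis using m that by (simp add: ivl_const ennreal_mult)
  qed
  have "ivl t (t + D) k \<le> ivl t (t + D) (\<lambda>x. ennreal m)"
    by (intro ivl_mono) (simp add: k_def)
  also have "\<dots> < \<top>" using D m by (simp add: ivl_const flip: ennreal_mult)
  finally have fin: "ivl t (t + D) k < \<top>" .
  \<comment> \<open>\<open>R\<close> is the mean value at a candidate, decided by the acceptance
    probability; multiplied by \<open>m\<close> it splits into a term for rejections at rate
    \<open>k\<close> and a term for points.\<close>
  have mR: "k (t + x) * val \<psi> Y (t + x) + mix (val \<psi>) Y (t + x) = ennreal m * R x" if x: "0 \<le> x" "x \<le> D" for x
  proof -
    obtain r where r: "0 \<le> r" "rate Y (t + x) = ennreal r" "r \<le> m"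
      using bound[of "t + x"] x m by (cases "rate Y (t + x)") (auto simp: top_unique)
    have "ennreal m * (1 - ennreal r / ennreal m) = ennreal m - ennreal r"
      using r m by (simp add: divide_ennreal ennreal_minus algebra_simps flip: ennreal_1 ennreal_mult)
    moreover have "ennreal m * (ennreal r / ennreal m) = ennreal r"
      using r m by (simp add: divide_ennreal flip: ennreal_mult)
    ultimately show ?thesis
      unfolding R_def using x r(2)
      by (simp add: k_def mix_val distrib_left mult.assoc[symmetric])
  qed
  have "val \<psi> Y t = ennreal (exp (- m * D)) * ?c +
     ivl t (t + D) (\<lambda>s. expn (ivl t s (\<lambda>x. k x + rate Y x)) *
       (k s * renewal (rate Y) (mix (val \<psi>) Y) ?c (t + D) s + mix (val \<psi>) Y s))"
    using renewal_thinning[of k "rate Y" "mix (val \<psi>) Y" t "t + D" ?c] fin D rest[of t] kr[of "t + D"] m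
    by (simp add: expn_ennreal)
  also have "ivl t (t + D) (\<lambda>s. expn (ivl t s (\<lambda>x. k x + rate Y x)) *
       (k s * renewal (rate Y) (mix (val \<psi>) Y) ?c (t + D) s + mix (val \<psi>) Y s)) =
     ivl (t + 0) (t + D) (\<lambda>s. ennreal (exp (- m * (s - t))) * (ennreal m * R (s - t)))"
    unfolding add_0_right
  proof (rule ivl_cong)
    fix s assume s: "t \<le> s" "s \<le> t + D"
    show "expn (ivl t s (\<lambda>x. k x + rate Y x)) *
       (k s * renewal (rate Y) (mix (val \<psi>) Y) ?c (t + D) s + mix (val \<psi>) Y s) =
      ennreal (exp (- m * (s - t))) * (ennreal m * R (s - t))"
      unfolding kr[OF s] rest[OF s] using mR[of "s - t"] s m by (simp add: expn_ennreal)
  qed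
  also have "\<dots> = ivl 0 D (\<lambda>x. ennreal (exp (- m * x)) * (ennreal m * R x))"
    by (subst ivl_shift) auto
  also have "ennreal (exp (- m * D)) * ?c = (\<integral>\<^sup>+x. (if D < x then ennreal (m * exp (- m * x)) else 0) * ?c \<partial>lborel)"
    by (subst nn_integral_multc) (auto simp: exp_tail[OF m])
  also have "(\<integral>\<^sup>+x. (if D < x then ennreal (m * exp (- m * x)) else 0) * ?c \<partial>lborel) +
      ivl 0 D (\<lambda>x. ennreal (exp (- m * x)) * (ennreal m * R x)) =
    (\<integral>\<^sup>+x. (if D < x then ennreal (m * exp (- m * x)) else 0) * ?c +
      (if 0 \<le> x \<and> x \<le> D then ennreal (exp (- m * x)) * (ennreal m * R x) else 0) \<partial>lborel)"
    unfolding ivl_def by (rule nn_integral_add[symmetric]) measurable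
  also have "\<dots> = (\<integral>\<^sup>+x. ennreal (exponential_density m x) * (if x \<le> D then R x else ?c) \<partial>lborel)"
    using m D by (intro nn_integral_cong) (auto simp: exponential_density_def ennreal_mult mult_ac)
  finally show ?thesis unfolding R_def .
qed

text \<open>Only an inequality: where the cumulative rate jumps to infinity, the inverse method stops with
  positive probability although \<open>val\<close> gives no weight to stopping.\<close>

lemma val_inverse:
  assumes \<psi>[measurable]: "\<psi> \<in> borel_measurable S" and Y[measurable]: "Y \<in> space S"
    and t: "0 \<le> t" "t \<le> len" and s: "0 \<le> s" "ivl 0 t (rate Y) = ennreal s"
  shows "val \<psi> Y t \<le> (\<integral>\<^sup>+y. ennreal (exponential_density 1 y) *
      (if level_set len (rate Y) (s + y) \<noteq> {} then mean_after \<psi> Y (Inf (level_set len (rate Y) (s + y)))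
       else \<psi> Y) \<partial>lborel)"
proof -
  let ?h = "rate Y"
  let ?L = "\<lambda>y. level_set len ?h (s + y)"
  have hm: "(\<lambda>(y::real, x). ?h x) \<in> borel_measurable (borel \<Otimes>\<^sub>M borel)" by measurable
  have [measurable]: "Measurable.pred borel (\<lambda>y. ?L y \<noteq> {})"
    by (rule pred_level_set[OF hm _ len_pos]) measurable
  then have "Measurable.pred borel (\<lambda>y. \<not> ?L y \<noteq> {})" by (rule pred_intros_logic)
  then have [measurable]: "Measurable.pred borel (\<lambda>y. ?L y = {})" by simp
  have [measurable]: "(\<lambda>y. Inf (?L y)) \<in> borel_measurable borel"
    by (rule measurable_Inf_level_set[OF hm _ len_pos]) measurable
  note [measurable] = measurable_mix[OF val_measurable[OF \<psi>]]
  have add: "ivl 0 r ?h = ennreal s + ivl t r ?h" if "t \<le> r" for r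
    using ivl_split[of ?h 0 t r] t that s by simp
  \<comment> \<open>The contribution of the exponential variables for which the equation has a
    solution.\<close>
  let ?K = "\<integral>\<^sup>+y. (if 0 < y \<and> ?L y \<noteq> {} then ennreal (exp (- y)) * mean_after \<psi> Y (Inf (?L y)) else 0) \<partial>lborel"
  \<comment> \<open>As long as the cumulative rate is finite, \<open>time_change\<close> replaces
    the time of the next point by the level \<open>y\<close>, whose weight exp(- y) is the survival
    probability. The least level on \<open>[t, c]\<close> is the solution taken by the algorithm:
    earlier than \<open>t\<close> the cumulative rate is at most \<open>s < s + y\<close>.\<close>
  have 1: "ivl t len (\<lambda>r. mix (val \<psi>) Y r * expn (ivl t r ?h)) \<le> ?K"
  proof (rule ivl_le_finite_part[of ?h])
    fix c assume c: "t \<le> c" "c \<le> len" "ivl t c ?h < \<top>"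
    obtain C where C: "0 \<le> C" "ivl t c ?h = ennreal C"
      using c(3) by (cases "ivl t c ?h") auto
    have "ivl t c (\<lambda>r. mix (val \<psi>) Y r * expn (ivl t r ?h)) =
       ivl t c (\<lambda>r. ?h r * (mean_after \<psi> Y r * expn (ivl t r ?h)))"
      by (simp add: mix_val mult.assoc)
    also have "\<dots> = (\<integral>\<^sup>+y. mean_after \<psi> Y (least_level t c ?h y) * expn (ivl t (least_level t c ?h y) ?h) *
        indicator {0<..<C} y \<partial>lborel)"
      by (rule time_change[OF _ c(1,3) _ C]) measurable
    also have "\<dots> \<le> ?K"
    proof (rule nn_integral_mono)
      fix y
      show "mean_after \<psi> Y (least_level t c ?h y) * expn (ivl t (least_level t c ?h y) ?h) * indicator {0<..<C} y
        \<le> (if 0 < y \<and> ?L y \<noteq> {} then ennreal (exp (- y)) * mean_after \<psi> Y (Inf (?L y)) else 0)"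
      proof (cases "0 < y \<and> y < C")
        case True
        let ?w = "least_level t c ?h y"
        have "ennreal y \<le> ivl t c ?h" using True C by (simp add: ennreal_leI)
        note w = least_level[OF _ c(1,3) less_imp_le this, simplified]
        have w1: "t \<le> ?w" "?w \<le> c" "ivl t ?w ?h = ennreal y" using w True by auto
        have tw: "t < ?w" using w1 True by (cases "?w = t") auto
        have wl: "?w < len"
        proof (cases "?w = len")
          case True
          then have "?w = c" using w1 c by auto
          then show ?thesis using w1(3) C \<open>0 < y \<and> y < C\<close> by simp
        qed (use w1 c in auto)
        have mem: "?w \<in> ?L y"
          using tw wl t s w1 True add[of ?w] by (simp add: level_set_def)
        moreover have "?w \<le> r" if "r \<in> ?L y" for r
        proof -
          have r: "0 < r" "ivl 0 r ?h = ennreal (s + y)" using that by (auto simp: level_set_def)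
          have "t \<le> r"
          proof (rule ccontr)
            assume "\<not> t \<le> r"
            then have "ivl 0 r ?h \<le> ennreal s" using ivl_mono_bound[of r t 0 ?h] s by simp
            then show False using r True s by simp
          qed
          then have "ivl t r ?h = ennreal y" using add[of r] r s True by simp
          then show ?thesis using w(4)[of r] \<open>t \<le> r\<close> w1(2) True by (cases "r \<le> c") auto
        qed
        ultimately have "Inf (?L y) = ?w" by (intro cInf_eq_minimum)
        then show ?thesis using True mem w1 by (auto simp: expn_ennreal mult.commute)
      qed (simp add: indicator_def)
    qed
    finally show "ivl t c (\<lambda>r. mix (val \<psi>) Y r * expn (ivl t r ?h)) \<le> ?K" .
  qed (use t in auto)
  \<comment> \<open>If \<open>C\<close> is the rate accumulated until the end, every level beyond
    \<open>C\<close> has no solution, and these have probability exp(- C). With an infinite rate the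
    left side is 0.\<close>
  have 2: "expn (ivl t len ?h) * \<psi> Y \<le> (\<integral>\<^sup>+y. (if 0 < y \<and> ?L y = {} then ennreal (exp (- y)) else 0) * \<psi> Y \<partial>lborel)"
  proof (cases "ivl t len ?h")
    case (real C)
    have "expn (ivl t len ?h) = (\<integral>\<^sup>+y. (if C < y then ennreal (1 * exp (- 1 * y)) else 0) \<partial>lborel)"
      using real by (subst exp_tail) (auto simp: expn_ennreal)
    also have "\<dots> \<le> (\<integral>\<^sup>+y. (if 0 < y \<and> ?L y = {} then ennreal (exp (- y)) else 0) \<partial>lborel)"
    proof (rule nn_integral_mono)
      fix y
      have "?L y = {}" if "C < y"
      proof -
        have "ivl 0 r ?h \<noteq> ennreal (s + y)" if "r < len" for r
        proof -
          have "ivl 0 r ?h \<le> ennreal (s + C)"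
            using ivl_mono_bound[of r len 0 ?h] add[of len] t that real s by (simp add: ennreal_plus)
          also have "\<dots> < ennreal (s + y)" using \<open>C < y\<close> s real by (simp add: ennreal_less_iff)
          finally show ?thesis by simp
        qed
        then show ?thesis by (auto simp: level_set_def)
      qed
      then show "(if C < y then ennreal (1 * exp (- 1 * y)) else 0) \<le> (if 0 < y \<and> ?L y = {} then ennreal (exp (- y)) else 0)"
        using real by auto
    qed
    finally have "expn (ivl t len ?h) \<le> (\<integral>\<^sup>+y. (if 0 < y \<and> ?L y = {} then ennreal (exp (- y)) else 0) \<partial>lborel)" .
    then have "expn (ivl t len ?h) * \<psi> Y \<le> (\<integral>\<^sup>+y. (if 0 < y \<and> ?L y = {} then ennreal (exp (- y)) else 0) \<partial>lborel) * \<psi> Y"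
      by (rule mult_right_mono) simp
    also have "\<dots> = (\<integral>\<^sup>+y. (if 0 < y \<and> ?L y = {} then ennreal (exp (- y)) else 0) * \<psi> Y \<partial>lborel)"
      by (rule nn_integral_multc[symmetric]) measurable
    finally show ?thesis .
  qed simp
  have "val \<psi> Y t \<le> ?K + (\<integral>\<^sup>+y. (if 0 < y \<and> ?L y = {} then ennreal (exp (- y)) else 0) * \<psi> Y \<partial>lborel)"
    unfolding val_renewal[OF \<psi> Y, of t] renewal_def by (rule add_mono[OF 1 2])
  also have "\<dots> = (\<integral>\<^sup>+y. (if 0 < y \<and> ?L y \<noteq> {} then ennreal (exp (- y)) * mean_after \<psi> Y (Inf (?L y)) else 0) +
      (if 0 < y \<and> ?L y = {} then ennreal (exp (- y)) else 0) * \<psi> Y \<partial>lborel)"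
    by (rule nn_integral_add[symmetric]) measurable
  also have "\<dots> \<le> (\<integral>\<^sup>+y. ennreal (exponential_density 1 y) *
      (if ?L y \<noteq> {} then mean_after \<psi> Y (Inf (?L y)) else \<psi> Y) \<partial>lborel)"
    by (intro nn_integral_mono) (auto simp: exponential_density_def)
  finally show ?thesis .
qed

end

section \<open>Geometry of the network\<close>

lemma seg_pt_dist: "lower L i \<noteq> upper L i \<Longrightarrow> dist (lower L i) (seg_pt L i t) = \<bar>t\<bar>"
  by (simp add: seg_pt_def dist_norm)

lemma seg_pt_inj: "lower L i \<noteq> upper L i \<Longrightarrow> seg_pt L i s = seg_pt L i t \<longleftrightarrow> s = t"
  by (auto simp: seg_pt_def)

lemma seg_eq_image:
  assumes "lower L i \<noteq> upper L i"
  shows "seg L i = seg_pt L i ` {0<..<seg_len L i}"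
proof -
  let ?l = "seg_len L i"
  have l: "0 < ?l" using assms by (simp add: seg_len_def)
  have eq: "seg_pt L i t = (1 - t / ?l) *\<^sub>R lower L i + (t / ?l) *\<^sub>R upper L i" for t
    by (simp add: seg_pt_def seg_len_def algebra_simps)
  show ?thesis
  proof (intro set_eqI iffI)
    fix x assume "x \<in> seg L i"
    then obtain u where u: "0 < u" "u < 1" "x = (1 - u) *\<^sub>R lower L i + u *\<^sub>R upper L i"
      by (auto simp: seg_def in_segment)
    then have "x = seg_pt L i (u * ?l)" using l by (simp add: eq)
    then show "x \<in> seg_pt L i ` {0<..<?l}" using u l by auto
  next
    fix x assume "x \<in> seg_pt L i ` {0<..<?l}"
    then obtain t where "0 < t" "t < ?l" "x = seg_pt L i t" by auto
    then show "x \<in> seg L i"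
      using assms l by (auto simp: seg_def in_segment eq intro!: exI[of _ "t / ?l"])
  qed
qed

lemma seg_borel[measurable]: "seg L i \<in> sets borel"
  by (simp add: seg_def open_segment_def borel_compact compact_segment sets.Diff)

lemma net_borel[measurable]: "net L \<in> sets borel"
  unfolding net_def by (intro sets.finite_UN) auto

lemma up_seg_borel[measurable]: "up_seg L i \<in> sets borel"
  unfolding up_seg_def by (intro sets.finite_UN) auto

lemma seg_pt_measurable[measurable]: "seg_pt L i \<in> borel_measurable borel"
  unfolding seg_pt_def by measurable

lemma up_seg_subset_net: "up_seg L i \<subseteq> net L"
  by (auto simp: up_seg_def net_def)

locale network_geometry =
  fixes L :: "'a::euclidean_space network"
  assumes lin: "linear_network L"
begin

lemma ends_neq: "i \<in> {1..nseg L} \<Longrightarrow> lower L i \<noteq> upper L i"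
  using lin by (auto simp: linear_network_def)

lemma seg_len_pos: "i \<in> {1..nseg L} \<Longrightarrow> 0 < seg_len L i"
  using ends_neq[of i] by (simp add: seg_len_def)

lemma seg_unique: "u \<in> seg L i \<Longrightarrow> u \<in> seg L j \<Longrightarrow> i \<in> {1..nseg L} \<Longrightarrow> j \<in> {1..nseg L} \<Longrightarrow> i = j"
  using lin unfolding linear_network_def disjoint_family_on_def by blast

lemma seg_subset_net: "i \<in> {1..nseg L} \<Longrightarrow> seg L i \<subseteq> net L"
  by (auto simp: net_def)

lemma seg_pt_in_seg: "i \<in> {1..nseg L} \<Longrightarrow> 0 < t \<Longrightarrow> t < seg_len L i \<Longrightarrow> seg_pt L i t \<in> seg L i"
  using seg_eq_image[OF ends_neq, of i] by auto

lemma segE: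
  assumes "i \<in> {1..nseg L}" "u \<in> seg L i"
  obtains t where "0 < t" "t < seg_len L i" "u = seg_pt L i t"
  using assms seg_eq_image[OF ends_neq, of i] by auto

lemma up_pt_eq:
  assumes i: "i \<in> {1..nseg L}" and t: "0 < t" "t < seg_len L i"
  shows "up_pt L (seg_pt L i t) = seg_part L i 0 t \<union> up_seg L i"
proof -
  have "j = i \<and> s = t" if "j \<in> {1..nseg L}" "0 < s" "s < seg_len L j" "seg_pt L i t = seg_pt L j s" for j s
  proof -
    have "seg_pt L i t \<in> seg L j" using seg_pt_in_seg[OF that(1-3)] that(4) by simp
    with seg_pt_in_seg[OF i t] have "i = j" by (rule seg_unique) (use i that in auto)
    then show ?thesis using that(4) seg_pt_inj[OF ends_neq[OF i]] by simp
  qed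
  then show ?thesis
    unfolding up_pt_def using i t by blast
qed

lemma up_seg_disjoint:
  assumes i: "i \<in> {1..nseg L}"
  shows "seg L i \<inter> up_seg L i = {}"
proof -
  have False if u: "u \<in> seg L i" "u \<in> up_seg L i" for u
  proof -
    obtain j where j: "j \<in> {1..nseg L}" "seg_before L j i" "u \<in> seg L j"
      using u(2) unfolding up_seg_def by blast
    with seg_unique[OF u(1) j(3) i j(1)] show False by (simp add: seg_before_def)
  qed
  then show ?thesis by blast
qed

lemma seg_part_iff:
  assumes i: "i \<in> {1..nseg L}" and u: "u \<in> seg L i" and t: "t \<le> seg_len L i"
  shows "u \<in> seg_part L i 0 t \<longleftrightarrow> dist (lower L i) u < t"
proof -
  obtain s where s: "0 < s" "s < seg_len L i" "u = seg_pt L i s" by (rule segE[OF i u])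
  then have "u \<in> seg_part L i 0 t \<longleftrightarrow> s < t"
    by (auto simp: seg_part_def seg_pt_inj[OF ends_neq[OF i]])
  then show ?thesis using s by (simp add: seg_pt_dist[OF ends_neq[OF i]])
qed

section \<open>The length measure in the coordinates of the segments\<close>

lemma sets_length_measure: "sets (length_measure L) = sets (restrict_space borel (net L))"
proof -
  have "sets (length_measure L) = sigma_sets (net L) (sets (restrict_space borel (net L)))"
    unfolding length_measure_def
    using sets.space_closed[of "restrict_space borel (net L)"]
    by (intro sets_measure_of) (simp add: space_restrict_space)
  also have "\<dots> = sets (restrict_space borel (net L))"
    using sets.sigma_sets_eq[of "restrict_space borel (net L)"] by (simp add: space_restrict_space)
  finally show ?thesis .
qed

lemma space_length_measure: "space (length_measure L) = net L"
  using sets_eq_imp_space_eq[OF sets_length_measure] by (simp add: space_restrict_space)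

text \<open>Each summand is the image of Lebesgue measure under the parametrisation of a segment, so
  the defining set function is a finite sum of measures and therefore countably additive.\<close>

lemma emeasure_length_measure:
  assumes A: "A \<in> sets (restrict_space borel (net L))"
  shows "emeasure (length_measure L) A =
    (\<Sum>i=1..nseg L. emeasure lborel {t \<in> {0<..<seg_len L i}. seg_pt L i t \<in> A})"
proof -
  let ?N = "\<lambda>i. distr (restrict_space lborel {0<..<seg_len L i}) (restrict_space borel (net L)) (seg_pt L i)"
  have m: "seg_pt L i \<in> restrict_space lborel {0<..<seg_len L i} \<rightarrow>\<^sub>M restrict_space borel (net L)"
    if "i \<in> {1..nseg L}" for i
    using seg_pt_in_seg[OF that] seg_subset_net[OF that]
    by (intro measurable_restrict_space2 measurable_restrict_space1) (auto simp: space_restrict_space)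
  have eq: "emeasure (?N i) A = emeasure lborel {t \<in> {0<..<seg_len L i}. seg_pt L i t \<in> A}"
    if "i \<in> {1..nseg L}" "A \<in> sets (restrict_space borel (net L))" for i A
    using that
    by (subst emeasure_distr[OF m])
       (auto simp: emeasure_restrict_space space_restrict_space intro!: arg_cong[where f="emeasure lborel"])
  show ?thesis
  proof (rule emeasure_measure_of[OF length_measure_def])
    show "sets (restrict_space borel (net L)) \<subseteq> Pow (net L)"
      using sets.space_closed[of "restrict_space borel (net L)"] by (simp add: space_restrict_space)
    show "A \<in> sets (length_measure L)" using A by (simp add: sets_length_measure)
    show "positive (sets (length_measure L)) (\<lambda>A. \<Sum>i = 1..nseg L. emeasure lborel {t \<in> {0<..<seg_len L i}. seg_pt L i t \<in> A})"
      by (simp add: positive_def)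
    show "countably_additive (sets (length_measure L)) (\<lambda>A. \<Sum>i = 1..nseg L. emeasure lborel {t \<in> {0<..<seg_len L i}. seg_pt L i t \<in> A})"
    proof (rule countably_additiveI)
      fix F :: "nat \<Rightarrow> 'a set"
      assume F: "range F \<subseteq> sets (length_measure L)" "disjoint_family F" "\<Union> (range F) \<in> sets (length_measure L)"
      then have F': "F n \<in> sets (restrict_space borel (net L))" for n by (auto simp: sets_length_measure)
      have "(\<Sum>n. \<Sum>i = 1..nseg L. emeasure lborel {t \<in> {0<..<seg_len L i}. seg_pt L i t \<in> F n}) =
        (\<Sum>n. \<Sum>i = 1..nseg L. emeasure (?N i) (F n))"
        using F' by (intro suminf_cong sum.cong) (auto simp: eq)
      also have "\<dots> = (\<Sum>i = 1..nseg L. \<Sum>n. emeasure (?N i) (F n))"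
        by (intro suminf_sum) auto
      also have "\<dots> = (\<Sum>i = 1..nseg L. emeasure (?N i) (\<Union> (range F)))"
        using F' F(2) by (intro sum.cong suminf_emeasure) auto
      also have "\<dots> = (\<Sum>i = 1..nseg L. emeasure lborel {t \<in> {0<..<seg_len L i}. seg_pt L i t \<in> \<Union> (range F)})"
        using F(3) by (intro sum.cong eq) (auto simp: sets_length_measure)
      finally show "(\<Sum>n. \<Sum>i = 1..nseg L. emeasure lborel {t \<in> {0<..<seg_len L i}. seg_pt L i t \<in> F n}) =
        (\<Sum>i = 1..nseg L. emeasure lborel {t \<in> {0<..<seg_len L i}. seg_pt L i t \<in> \<Union> (range F)})" .
    qed
  qed
qed

lemma finite_length_measure: "finite_measure (length_measure L)"
proof (rule finite_measureI)
  have "net L \<in> sets (restrict_space borel (net L))"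
    using sets.top[of "restrict_space borel (net L)"] by (simp add: space_restrict_space)
  then have "emeasure (length_measure L) (net L) =
      (\<Sum>i=1..nseg L. emeasure lborel {t \<in> {0<..<seg_len L i}. seg_pt L i t \<in> net L})"
    by (rule emeasure_length_measure)
  also have "\<dots> \<le> (\<Sum>i=1..nseg L. ennreal (seg_len L i))"
  proof (rule sum_mono)
    fix i
    have "emeasure lborel {t \<in> {0<..<seg_len L i}. seg_pt L i t \<in> net L} \<le> emeasure lborel {0<..<seg_len L i}"
      by (rule emeasure_mono) auto
    then show "emeasure lborel {t \<in> {0<..<seg_len L i}. seg_pt L i t \<in> net L} \<le> ennreal (seg_len L i)"
      by (simp add: seg_len_def)
  qed
  also have "\<dots> < \<top>" by (simp add: seg_len_def)
  finally show "emeasure (length_measure L) (space (length_measure L)) \<noteq> \<infinity>"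
    by (simp add: space_length_measure)
qed

lemma sets_restrict_length:
  "A \<subseteq> net L \<Longrightarrow> sets (restrict_space (length_measure L) A) = sets (restrict_space borel A)"
  by (simp add: sets_restrict_space_cong[OF sets_length_measure] sets_restrict_restrict_space Int_absorb1)

text \<open>By disjointness the other segments contribute the measure of the empty set.\<close>

lemma restrict_length_eq_distr:
  assumes i: "i \<in> {1..nseg L}"
  shows "restrict_space (length_measure L) (seg L i) =
    distr (restrict_space lborel {0<..<seg_len L i}) (restrict_space borel (seg L i)) (seg_pt L i)" (is "?A = ?D")
proof (rule measure_eqI)
  have m: "seg_pt L i \<in> restrict_space lborel {0<..<seg_len L i} \<rightarrow>\<^sub>M restrict_space borel (seg L i)"
    using seg_pt_in_seg[OF i]
    by (intro measurable_restrict_space2 measurable_restrict_space1) (auto simp: space_restrict_space)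
  show "sets ?A = sets ?D" by (simp add: sets_restrict_length seg_subset_net[OF i])
  fix Z assume "Z \<in> sets ?A"
  then have Z: "Z \<in> sets (restrict_space borel (seg L i))" by (simp add: sets_restrict_length seg_subset_net[OF i])
  then have Zs: "Z \<subseteq> seg L i" "Z \<in> sets borel" by (auto simp: sets_restrict_space)
  then have Zn: "Z \<in> sets (restrict_space borel (net L))"
    using seg_subset_net[OF i] by (auto simp: sets_restrict_space_iff)
  have sn: "seg L i \<inter> space (length_measure L) \<in> sets (length_measure L)"
    using seg_subset_net[OF i] by (auto simp: sets_length_measure space_length_measure sets_restrict_space_iff)
  have "emeasure ?A Z = emeasure (length_measure L) Z"
    using Zs by (intro emeasure_restrict_space[OF sn])
  also have "\<dots> = (\<Sum>j=1..nseg L. if j = i then emeasure lborel {t \<in> {0<..<seg_len L i}. seg_pt L i t \<in> Z} else 0)"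
    unfolding emeasure_length_measure[OF Zn]
  proof (rule sum.cong)
    fix j assume j: "j \<in> {1..nseg L}"
    show "emeasure lborel {t \<in> {0<..<seg_len L j}. seg_pt L j t \<in> Z} =
        (if j = i then emeasure lborel {t \<in> {0<..<seg_len L i}. seg_pt L i t \<in> Z} else 0)"
    proof (cases "j = i")
      case False
      then have e: "{t \<in> {0<..<seg_len L j}. seg_pt L j t \<in> Z} = {}"
        using seg_pt_in_seg[OF j] seg_unique[OF _ _ i j] Zs(1) by auto
      show ?thesis unfolding e using False by simp
    qed simp
  qed simp
  also have "\<dots> = emeasure lborel {t \<in> {0<..<seg_len L i}. seg_pt L i t \<in> Z}"
    using i by simp
  also have "\<dots> = emeasure ?D Z"
    using Z by (subst emeasure_distr[OF m])
      (auto simp: emeasure_restrict_space space_restrict_space intro!: arg_cong[where f="emeasure lborel"])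
  finally show "emeasure ?A Z = emeasure ?D Z" .
qed

lemma integral_restrict_length:
  assumes i: "i \<in> {1..nseg L}" and h: "h \<in> borel_measurable (restrict_space borel (seg L i))"
  shows "integral\<^sup>N (restrict_space (length_measure L) (seg L i)) h =
    (\<integral>\<^sup>+t. (if 0 < t \<and> t < seg_len L i then h (seg_pt L i t) else 0) \<partial>lborel)"
proof -
  have m: "seg_pt L i \<in> restrict_space lborel {0<..<seg_len L i} \<rightarrow>\<^sub>M restrict_space borel (seg L i)"
    using seg_pt_in_seg[OF i]
    by (intro measurable_restrict_space2 measurable_restrict_space1) (auto simp: space_restrict_space)
  have "integral\<^sup>N (restrict_space (length_measure L) (seg L i)) h =
     (\<integral>\<^sup>+t. h (seg_pt L i t) \<partial>restrict_space lborel {0<..<seg_len L i})"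
    unfolding restrict_length_eq_distr[OF i] by (rule nn_integral_distr[OF m]) (use h in simp)
  also have "\<dots> = (\<integral>\<^sup>+t. h (seg_pt L i t) * indicator {0<..<seg_len L i} t \<partial>lborel)"
    by (rule nn_integral_restrict_space) simp
  also have "\<dots> = (\<integral>\<^sup>+t. (if 0 < t \<and> t < seg_len L i then h (seg_pt L i t) else 0) \<partial>lborel)"
    by (intro nn_integral_cong) (auto simp: indicator_def)
  finally show ?thesis .
qed

end

section \<open>Points with and without marks\<close>

lemma sets_eqI_measurable_id:
  assumes "space M = space N" "(\<lambda>x. x) \<in> M \<rightarrow>\<^sub>M N" "(\<lambda>x. x) \<in> N \<rightarrow>\<^sub>M M"
  shows "sets M = sets N"
proof (intro set_eqI iffI)
  fix A assume A: "A \<in> sets M"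
  from measurable_sets[OF assms(3) A] sets.sets_into_space[OF A] assms(1) show "A \<in> sets N"
    by (simp add: Int_absorb2)
next
  fix A assume A: "A \<in> sets N"
  from measurable_sets[OF assms(2) A] sets.sets_into_space[OF A] assms(1) show "A \<in> sets M"
    by (simp add: Int_absorb2)
qed

text \<open>For marked points: restricting the places before or after forming the product with the
  marks gives the same measurable sets.\<close>

lemma sets_pair_restrict_space1:
  assumes "A \<in> sets borel" "A \<subseteq> C"
  shows "sets (restrict_space borel A \<Otimes>\<^sub>M N) = sets (restrict_space (restrict_space borel C \<Otimes>\<^sub>M N) (fst -` A))"
proof (rule sets_eqI_measurable_id)
  show "space (restrict_space borel A \<Otimes>\<^sub>M N) = space (restrict_space (restrict_space borel C \<Otimes>\<^sub>M N) (fst -` A))"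
    using assms by (auto simp: space_pair_measure space_restrict_space)
  show "(\<lambda>x. x) \<in> restrict_space borel A \<Otimes>\<^sub>M N \<rightarrow>\<^sub>M restrict_space (restrict_space borel C \<Otimes>\<^sub>M N) (fst -` A)"
  proof (rule measurable_restrict_space2)
    show "(\<lambda>x. x) \<in> restrict_space borel A \<Otimes>\<^sub>M N \<rightarrow>\<^sub>M restrict_space borel C \<Otimes>\<^sub>M N"
    proof (rule measurable_pair)
      show "fst \<circ> (\<lambda>x. x) \<in> restrict_space borel A \<Otimes>\<^sub>M N \<rightarrow>\<^sub>M restrict_space borel C"
        unfolding comp_def
      proof (rule measurable_restrict_space2)
        have "(\<lambda>x. x) \<in> restrict_space borel A \<rightarrow>\<^sub>M borel" by (rule measurable_restrict_space1) simp
        from measurable_compose[OF measurable_fst this]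
        show "(\<lambda>x. fst x) \<in> restrict_space borel A \<Otimes>\<^sub>M N \<rightarrow>\<^sub>M borel" .
      qed (use assms in \<open>auto simp: space_pair_measure space_restrict_space\<close>)
    qed (simp add: comp_def)
  qed (use assms in \<open>auto simp: space_pair_measure space_restrict_space\<close>)
  show "(\<lambda>x. x) \<in> restrict_space (restrict_space borel C \<Otimes>\<^sub>M N) (fst -` A) \<rightarrow>\<^sub>M restrict_space borel A \<Otimes>\<^sub>M N"
  proof (rule measurable_pair)
    show "fst \<circ> (\<lambda>x. x) \<in> restrict_space (restrict_space borel C \<Otimes>\<^sub>M N) (fst -` A) \<rightarrow>\<^sub>M restrict_space borel A"
      unfolding comp_def
    proof (rule measurable_restrict_space2)
      have "(\<lambda>x. x) \<in> restrict_space borel C \<rightarrow>\<^sub>M borel" by (rule measurable_restrict_space1) simp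
      from measurable_restrict_space1[OF measurable_compose[OF measurable_fst this]]
      show "(\<lambda>x. fst x) \<in> restrict_space (restrict_space borel C \<Otimes>\<^sub>M N) (fst -` A) \<rightarrow>\<^sub>M borel" .
    qed (auto simp: space_restrict_space)
    show "snd \<circ> (\<lambda>x. x) \<in> restrict_space (restrict_space borel C \<Otimes>\<^sub>M N) (fst -` A) \<rightarrow>\<^sub>M N"
      unfolding comp_def by (rule measurable_restrict_space1) simp
  qed
qed

text \<open>Unmarked points fit in with a mark space of one element.\<close>

locale point_model = network_geometry L + sigma_finite_measure \<nu>
  for L :: "'a::euclidean_space network" and \<nu> :: "'m measure" +
  fixes \<kappa> :: "('a, 'p) point_kind" and mkp :: "'a \<Rightarrow> 'm \<Rightarrow> 'p"
  assumes loc_mkp: "\<And>u m. loc \<kappa> (mkp u m) = u"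
    and mkp_measurable: "(\<lambda>(u, m). mkp u m) \<in> restrict_space borel (net L) \<Otimes>\<^sub>M \<nu> \<rightarrow>\<^sub>M points_on L \<kappa> (net L)"
    and loc_measurable: "loc \<kappa> \<in> points_on L \<kappa> (net L) \<rightarrow>\<^sub>M restrict_space borel (net L)"
    and sets_points_on: "\<And>A. A \<in> sets borel \<Longrightarrow> A \<subseteq> net L \<Longrightarrow>
      sets (points_on L \<kappa> A) = sets (restrict_space (points_on L \<kappa> (net L)) (loc \<kappa> -` A))"
    and sigma_finite_points_on: "\<And>A. A \<in> sets borel \<Longrightarrow> A \<subseteq> net L \<Longrightarrow> sigma_finite_measure (points_on L \<kappa> A)"
    and integral_points_on: "\<And>i h. i \<in> {1..nseg L} \<Longrightarrow> h \<in> borel_measurable (points_on L \<kappa> (seg L i)) \<Longrightarrow>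
      integral\<^sup>N (points_on L \<kappa> (seg L i)) h =
        (\<integral>\<^sup>+t. (if 0 < t \<and> t < seg_len L i then \<integral>\<^sup>+m. h (mkp (seg_pt L i t) m) \<partial>\<nu> else 0) \<partial>lborel)"
begin

definition borel_part :: "'a set \<Rightarrow> bool" where
  "borel_part A \<longleftrightarrow> A \<in> sets borel \<and> A \<subseteq> net L"

lemma space_points_on: "borel_part A \<Longrightarrow> space (points_on L \<kappa> A) = {p \<in> space (points_on L \<kappa> (net L)). loc \<kappa> p \<in> A}"
  using sets_eq_imp_space_eq[OF sets_points_on, of A] by (auto simp: space_restrict_space borel_part_def)

lemma space_patterns_on:
  "borel_part A \<Longrightarrow> space (patterns_on L \<kappa> A) =
    {X. finite X \<and> X \<subseteq> space (points_on L \<kappa> (net L)) \<and> loc \<kappa> ` X \<subseteq> A \<and> inj_on (loc \<kappa>) X}"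
  unfolding patterns_on_def space_pattern_space by (auto simp: space_points_on)

lemma borel_part_seg: "i \<in> {1..nseg L} \<Longrightarrow> borel_part (seg L i)"
  by (simp add: borel_part_def seg_subset_net)

lemma borel_part_net: "borel_part (net L)"
  by (simp add: borel_part_def)

lemma borel_part_up_seg: "borel_part (up_seg L i)"
  by (simp add: borel_part_def up_seg_subset_net)

lemma borel_part_Un: "borel_part A \<Longrightarrow> borel_part C \<Longrightarrow> borel_part (A \<union> C)"
  by (auto simp: borel_part_def)

lemma loc_vimage_sets:
  assumes "borel_part A"
  shows "loc \<kappa> -` A \<inter> space (points_on L \<kappa> (net L)) \<in> sets (points_on L \<kappa> (net L))"
  using assms by (intro measurable_sets[OF loc_measurable]) (auto simp: borel_part_def sets_restrict_space_iff)

lemma sets_points_on_subset: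
  assumes A: "borel_part A" "borel_part C" "A \<subseteq> C"
  shows "sets (points_on L \<kappa> A) = sets (restrict_space (points_on L \<kappa> C) (loc \<kappa> -` A))"
proof -
  have "sets (restrict_space (points_on L \<kappa> C) (loc \<kappa> -` A)) =
    sets (restrict_space (restrict_space (points_on L \<kappa> (net L)) (loc \<kappa> -` C)) (loc \<kappa> -` A))"
    using A by (intro sets_restrict_space_cong sets_points_on) (auto simp: borel_part_def)
  also have "\<dots> = sets (restrict_space (points_on L \<kappa> (net L)) (loc \<kappa> -` C \<inter> loc \<kappa> -` A))"
    by (rule sets_restrict_restrict_space)
  also have "loc \<kappa> -` C \<inter> loc \<kappa> -` A = loc \<kappa> -` A" using A by auto
  finally show ?thesis using A by (simp add: sets_points_on borel_part_def)
qed

lemma points_on_sets_mono: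
  assumes A: "borel_part A" "borel_part C" "A \<subseteq> C" and D: "D \<in> sets (points_on L \<kappa> A)"
  shows "D \<in> sets (points_on L \<kappa> C)"
proof -
  have "loc \<kappa> -` A \<inter> space (points_on L \<kappa> C) \<in> sets (points_on L \<kappa> C)"
  proof -
    have "loc \<kappa> -` A \<inter> space (points_on L \<kappa> C) =
       loc \<kappa> -` C \<inter> (loc \<kappa> -` A \<inter> space (points_on L \<kappa> (net L)))"
      using A by (auto simp: space_points_on)
    also have "\<dots> \<in> sets (restrict_space (points_on L \<kappa> (net L)) (loc \<kappa> -` C))"
      using loc_vimage_sets[OF A(1)] by (auto simp: sets_restrict_space)
    finally show ?thesis using A(2) by (simp add: sets_points_on borel_part_def)
  qed
  with D show ?thesis
    unfolding sets_points_on_subset[OF A] by (auto simp: sets_restrict_space_iff)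
qed

lemma points_on_sets_Int:
  assumes A: "borel_part A" "borel_part C" "A \<subseteq> C" and D: "D \<in> sets (points_on L \<kappa> C)"
  shows "{p \<in> D. loc \<kappa> p \<in> A} \<in> sets (points_on L \<kappa> A)"
  using D unfolding sets_points_on_subset[OF A] sets_restrict_space by (auto intro!: image_eqI[of _ _ D])

lemma measurable_loc:
  assumes A: "borel_part A"
  shows "loc \<kappa> \<in> points_on L \<kappa> A \<rightarrow>\<^sub>M borel"
proof -
  have "(\<lambda>x. x) \<in> restrict_space borel (net L) \<rightarrow>\<^sub>M borel" by (rule measurable_restrict_space1) simp
  from measurable_restrict_space1[OF measurable_compose[OF loc_measurable this]]
  show ?thesis
    using A by (simp add: sets_points_on borel_part_def cong: measurable_cong_sets)
qed

lemma measurable_mkp: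
  assumes A: "borel_part A"
  shows "(\<lambda>(u, m). mkp u m) \<in> restrict_space borel A \<Otimes>\<^sub>M \<nu> \<rightarrow>\<^sub>M points_on L \<kappa> A"
proof -
  have "(\<lambda>(u, m). mkp u m) \<in> restrict_space borel A \<Otimes>\<^sub>M \<nu> \<rightarrow>\<^sub>M restrict_space (points_on L \<kappa> (net L)) (loc \<kappa> -` A)"
  proof (rule measurable_restrict_space2)
    have "(\<lambda>(u, m). mkp u m) \<in> restrict_space (restrict_space borel (net L) \<Otimes>\<^sub>M \<nu>) (fst -` A) \<rightarrow>\<^sub>M points_on L \<kappa> (net L)"
      by (rule measurable_restrict_space1) (rule mkp_measurable)
    then show "(\<lambda>(u, m). mkp u m) \<in> restrict_space borel A \<Otimes>\<^sub>M \<nu> \<rightarrow>\<^sub>M points_on L \<kappa> (net L)"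
      using A by (simp add: sets_pair_restrict_space1[of A "net L"] borel_part_def cong: measurable_cong_sets)
  qed (auto simp: space_pair_measure space_restrict_space loc_mkp)
  then show ?thesis
    using A by (simp add: sets_points_on borel_part_def cong: measurable_cong_sets)
qed

text \<open>The two patterns live on disjoint parts of the network, so their counts add and places
  stay distinct.\<close>

lemma measurable_pattern_Un:
  assumes A: "borel_part A" "borel_part C" "borel_part E" "A \<inter> C = {}" "A \<subseteq> E" "C \<subseteq> E"
    and X: "X \<in> M \<rightarrow>\<^sub>M patterns_on L \<kappa> A" and Y: "Y \<in> M \<rightarrow>\<^sub>M patterns_on L \<kappa> C"
  shows "(\<lambda>y. X y \<union> Y y) \<in> M \<rightarrow>\<^sub>M patterns_on L \<kappa> E"
  unfolding patterns_on_def
proof (rule measurable_pattern_spaceI)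
  have XY: "X y \<in> space (patterns_on L \<kappa> A)" "Y y \<in> space (patterns_on L \<kappa> C)" if "y \<in> space M" for y
    using measurable_space[OF X that] measurable_space[OF Y that] by auto
  show "X y \<union> Y y \<in> space (pattern_space (loc \<kappa>) (points_on L \<kappa> E))" if "y \<in> space M" for y
    using XY[OF that] A unfolding patterns_on_def[symmetric]
    by (auto simp: space_patterns_on inj_on_Un) blast+
  fix D assume D: "D \<in> sets (points_on L \<kappa> E)"
  let ?DA = "{p \<in> D. loc \<kappa> p \<in> A}" and ?DC = "{p \<in> D. loc \<kappa> p \<in> C}"
  have [measurable]: "(\<lambda>y. card (X y \<inter> ?DA)) \<in> M \<rightarrow>\<^sub>M count_space UNIV"
    by (rule measurable_compose[OF X[unfolded patterns_on_def] measurable_card_Int[OF points_on_sets_Int[OF _ _ _ D]]])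
       (use A in auto)
  have [measurable]: "(\<lambda>y. card (Y y \<inter> ?DC)) \<in> M \<rightarrow>\<^sub>M count_space UNIV"
    by (rule measurable_compose[OF Y[unfolded patterns_on_def] measurable_card_Int[OF points_on_sets_Int[OF _ _ _ D]]])
       (use A in auto)
  have "(\<lambda>y. card (X y \<inter> ?DA) + card (Y y \<inter> ?DC)) \<in> M \<rightarrow>\<^sub>M count_space UNIV" by measurable
  moreover have "card ((X y \<union> Y y) \<inter> D) = card (X y \<inter> ?DA) + card (Y y \<inter> ?DC)" if "y \<in> space M" for y
  proof -
    have XA: "\<And>p. p \<in> X y \<Longrightarrow> loc \<kappa> p \<in> A" "finite (X y)" and YC: "\<And>p. p \<in> Y y \<Longrightarrow> loc \<kappa> p \<in> C" "finite (Y y)"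
      using XY[OF that] A by (auto simp: space_patterns_on)
    then have "(X y \<union> Y y) \<inter> D = (X y \<inter> ?DA) \<union> (Y y \<inter> ?DC)" by auto
    moreover have "(X y \<inter> ?DA) \<inter> (Y y \<inter> ?DC) = {}" using A(4) by auto
    ultimately show ?thesis using XA YC by (simp add: card_Un_disjoint)
  qed
  ultimately show "(\<lambda>y. card ((X y \<union> Y y) \<inter> D)) \<in> M \<rightarrow>\<^sub>M count_space UNIV"
    by (simp cong: measurable_cong)
qed

lemma measurable_pattern_restrict:
  assumes A: "borel_part A" "borel_part C" "A \<subseteq> C" and X: "X \<in> M \<rightarrow>\<^sub>M patterns_on L \<kappa> C"
  shows "(\<lambda>y. {q \<in> X y. loc \<kappa> q \<in> A}) \<in> M \<rightarrow>\<^sub>M patterns_on L \<kappa> A"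
  unfolding patterns_on_def
proof (rule measurable_pattern_spaceI)
  show "{q \<in> X y. loc \<kappa> q \<in> A} \<in> space (pattern_space (loc \<kappa>) (points_on L \<kappa> A))" if "y \<in> space M" for y
    using measurable_space[OF X that] A unfolding patterns_on_def[symmetric]
    by (auto simp: space_patterns_on intro: inj_on_subset)
  fix D assume D: "D \<in> sets (points_on L \<kappa> A)"
  have "{q \<in> X y. loc \<kappa> q \<in> A} \<inter> D = X y \<inter> D" for y
    using sets.sets_into_space[OF D] A by (auto simp: space_points_on)
  then show "(\<lambda>y. card ({q \<in> X y. loc \<kappa> q \<in> A} \<inter> D)) \<in> M \<rightarrow>\<^sub>M count_space UNIV"
    using measurable_compose[OF X[unfolded patterns_on_def] measurable_card_Int[OF points_on_sets_mono[OF A D]]] by simp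
qed

end

text \<open>Given the past, the place \<open>u\<close> of a point has intensity \<open>lam u\<close> and its mark has density
  \<open>fm u\<close> with respect to \<open>\<nu>\<close>.\<close>

locale marking_model = point_model L \<nu> \<kappa> mkp
  for L :: "'a::euclidean_space network" and \<nu> :: "'m measure" and \<kappa> :: "('a, 'p) point_kind"
    and mkp :: "'a \<Rightarrow> 'm \<Rightarrow> 'p" +
  fixes mk :: "('a, 'p) marking" and lam :: "'a \<Rightarrow> 'p set \<Rightarrow> real"
    and fm :: "'a \<Rightarrow> 'p set \<Rightarrow> 'm \<Rightarrow> real"
  assumes lam_measurable: "(\<lambda>(u, X). lam u (past L \<kappa> u X)) \<in>
      borel_measurable (restrict_space borel (net L) \<Otimes>\<^sub>M patterns_on L \<kappa> (net L))"
    and fm_measurable: "(\<lambda>((u, X), m). fm u (past L \<kappa> u X) m) \<in>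
      borel_measurable ((restrict_space borel (net L) \<Otimes>\<^sub>M patterns_on L \<kappa> (net L)) \<Otimes>\<^sub>M \<nu>)"
    and fm_prob: "\<And>u X. u \<in> net L \<Longrightarrow> X \<in> space (patterns_on L \<kappa> (net L)) \<Longrightarrow>
      (\<integral>\<^sup>+m. ennreal (fm u (past L \<kappa> u X) m) \<partial>\<nu>) = 1"
    and mk_eq: "\<And>u X rest. (\<And>p. subprob_space (rest p)) \<Longrightarrow>
      mk u X rest = density \<nu> (\<lambda>m. ennreal (fm u X m)) \<bind> (\<lambda>m. rest (mkp u m))"

lemma (in network_geometry) points_on_unmarked: "points_on L unmarked A = restrict_space (length_measure L) A"
  by (simp add: points_on_def unmarked_def)

lemma (in network_geometry) points_on_marked:
  "points_on L (marked \<nu>) A = restrict_space (length_measure L) A \<Otimes>\<^sub>M \<nu>"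
  by (simp add: points_on_def marked_def)

lemma (in network_geometry) sigma_finite_restrict_length:
  assumes "A \<in> sets borel" "A \<subseteq> net L"
  shows "sigma_finite_measure (restrict_space (length_measure L) A)"
proof -
  have "finite_measure (restrict_space (length_measure L) A)"
    using assms by (intro finite_measure_restrict_space finite_length_measure)
      (auto simp: sets_length_measure space_length_measure sets_restrict_space_iff)
  then show ?thesis by (rule finite_measure.axioms)
qed

lemma (in network_geometry) point_model_unmarked:
  "point_model L (count_space (UNIV :: unit set)) unmarked (\<lambda>u m. u)"
proof (intro point_model.intro point_model_axioms.intro)
  show "network_geometry L" ..
  show "sigma_finite_measure (count_space (UNIV :: unit set))"
    by (rule sigma_finite_measure_count_space_finite) simp
  have loc: "loc unmarked = (\<lambda>u :: 'a. u)" by (simp add: unmarked_def)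
  show "loc unmarked u = u" for u :: 'a by (simp add: loc)
  have s: "sets (points_on L unmarked A) = sets (restrict_space borel A)" if "A \<subseteq> net L" for A
    using that by (simp add: points_on_unmarked sets_restrict_length)
  show "(\<lambda>(u, m). u) \<in> restrict_space borel (net L) \<Otimes>\<^sub>M count_space (UNIV :: unit set) \<rightarrow>\<^sub>M points_on L unmarked (net L)"
    by (simp add: s split_beta' cong: measurable_cong_sets)
  show "loc unmarked \<in> points_on L unmarked (net L) \<rightarrow>\<^sub>M restrict_space borel (net L)"
    unfolding loc by (simp add: s cong: measurable_cong_sets)
  show "sets (points_on L unmarked A) = sets (restrict_space (points_on L unmarked (net L)) (loc unmarked -` A))"
    if "A \<subseteq> net L" for A
  proof -
    have "sets (restrict_space (points_on L unmarked (net L)) (loc unmarked -` A)) =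
        sets (restrict_space (restrict_space borel (net L)) A)"
      unfolding loc vimage_ident by (rule sets_restrict_space_cong) (simp add: s)
    then show ?thesis using that by (simp add: s sets_restrict_restrict_space Int_absorb1)
  qed
  show "sigma_finite_measure (points_on L unmarked A)" if "A \<in> sets borel" "A \<subseteq> net L" for A
    using that by (simp add: points_on_unmarked sigma_finite_restrict_length)
  show "integral\<^sup>N (points_on L unmarked (seg L i)) h =
      (\<integral>\<^sup>+t. (if 0 < t \<and> t < seg_len L i then \<integral>\<^sup>+m. h (seg_pt L i t) \<partial>count_space (UNIV :: unit set) else 0) \<partial>lborel)"
    if "i \<in> {1..nseg L}" "h \<in> borel_measurable (points_on L unmarked (seg L i))" for i and h :: "'a \<Rightarrow> ennreal"
  proof -
    have c: "(\<integral>\<^sup>+m. x \<partial>count_space (UNIV :: unit set)) = x" for x :: ennreal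
      by (simp add: nn_integral_count_space_finite)
    show ?thesis
      unfolding c using that integral_restrict_length[of i h]
      by (simp add: points_on_unmarked sets_restrict_length seg_subset_net cong: measurable_cong_sets)
  qed
qed

lemma (in network_geometry) point_model_marked:
  assumes "sigma_finite_measure \<nu>"
  shows "point_model L \<nu> (marked \<nu>) Pair"
proof (intro point_model.intro point_model_axioms.intro)
  interpret \<nu>: sigma_finite_measure \<nu> by fact
  show "network_geometry L" ..
  show "sigma_finite_measure \<nu>" by fact
  show "loc (marked \<nu>) (u, m) = u" for u :: 'a and m by (simp add: marked_def)
  have s: "sets (points_on L (marked \<nu>) A) = sets (restrict_space borel A \<Otimes>\<^sub>M \<nu>)" if "A \<subseteq> net L" for A
    unfolding points_on_marked by (rule sets_pair_measure_cong) (use that in \<open>simp_all add: sets_restrict_length\<close>)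
  show "(\<lambda>(u, m). (u, m)) \<in> restrict_space borel (net L) \<Otimes>\<^sub>M \<nu> \<rightarrow>\<^sub>M points_on L (marked \<nu>) (net L)"
    by (simp add: s cong: measurable_cong_sets)
  show "loc (marked \<nu>) \<in> points_on L (marked \<nu>) (net L) \<rightarrow>\<^sub>M restrict_space borel (net L)"
    by (simp add: s cong: measurable_cong_sets) (simp add: marked_def)
  show "sets (points_on L (marked \<nu>) A) = sets (restrict_space (points_on L (marked \<nu>) (net L)) (loc (marked \<nu>) -` A))"
    if A: "A \<in> sets borel" "A \<subseteq> net L" for A
  proof -
    have "sets (restrict_space (points_on L (marked \<nu>) (net L)) (fst -` A)) =
        sets (restrict_space (restrict_space borel (net L) \<Otimes>\<^sub>M \<nu>) (fst -` A))"
      by (rule sets_restrict_space_cong) (simp add: s)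
    then show ?thesis
      using A by (simp add: s sets_pair_restrict_space1[OF A, symmetric] marked_def[THEN arg_cong[of _ _ loc], simplified])
  qed
  show sf: "sigma_finite_measure (points_on L (marked \<nu>) A)" if "A \<in> sets borel" "A \<subseteq> net L" for A
  proof -
    interpret A: sigma_finite_measure "restrict_space (length_measure L) A"
      using that by (rule sigma_finite_restrict_length)
    interpret pair_sigma_finite "restrict_space (length_measure L) A" \<nu> ..
    show ?thesis unfolding points_on_marked ..
  qed
  show "integral\<^sup>N (points_on L (marked \<nu>) (seg L i)) h =
      (\<integral>\<^sup>+t. (if 0 < t \<and> t < seg_len L i then \<integral>\<^sup>+m. h (seg_pt L i t, m) \<partial>\<nu> else 0) \<partial>lborel)"
    if i: "i \<in> {1..nseg L}" and h: "h \<in> borel_measurable (points_on L (marked \<nu>) (seg L i))" for i and h :: "'a \<times> 'b \<Rightarrow> ennreal"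
  proof -
    interpret A: sigma_finite_measure "restrict_space (length_measure L) (seg L i)"
      using i by (intro sigma_finite_restrict_length) (auto simp: seg_subset_net)
    have h': "h \<in> borel_measurable (restrict_space (length_measure L) (seg L i) \<Otimes>\<^sub>M \<nu>)"
      using h by (simp add: points_on_marked)
    have m: "(\<lambda>u. \<integral>\<^sup>+m. h (u, m) \<partial>\<nu>) \<in> borel_measurable (restrict_space borel (seg L i))"
      using \<nu>.borel_measurable_nn_integral_fst[OF h'] i
      by (simp add: sets_restrict_length seg_subset_net cong: measurable_cong_sets)
    show ?thesis
      unfolding points_on_marked \<nu>.nn_integral_fst[OF h', symmetric]
      by (rule integral_restrict_length[OF i m])
  qed
qed

section \<open>Simulation on one segment\<close>

lemma sets_exp_law[simp, measurable_cong]: "sets (exp_law r) = sets borel"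
  by (simp add: exp_law_def)

lemma space_exp_law[simp]: "space (exp_law r) = UNIV"
  by (simp add: exp_law_def)

lemma nn_integral_exp_law:
  "f \<in> borel_measurable borel \<Longrightarrow>
   (\<integral>\<^sup>+x. f x \<partial>exp_law r) = (\<integral>\<^sup>+x. ennreal (exponential_density r x) * f x \<partial>lborel)"
  unfolding exp_law_def by (subst nn_integral_density) auto

text \<open>Includes r \<le> 0, where the density is never positive and the measure is null: a step
  has to be a kernel on all states, also on those where the bounds of the thinning are not
  assumed.\<close>

lemma subprob_space_exp_law: "subprob_space (exp_law r)"
proof (rule subprob_spaceI)
  show "emeasure (exp_law r) (space (exp_law r)) \<le> 1"
  proof (cases "0 < r")
    case True
    then interpret prob_space "exp_law r" unfolding exp_law_def by (rule prob_space_exponential_density)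
    show ?thesis by (subst emeasure_space_1) simp
  next
    case False
    then have "ennreal (exponential_density r x) = 0" for x
      by (simp add: exponential_density_def ennreal_neg mult_nonpos_nonneg)
    then show ?thesis by (simp add: exp_law_def emeasure_density)
  qed
qed simp

lemma measurable_exp_law[measurable]: "exp_law \<in> borel \<rightarrow>\<^sub>M subprob_algebra borel"
proof (rule measurable_subprob_algebra)
  fix A :: "real set" assume [measurable]: "A \<in> sets borel"
  have "(\<lambda>r. \<integral>\<^sup>+x. ennreal (if x < 0 then 0 else r * exp (- x * r)) * indicator A x \<partial>lborel) \<in> borel_measurable borel"
    by measurable
  then show "(\<lambda>r. emeasure (exp_law r) A) \<in> borel_measurable borel"
    by (simp add: exp_law_def emeasure_density exponential_density_def)
qed (auto intro: subprob_space_exp_law)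

abbreviation uniform01 :: "real measure" where
  "uniform01 \<equiv> uniform_measure lborel {0..1}"

lemma prob_space_uniform01: "prob_space uniform01"
  by (rule prob_space_uniform_measure) simp_all

lemma uniform01_in: "uniform01 \<in> space (subprob_algebra borel)"
  using prob_space_uniform01 by (simp add: space_subprob_algebra prob_space_imp_subprob_space)

text \<open>A negative \<open>q\<close> yields \<open>a\<close> almost surely, in agreement with
  \<open>ennreal q = 0\<close>.\<close>

lemma nn_integral_uniform01_test:
  assumes q: "q \<le> 1"
  shows "(\<integral>\<^sup>+u. (if q < u then a else b) \<partial>uniform01) = (1 - ennreal q) * a + ennreal q * b"
proof -
  let ?q = "max 0 q"
  have "(\<integral>\<^sup>+u. (if q < u then a else b) \<partial>uniform01) =
      (\<integral>\<^sup>+u. (if q < u then a else b) * indicator {0..1} u \<partial>lborel)"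
    by (subst nn_integral_uniform_measure) (auto simp: divide_ennreal_def)
  also have "\<dots> = (\<integral>\<^sup>+u. a * indicator {?q<..1} u + b * indicator {0..<?q} u \<partial>lborel)"
    using AE_lborel_singleton[of ?q] q
    by (intro nn_integral_cong_AE) (auto simp: indicator_def max_def elim!: eventually_mono)
  also have "\<dots> = a * ennreal (1 - ?q) + b * ennreal ?q"
    using q by (subst nn_integral_add) (auto simp: nn_integral_cmult)
  also have "ennreal (1 - ?q) = 1 - ennreal q"
    by (cases "0 \<le> q") (auto simp: ennreal_minus ennreal_neg simp flip: ennreal_1)
  also have "ennreal ?q = ennreal q" by (simp add: max_def ennreal_neg)
  finally show ?thesis by (simp add: mult.commute)
qed

lemma ennreal_divide_pos: "0 < m \<Longrightarrow> ennreal (r / m) = ennreal r / ennreal m"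
  by (cases "0 \<le> r") (simp_all add: divide_ennreal ennreal_neg divide_nonpos_pos)

lemma subprob_space_return: "space M \<noteq> {} \<Longrightarrow> subprob_space (return M x)"
  by (intro subprob_spaceI) (simp_all add: indicator_def)

text \<open>\<open>C\<close> is the part of the network already simulated. It contains the upstream
  segments but possibly others too, whose points must be shown to have no influence.\<close>

locale segment_simulation = marking_model L \<nu> \<kappa> mkp mk lam fm
  for L :: "'a::euclidean_space network" and \<nu> :: "'m measure" and \<kappa> :: "('a, 'p) point_kind"
    and mkp :: "'a \<Rightarrow> 'm \<Rightarrow> 'p" and mk lam fm +
  fixes i :: nat and C :: "'a set"
  assumes i: "i \<in> {1..nseg L}"
    and C: "borel_part C" "C \<inter> seg L i = {}" "up_seg L i \<subseteq> C"
begin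

abbreviation "len \<equiv> seg_len L i"
abbreviation "B \<equiv> points_on L \<kappa> (seg L i)"
abbreviation "HH \<equiv> patterns_on L \<kappa> C"
abbreviation "tm \<equiv> (\<lambda>p. dist (lower L i) (loc \<kappa> p))"
abbreviation "pt \<equiv> (\<lambda>t. mkp (seg_pt L i t))"
abbreviation "SS \<equiv> state_space L \<kappa> i"

definition srate :: "'p set \<Rightarrow> 'p set \<Rightarrow> real \<Rightarrow> ennreal" where
  "srate H Y t = ennreal (seg_rate L \<kappa> lam i (H \<union> Y) t)"

text \<open>Set to 0 outside of \<open>(0, len)\<close>, where \<open>seg_pt\<close> leaves the open
  segment and nothing is known about \<open>fm\<close>.\<close>

definition smark :: "'p set \<Rightarrow> 'p set \<Rightarrow> real \<Rightarrow> 'm \<Rightarrow> ennreal" where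
  "smark H Y t m = (if 0 < t \<and> t < len
     then ennreal (fm (seg_pt L i t) (past L \<kappa> (seg_pt L i t) (H \<union> Y)) m) else 0)"

lemma BS: "borel_part (seg L i)"
  using i by (rule borel_part_seg)

lemma tm_eq:
  assumes "p \<in> space B"
  shows "0 < tm p" "tm p < len" "loc \<kappa> p = seg_pt L i (tm p)"
proof -
  have "loc \<kappa> p \<in> seg L i" using assms by (simp add: space_points_on[OF BS])
  then obtain t where "0 < t" "t < len" "loc \<kappa> p = seg_pt L i t" by (rule segE[OF i])
  then show "0 < tm p" "tm p < len" "loc \<kappa> p = seg_pt L i (tm p)"
    by (simp_all add: seg_pt_dist[OF ends_neq[OF i]])
qed

sublocale timed_points "loc \<kappa>" B tm
proof
  show "tm \<in> borel_measurable B"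
    using measurable_loc[OF BS] by measurable
  show "loc \<kappa> p = loc \<kappa> q \<longleftrightarrow> tm p = tm q" if "p \<in> space B" "q \<in> space B" for p q
    using tm_eq(3)[OF that(1)] tm_eq(3)[OF that(2)] by metis
qed

lemma patterns_seg: "patterns_on L \<kappa> (seg L i) = S"
  by (simp add: patterns_on_def)

lemma SS_eq: "SS = count_space UNIV \<Otimes>\<^sub>M (borel \<Otimes>\<^sub>M S)"
  by (simp add: state_space_def patterns_seg)

lemma space_SS: "space SS = UNIV \<times> UNIV \<times> space S"
  by (simp add: SS_eq space_pair_measure)

lemma SS_nonempty: "space SS \<noteq> {}"
  using empty_in_S unfolding space_SS by blast

lemma HH_D:
  assumes "H \<in> space HH"
  shows "H \<subseteq> space (points_on L \<kappa> (net L))" "q \<in> H \<Longrightarrow> loc \<kappa> q \<in> C" "finite H" "inj_on (loc \<kappa>) H"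
  using assms by (auto simp: space_patterns_on[OF C(1)])

lemma S_loc: "Y \<in> space S \<Longrightarrow> q \<in> Y \<Longrightarrow> loc \<kappa> q \<in> seg L i"
  using space_S_D(2)[of Y] space_points_on[OF BS] by auto

text \<open>The segment is disjoint from \<open>C\<close> and from its own upstream part, so the
  upstream half of \<open>up_pt\<close> meets \<open>H\<close> only and the half on the segment
  meets the new points only.\<close>

lemma past_eq:
  assumes H: "H \<in> space HH" and Y: "Y \<in> space S" and t: "0 < t" "t < len"
  shows "past L \<kappa> (seg_pt L i t) (H \<union> Y) = {q \<in> H. loc \<kappa> q \<in> up_seg L i} \<union> before tm t Y"
proof -
  have "seg_part L i 0 t \<subseteq> seg L i"
    using t seg_eq_image[OF ends_neq[OF i]] by (auto simp: seg_part_def)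
  then have "q \<in> H \<Longrightarrow> loc \<kappa> q \<notin> seg_part L i 0 t" for q
    using HH_D(2)[OF H] C(2) by blast
  moreover have "q \<in> Y \<Longrightarrow> loc \<kappa> q \<notin> up_seg L i" for q
    using S_loc[OF Y] up_seg_disjoint[OF i] by blast
  moreover have "q \<in> Y \<Longrightarrow> loc \<kappa> q \<in> seg_part L i 0 t \<longleftrightarrow> tm q < t" for q
    using seg_part_iff[OF i S_loc[OF Y]] t by simp
  ultimately show ?thesis
    unfolding past_def up_pt_eq[OF i t] before_def by blast
qed

lemma measurable_Un_net:
  "H \<in> M \<rightarrow>\<^sub>M HH \<Longrightarrow> Y \<in> M \<rightarrow>\<^sub>M S \<Longrightarrow> (\<lambda>y. H y \<union> Y y) \<in> M \<rightarrow>\<^sub>M patterns_on L \<kappa> (net L)"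
  by (rule measurable_pattern_Un[OF C(1) BS borel_part_net C(2)])
     (use C(1) BS in \<open>auto simp: borel_part_def patterns_seg\<close>)

lemma measurable_up_part_Un:
  assumes "H \<in> M \<rightarrow>\<^sub>M HH" "Y \<in> M \<rightarrow>\<^sub>M S"
  shows "(\<lambda>y. up_part L \<kappa> i (H y) \<union> Y y) \<in> M \<rightarrow>\<^sub>M patterns_on L \<kappa> (up_seg L i \<union> seg L i)"
  unfolding up_part_def
  by (rule measurable_pattern_Un[OF borel_part_up_seg BS borel_part_Un[OF borel_part_up_seg BS]])
     (use up_seg_disjoint[OF i] measurable_pattern_restrict[OF borel_part_up_seg C(1,3) assms(1)] assms(2)
      in \<open>auto simp: patterns_seg\<close>)

lemma Un_in_net: "H \<in> space HH \<Longrightarrow> Y \<in> space S \<Longrightarrow> H \<union> Y \<in> space (patterns_on L \<kappa> (net L))"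
  using measurable_space[OF measurable_Un_net[of fst "HH \<Otimes>\<^sub>M S" snd], of "(H, Y)"]
  by (simp add: space_pair_measure)

lemma measurable_seg_pt_restrict:
  assumes [measurable]: "t \<in> borel_measurable M"
  shows "(\<lambda>y. seg_pt L i (t y)) \<in> restrict_space M {y. 0 < t y \<and> t y < len} \<rightarrow>\<^sub>M restrict_space borel (seg L i)"
  by (intro measurable_restrict_space2 measurable_restrict_space1)
     (auto simp: space_restrict_space intro!: seg_pt_in_seg[OF i])

lemma restrict_seg_net: "f \<in> M \<rightarrow>\<^sub>M restrict_space borel (seg L i) \<Longrightarrow> f \<in> M \<rightarrow>\<^sub>M restrict_space borel (net L)"
  using seg_subset_net[OF i] by (auto simp: measurable_restrict_space2_iff)

lemma measurable_seg_rate[measurable (raw)]: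
  assumes H: "H \<in> M \<rightarrow>\<^sub>M HH" and Y: "Y \<in> M \<rightarrow>\<^sub>M S" and t[measurable]: "t \<in> borel_measurable M"
  shows "(\<lambda>y. seg_rate L \<kappa> lam i (H y \<union> Y y) (t y)) \<in> borel_measurable M"
  unfolding seg_rate_def
proof (subst measurable_If_restrict_space_iff, measurable, safe)
  let ?R = "restrict_space M {y. 0 < t y \<and> t y < len}"
  have "(\<lambda>y. (seg_pt L i (t y), H y \<union> Y y)) \<in> ?R \<rightarrow>\<^sub>M restrict_space borel (net L) \<Otimes>\<^sub>M patterns_on L \<kappa> (net L)"
    by (intro measurable_Pair restrict_seg_net measurable_seg_pt_restrict t measurable_restrict_space1 measurable_Un_net H Y)
  from measurable_compose[OF this lam_measurable]
  show "(\<lambda>y. lam (seg_pt L i (t y)) (past L \<kappa> (seg_pt L i (t y)) (H y \<union> Y y))) \<in> borel_measurable ?R"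
    by simp
qed simp

lemma measurable_srate[measurable (raw)]:
  assumes [measurable]: "H \<in> M \<rightarrow>\<^sub>M HH" "Y \<in> M \<rightarrow>\<^sub>M S" "t \<in> borel_measurable M"
  shows "(\<lambda>y. srate (H y) (Y y) (t y)) \<in> borel_measurable M"
  unfolding srate_def by measurable

lemma measurable_smark[measurable (raw)]:
  assumes H: "H \<in> M \<rightarrow>\<^sub>M HH" and Y: "Y \<in> M \<rightarrow>\<^sub>M S" and t[measurable]: "t \<in> borel_measurable M"
    and m: "m \<in> M \<rightarrow>\<^sub>M \<nu>"
  shows "(\<lambda>y. smark (H y) (Y y) (t y) (m y)) \<in> borel_measurable M"
  unfolding smark_def
proof (subst measurable_If_restrict_space_iff, measurable, safe)
  let ?R = "restrict_space M {y. 0 < t y \<and> t y < len}"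
  have "(\<lambda>y. ((seg_pt L i (t y), H y \<union> Y y), m y)) \<in> ?R \<rightarrow>\<^sub>M
      (restrict_space borel (net L) \<Otimes>\<^sub>M patterns_on L \<kappa> (net L)) \<Otimes>\<^sub>M \<nu>"
    by (intro measurable_Pair restrict_seg_net measurable_seg_pt_restrict t measurable_restrict_space1 measurable_Un_net H Y m)
  from measurable_compose[OF this fm_measurable]
  show "(\<lambda>y. ennreal (fm (seg_pt L i (t y)) (past L \<kappa> (seg_pt L i (t y)) (H y \<union> Y y)) (m y))) \<in> borel_measurable ?R"
    by simp
qed simp

lemma smark_prob:
  assumes "H \<in> space HH" "Y \<in> space S" "0 < t" "t < len"
  shows "(\<integral>\<^sup>+m. smark H Y t m \<partial>\<nu>) = 1"
  using assms fm_prob[OF _ Un_in_net[OF assms(1,2)]] seg_pt_in_seg[OF i] seg_subset_net[OF i]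
  by (auto simp: smark_def)

lemma empty_in_HH: "{} \<in> space HH"
  by (simp add: space_patterns_on[OF C(1)])

lemma marked_line:
  assumes H[measurable]: "H \<in> space HH"
  shows "marked_line (loc \<kappa>) B tm \<nu> len pt (srate H) (smark H)"
proof
  show "0 < len" using i by (rule seg_len_pos)
  show "0 < tm p \<and> tm p < len" if "p \<in> space B" for p using tm_eq[OF that] by simp
  show "tm (pt t m) = t" if "0 < t" for t m
    using that by (simp add: loc_mkp seg_pt_dist[OF ends_neq[OF i]])
  show "(\<lambda>(t, m). pt t m) \<in> restrict_space borel {0<..<len} \<Otimes>\<^sub>M \<nu> \<rightarrow>\<^sub>M B"
  proof -
    have "(\<lambda>t. seg_pt L i t) \<in> restrict_space borel {0<..<len} \<rightarrow>\<^sub>M restrict_space borel (seg L i)"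
      using measurable_seg_pt_restrict[of "\<lambda>t. t" borel]
      by (simp add: greaterThanLessThan_def greaterThan_def lessThan_def Collect_conj_eq)
    then have "(\<lambda>(t, m). (seg_pt L i t, m)) \<in> restrict_space borel {0<..<len} \<Otimes>\<^sub>M \<nu> \<rightarrow>\<^sub>M restrict_space borel (seg L i) \<Otimes>\<^sub>M \<nu>"
      by measurable
    from measurable_compose[OF this measurable_mkp[OF BS]] show ?thesis by (simp add: split_beta')
  qed
  show "(\<lambda>(Y, t). srate H Y t) \<in> borel_measurable (S \<Otimes>\<^sub>M borel)" by measurable
  show "(\<lambda>((Y, t), m). smark H Y t m) \<in> borel_measurable ((S \<Otimes>\<^sub>M borel) \<Otimes>\<^sub>M \<nu>)"
    unfolding split_beta' by measurable
  show "(\<integral>\<^sup>+m. smark H Y t m \<partial>\<nu>) = 1" if "Y \<in> space S" "0 < t" "t < len" for Y t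
    using smark_prob[OF H that] .
  show "integral\<^sup>N B h = (\<integral>\<^sup>+t. (if 0 < t \<and> t < len then \<integral>\<^sup>+m. h (pt t m) \<partial>\<nu> else 0) \<partial>lborel)"
    if "h \<in> borel_measurable B" for h
    using integral_points_on[OF i that] .
qed

lemma cum_intensity_eq:
  assumes H: "H \<in> space HH" and Y: "Y \<in> space S" and t: "0 < t" "t < len"
  shows "cum_intensity L \<kappa> lam i (H \<union> Y) t = ivl 0 t (srate H Y)"
proof -
  let ?X = "H \<union> Y"
  let ?g = "\<lambda>v. ennreal (lam v (past L \<kappa> v ?X)) * indicator (seg_part L i 0 t) v"
  have part: "seg_part L i 0 t \<subseteq> seg L i"
    using t seg_eq_image[OF ends_neq[OF i]] by (auto simp: seg_part_def)
  have "(\<lambda>v. (v, ?X)) \<in> restrict_space borel (seg L i) \<rightarrow>\<^sub>M restrict_space borel (net L) \<Otimes>\<^sub>M patterns_on L \<kappa> (net L)"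
    by (intro measurable_Pair restrict_seg_net measurable_ident_sets refl measurable_const Un_in_net H Y)
  from measurable_compose[OF this lam_measurable]
  have l[measurable]: "(\<lambda>v. lam v (past L \<kappa> v ?X)) \<in> borel_measurable (restrict_space borel (seg L i))" by simp
  have [measurable]: "(\<lambda>v. v) \<in> borel_measurable (restrict_space borel (seg L i))"
    by (rule measurable_restrict_space1) simp
  have m: "(\<lambda>v. ennreal (lam v (past L \<kappa> v ?X)) * (if dist (lower L i) v < t then 1 else 0))
      \<in> borel_measurable (restrict_space borel (seg L i))" by measurable
  have eq: "?g v = ennreal (lam v (past L \<kappa> v ?X)) * (if dist (lower L i) v < t then 1 else 0)"
    if "v \<in> space (restrict_space borel (seg L i))" for v
    using that seg_part_iff[OF i, of v t] t by (simp add: space_restrict_space indicator_def)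
  have g: "?g \<in> borel_measurable (restrict_space borel (seg L i))"
    using m by (subst measurable_cong[OF eq])
  have "cum_intensity L \<kappa> lam i ?X t = (\<integral>\<^sup>+v. ?g v * indicator (seg L i) v \<partial>length_measure L)"
    unfolding cum_intensity_def using part by (intro nn_integral_cong) (auto simp: indicator_def)
  also have "\<dots> = integral\<^sup>N (restrict_space (length_measure L) (seg L i)) ?g"
    using seg_subset_net[OF i]
    by (subst nn_integral_restrict_space)
       (auto simp: sets_length_measure space_length_measure sets_restrict_space_iff)
  also have "\<dots> = (\<integral>\<^sup>+s. (if 0 < s \<and> s < len then ?g (seg_pt L i s) else 0) \<partial>lborel)"
    by (rule integral_restrict_length[OF i g])
  also have "\<dots> = ivl 0 t (srate H Y)"
    unfolding ivl_def using AE_lborel_singleton[of 0] AE_lborel_singleton[of t]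
  proof (intro nn_integral_cong_AE, eventually_elim)
    fix s :: real assume "s \<noteq> 0" "s \<noteq> t"
    moreover have "seg_pt L i s \<in> seg_part L i 0 t \<longleftrightarrow> 0 < s \<and> s < t"
      by (auto simp: seg_part_def seg_pt_inj[OF ends_neq[OF i]])
    ultimately show "(if 0 < s \<and> s < len then ?g (seg_pt L i s) else 0) = (if 0 \<le> s \<and> s \<le> t then srate H Y s else 0)"
      using t by (auto simp: srate_def seg_rate_def indicator_def)
  qed
  finally show ?thesis .
qed

end

context segment_simulation
begin

text \<open>Gives access to \<open>add_pt\<close>, which does not depend on the upstream pattern;
  the empty pattern stands for any other.\<close>

interpretation E: marked_line "loc \<kappa>" B tm \<nu> len pt "srate {}" "smark {}"
  by (rule marked_line[OF empty_in_HH])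

definition put :: "'p set \<Rightarrow> real \<Rightarrow> 'p set \<Rightarrow> real \<Rightarrow> 'p sim_state measure" where
  "put H t Y c = put_point L \<kappa> mk i H t Y (\<lambda>Y'. return SS (False, c, Y'))"

lemma measurable_state[measurable (raw)]:
  assumes "e \<in> M \<rightarrow>\<^sub>M count_space UNIV" "c \<in> borel_measurable M" "Y \<in> M \<rightarrow>\<^sub>M S"
  shows "(\<lambda>y. (e y, c y, Y y)) \<in> M \<rightarrow>\<^sub>M SS"
  unfolding SS_eq using assms by (intro measurable_Pair)

lemma measurable_state_D[measurable (raw)]:
  assumes "st \<in> M \<rightarrow>\<^sub>M SS"
  shows "(\<lambda>y. fst (st y)) \<in> M \<rightarrow>\<^sub>M count_space UNIV" "(\<lambda>y. fst (snd (st y))) \<in> borel_measurable M"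
    "(\<lambda>y. snd (snd (st y))) \<in> M \<rightarrow>\<^sub>M S"
  using assms unfolding SS_eq by (auto intro: measurable_compose measurable_fst'' measurable_snd'')

text \<open>The law of the next state is the image of the mark density, a form in which integrals
  and measurability in all arguments can be read off.\<close>

lemma put_eq:
  assumes H: "H \<in> space HH" and Y: "Y \<in> space S"
  shows "put H t Y c = (if 0 < t \<and> t < len \<and> (\<forall>q\<in>Y. tm q < t)
     then distr (density \<nu> (smark H Y t)) SS (\<lambda>m. (False, c, E.add_pt t m Y)) else return SS (False, c, Y))"
proof (cases "0 < t \<and> t < len \<and> (\<forall>q\<in>Y. tm q < t)")
  case False
  moreover have "(\<forall>q\<in>Y. loc \<kappa> q \<in> seg_part L i 0 t) \<longleftrightarrow> (\<forall>q\<in>Y. tm q < t)" if "t < len"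
    using seg_part_iff[OF i S_loc[OF Y]] that by auto
  ultimately show ?thesis by (auto simp: put_def put_point_def)
next
  case True
  note [measurable] = H Y
  have guard: "0 < t \<and> t < len \<and> (\<forall>q\<in>Y. loc \<kappa> q \<in> seg_part L i 0 t)"
    using True seg_part_iff[OF i S_loc[OF Y]] by auto
  have dens: "density \<nu> (\<lambda>m. ennreal (fm (seg_pt L i t) (past L \<kappa> (seg_pt L i t) (H \<union> Y)) m)) = density \<nu> (smark H Y t)"
    using True by (simp add: smark_def[abs_def])
  have ne: "space \<nu> \<noteq> {}"
    using smark_prob[OF H Y, of t] True by (auto simp: nn_integral_empty)
  have "put H t Y c = density \<nu> (smark H Y t) \<bind> (\<lambda>m. return SS (False, c, insert (pt t m) Y))"
    unfolding put_def put_point_def if_P[OF guard] by (subst mk_eq) (auto simp: dens subprob_space_return SS_nonempty)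
  also have "\<dots> = density \<nu> (smark H Y t) \<bind> (\<lambda>m. return SS (False, c, E.add_pt t m Y))"
    using True
    by (intro bind_cong) (auto simp: E.add_pt_def add_last_def loc_mkp seg_pt_dist[OF ends_neq[OF i]])
  also have "\<dots> = distr (density \<nu> (smark H Y t)) SS (\<lambda>m. (False, c, E.add_pt t m Y))"
    by (rule bind_return_distr') (simp_all add: ne)
  finally show ?thesis using True by simp
qed

lemma nn_integral_put:
  assumes H[measurable]: "H \<in> space HH" and Y[measurable]: "Y \<in> space S" and w[measurable]: "w \<in> borel_measurable SS"
  shows "(\<integral>\<^sup>+x. w x \<partial>put H t Y c) = (if 0 < t \<and> t < len \<and> (\<forall>q\<in>Y. tm q < t)
     then \<integral>\<^sup>+m. smark H Y t m * w (False, c, E.add_pt t m Y) \<partial>\<nu> else w (False, c, Y))"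
proof -
  have "(\<integral>\<^sup>+x. w x \<partial>distr (density \<nu> (smark H Y t)) SS (\<lambda>m. (False, c, E.add_pt t m Y))) =
     (\<integral>\<^sup>+m. w (False, c, E.add_pt t m Y) \<partial>density \<nu> (smark H Y t))"
    by (rule nn_integral_distr) measurable
  also have "\<dots> = (\<integral>\<^sup>+m. smark H Y t m * w (False, c, E.add_pt t m Y) \<partial>\<nu>)"
    by (rule nn_integral_density) measurable
  finally show ?thesis
    using Y by (simp add: put_eq[OF H Y] nn_integral_return space_SS)
qed

lemma measurable_put[measurable (raw)]:
  assumes [measurable]: "H \<in> M \<rightarrow>\<^sub>M HH" "t \<in> borel_measurable M" "Y \<in> M \<rightarrow>\<^sub>M S" "c \<in> borel_measurable M"
  shows "(\<lambda>y. put (H y) (t y) (Y y) (c y)) \<in> M \<rightarrow>\<^sub>M subprob_algebra SS"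
proof (rule measurable_subprob_algebra)
  fix y assume y: "y \<in> space M"
  then have HY: "H y \<in> space HH" "Y y \<in> space S"
    using measurable_space[OF assms(1)] measurable_space[OF assms(3)] by auto
  show s: "sets (put (H y) (t y) (Y y) (c y)) = sets SS"
    by (simp add: put_eq[OF HY])
  have "emeasure (put (H y) (t y) (Y y) (c y)) (space SS) = (\<integral>\<^sup>+x. 1 \<partial>put (H y) (t y) (Y y) (c y))"
    using sets_eq_imp_space_eq[OF s] by simp
  also have "\<dots> \<le> 1"
    by (subst nn_integral_put[OF HY]) (auto simp: smark_prob[OF HY])
  finally show "subprob_space (put (H y) (t y) (Y y) (c y))"
    using sets_eq_imp_space_eq[OF s] SS_nonempty by (intro subprob_spaceI) auto
next
  fix A assume A[measurable]: "A \<in> sets SS"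
  have "(\<lambda>y. if 0 < t y \<and> t y < len \<and> (\<forall>q\<in>Y y. tm q < t y)
     then \<integral>\<^sup>+m. smark (H y) (Y y) (t y) m * indicator A (False, c y, E.add_pt (t y) m (Y y)) \<partial>\<nu>
     else indicator A (False, c y, Y y)) \<in> borel_measurable M" by measurable
  moreover have "emeasure (put (H y) (t y) (Y y) (c y)) A = (if 0 < t y \<and> t y < len \<and> (\<forall>q\<in>Y y. tm q < t y)
     then \<integral>\<^sup>+m. smark (H y) (Y y) (t y) m * indicator A (False, c y, E.add_pt (t y) m (Y y)) \<partial>\<nu>
     else indicator A (False, c y, Y y))" if y: "y \<in> space M" for y
  proof -
    have HY: "H y \<in> space HH" "Y y \<in> space S"
      using measurable_space[OF assms(1) y] measurable_space[OF assms(3) y] by auto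
    have "emeasure (put (H y) (t y) (Y y) (c y)) A = (\<integral>\<^sup>+x. indicator A x \<partial>put (H y) (t y) (Y y) (c y))"
      using A by (simp add: put_eq[OF HY])
    then show ?thesis by (simp add: nn_integral_put[OF HY])
  qed
  ultimately show "(\<lambda>y. emeasure (put (H y) (t y) (Y y) (c y)) A) \<in> borel_measurable M"
    by (simp cong: measurable_cong)
qed

lemma inverse_step_eq:
  assumes H: "H \<in> space HH" and Y: "Y \<in> space S"
  shows "inverse_step L \<kappa> mk lam i H (e, s, Y) = (if e then return SS (e, s, Y)
    else exp_law 1 \<bind> (\<lambda>y. if level_set len (srate H Y) (s + y) \<noteq> {}
      then put H (Inf (level_set len (srate H Y) (s + y))) Y (s + y) else return SS (True, s + y, Y)))"
proof -
  have sol: "{t \<in> {0<..<len}. cum_intensity L \<kappa> lam i (H \<union> Y) t = ennreal a} = level_set len (srate H Y) a" for a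
    unfolding level_set_def using cum_intensity_eq[OF H Y] by auto
  show ?thesis unfolding inverse_step_def put_def Let_def prod.case sol by (rule refl)
qed

lemma measurable_inverse_step:
  "(\<lambda>(H, st). inverse_step L \<kappa> mk lam i H st) \<in> HH \<Otimes>\<^sub>M SS \<rightarrow>\<^sub>M subprob_algebra SS"
proof -
  let ?M = "(HH \<Otimes>\<^sub>M SS) \<Otimes>\<^sub>M (borel :: real measure)"
  let ?h = "\<lambda>x. srate (fst (fst x)) (snd (snd (snd (fst x))))"
  let ?a = "\<lambda>x. fst (snd (snd (fst x))) + snd x"
  have h: "(\<lambda>(x, r). ?h x r) \<in> borel_measurable (?M \<Otimes>\<^sub>M borel)" by measurable
  have a: "?a \<in> borel_measurable ?M" by measurable
  note [measurable] = pred_level_set[OF h a E.len_pos] measurable_Inf_level_set[OF h a E.len_pos]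
  have b: "(\<lambda>x. if level_set len (?h x) (?a x) \<noteq> {}
      then put (fst (fst x)) (Inf (level_set len (?h x) (?a x))) (snd (snd (snd (fst x)))) (?a x)
      else return SS (True, ?a x, snd (snd (snd (fst x))))) \<in> ?M \<rightarrow>\<^sub>M subprob_algebra SS"
    by measurable
  have "(\<lambda>z. if fst (snd z) then return SS (snd z)
     else exp_law 1 \<bind> (\<lambda>y. if level_set len (srate (fst z) (snd (snd (snd z)))) (fst (snd (snd z)) + y) \<noteq> {}
      then put (fst z) (Inf (level_set len (srate (fst z) (snd (snd (snd z)))) (fst (snd (snd z)) + y)))
        (snd (snd (snd z))) (fst (snd (snd z)) + y)
      else return SS (True, fst (snd (snd z)) + y, snd (snd (snd z))))) \<in> HH \<Otimes>\<^sub>M SS \<rightarrow>\<^sub>M subprob_algebra SS"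
  proof (rule measurable_If)
    show "(\<lambda>z. exp_law 1 \<bind> (\<lambda>y. if level_set len (srate (fst z) (snd (snd (snd z)))) (fst (snd (snd z)) + y) \<noteq> {}
      then put (fst z) (Inf (level_set len (srate (fst z) (snd (snd (snd z)))) (fst (snd (snd z)) + y)))
        (snd (snd (snd z))) (fst (snd (snd z)) + y)
      else return SS (True, fst (snd (snd z)) + y, snd (snd (snd z))))) \<in> HH \<Otimes>\<^sub>M SS \<rightarrow>\<^sub>M subprob_algebra SS"
    proof (rule measurable_bind[where N=borel])
      show "(\<lambda>z. exp_law 1) \<in> HH \<Otimes>\<^sub>M SS \<rightarrow>\<^sub>M subprob_algebra borel"
        by (rule measurable_compose[OF _ measurable_exp_law]) simp
    qed (rule b)
  qed measurable
  then show ?thesis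
    by (rule measurable_cong[THEN iffD2, rotated])
       (auto simp: space_pair_measure space_SS inverse_step_eq cong: if_cong)
qed

lemma ogata_step_eq:
  "ogata_step L \<kappa> mk lam Ls Ms i H (e, t, Y) = (if e then return SS (e, t, Y)
     else exp_law (Ms t (up_part L \<kappa> i H \<union> Y)) \<bind> (\<lambda>T. uniform01 \<bind> (\<lambda>U.
       if t + T > len \<and> t + Ls t (up_part L \<kappa> i H \<union> Y) \<ge> len then return SS (True, t, Y)
       else if T > Ls t (up_part L \<kappa> i H \<union> Y) then return SS (False, t + Ls t (up_part L \<kappa> i H \<union> Y), Y)
       else if U > seg_rate L \<kappa> lam i (H \<union> Y) (t + T) / Ms t (up_part L \<kappa> i H \<union> Y) then return SS (False, t + T, Y)
       else put H (t + T) Y (t + T))))"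
  by (simp add: ogata_step_def put_def Let_def cong: if_cong)

context
  fixes Ls Ms :: "real \<Rightarrow> 'p set \<Rightarrow> real"
  assumes bounds: "ogata_bounds L \<kappa> lam i Ls Ms"
begin

lemma measurable_Ls[measurable (raw)]:
  assumes "t \<in> borel_measurable M" "H \<in> M \<rightarrow>\<^sub>M HH" "Y \<in> M \<rightarrow>\<^sub>M S"
  shows "(\<lambda>y. Ls (t y) (up_part L \<kappa> i (H y) \<union> Y y)) \<in> borel_measurable M"
    "(\<lambda>y. Ms (t y) (up_part L \<kappa> i (H y) \<union> Y y)) \<in> borel_measurable M"
proof -
  have p: "(\<lambda>y. (t y, up_part L \<kappa> i (H y) \<union> Y y)) \<in> M \<rightarrow>\<^sub>M borel \<Otimes>\<^sub>M patterns_on L \<kappa> (up_seg L i \<union> seg L i)"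
    using assms by (intro measurable_Pair measurable_up_part_Un)
  have "(\<lambda>(t, X). Ls t X) \<in> borel_measurable (borel \<Otimes>\<^sub>M patterns_on L \<kappa> (up_seg L i \<union> seg L i))"
    "(\<lambda>(t, X). Ms t X) \<in> borel_measurable (borel \<Otimes>\<^sub>M patterns_on L \<kappa> (up_seg L i \<union> seg L i))"
    using bounds by (auto simp: ogata_bounds_def)
  from this[THEN measurable_compose[OF p]]
  show "(\<lambda>y. Ls (t y) (up_part L \<kappa> i (H y) \<union> Y y)) \<in> borel_measurable M"
    "(\<lambda>y. Ms (t y) (up_part L \<kappa> i (H y) \<union> Y y)) \<in> borel_measurable M" by auto
qed

lemma measurable_ogata_body[measurable (raw)]:
  assumes [measurable]: "H \<in> M \<rightarrow>\<^sub>M HH" "t \<in> borel_measurable M" "Y \<in> M \<rightarrow>\<^sub>M S"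
    "T \<in> borel_measurable M" "U \<in> borel_measurable M"
  shows "(\<lambda>y. if t y + T y > len \<and> t y + Ls (t y) (up_part L \<kappa> i (H y) \<union> Y y) \<ge> len then return SS (True, t y, Y y)
       else if T y > Ls (t y) (up_part L \<kappa> i (H y) \<union> Y y)
       then return SS (False, t y + Ls (t y) (up_part L \<kappa> i (H y) \<union> Y y), Y y)
       else if U y > seg_rate L \<kappa> lam i (H y \<union> Y y) (t y + T y) / Ms (t y) (up_part L \<kappa> i (H y) \<union> Y y)
       then return SS (False, t y + T y, Y y)
       else put (H y) (t y + T y) (Y y) (t y + T y)) \<in> M \<rightarrow>\<^sub>M subprob_algebra SS"
  by measurable

lemma measurable_ogata_step:
  "(\<lambda>(H, st). ogata_step L \<kappa> mk lam Ls Ms i H st) \<in> HH \<Otimes>\<^sub>M SS \<rightarrow>\<^sub>M subprob_algebra SS"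
proof -
  have u: "(\<lambda>z. uniform01) \<in> N \<rightarrow>\<^sub>M subprob_algebra borel" for N :: "'z measure"
    using uniform01_in by simp
  let ?H = "\<lambda>z. fst z" and ?t = "\<lambda>z. fst (snd (snd z))" and ?Y = "\<lambda>z. snd (snd (snd z))"
  have "(\<lambda>z. if fst (snd z) then return SS (snd z)
     else exp_law (Ms (?t z) (up_part L \<kappa> i (?H z) \<union> ?Y z)) \<bind> (\<lambda>T. uniform01 \<bind> (\<lambda>U.
       if ?t z + T > len \<and> ?t z + Ls (?t z) (up_part L \<kappa> i (?H z) \<union> ?Y z) \<ge> len then return SS (True, ?t z, ?Y z)
       else if T > Ls (?t z) (up_part L \<kappa> i (?H z) \<union> ?Y z)
       then return SS (False, ?t z + Ls (?t z) (up_part L \<kappa> i (?H z) \<union> ?Y z), ?Y z)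
       else if U > seg_rate L \<kappa> lam i (?H z \<union> ?Y z) (?t z + T) / Ms (?t z) (up_part L \<kappa> i (?H z) \<union> ?Y z)
       then return SS (False, ?t z + T, ?Y z)
       else put (?H z) (?t z + T) (?Y z) (?t z + T)))) \<in> HH \<Otimes>\<^sub>M SS \<rightarrow>\<^sub>M subprob_algebra SS"
    by (intro measurable_If measurable_bind[where N="borel :: real measure"] u measurable_ogata_body
          measurable_compose[OF _ measurable_exp_law]) measurable
  then show ?thesis
    by (rule measurable_cong[THEN iffD2, rotated]) (auto simp: space_pair_measure space_SS ogata_step_eq cong: if_cong)
qed

end

end

section \<open>Both loops produce the given law\<close>

context segment_simulation
begin

lemma srate_cong:
  assumes "H \<in> space HH" "H' \<in> space HH" "Y \<in> space S" "Y' \<in> space S" "0 < t" "t < len"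
    and "{q \<in> H. loc \<kappa> q \<in> up_seg L i} = {q \<in> H'. loc \<kappa> q \<in> up_seg L i}" "before tm t Y = before tm t Y'"
  shows "seg_rate L \<kappa> lam i (H \<union> Y) t = seg_rate L \<kappa> lam i (H' \<union> Y') t"
  using assms by (simp add: seg_rate_def past_eq)

lemma HH_subset: "H \<in> space HH \<Longrightarrow> H' \<subseteq> H \<Longrightarrow> H' \<in> space HH"
  by (auto simp: space_patterns_on[OF C(1)] intro: finite_subset inj_on_subset)

lemma up_part_in_patterns: "H \<in> space HH \<Longrightarrow> up_part L \<kappa> i H \<in> space (patterns_on L \<kappa> (up_seg L i))"
  by (auto simp: space_patterns_on[OF C(1)] space_patterns_on[OF borel_part_up_seg] up_part_def intro: inj_on_subset)

lemma points_on_inclusion: "(\<lambda>p. p) \<in> B \<rightarrow>\<^sub>M points_on L \<kappa> (net L)"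
proof (rule measurableI)
  show "p \<in> space (points_on L \<kappa> (net L))" if "p \<in> space B" for p
    using that by (simp add: space_points_on[OF BS])
  show "(\<lambda>p. p) -` D \<inter> space B \<in> sets B" if D: "D \<in> sets (points_on L \<kappa> (net L))" for D
  proof -
    have "(\<lambda>p. p) -` D \<inter> space B = {p \<in> D. loc \<kappa> p \<in> seg L i}"
      using sets.sets_into_space[OF D] by (auto simp: space_points_on[OF BS])
    then show ?thesis using points_on_sets_Int[OF BS borel_part_net _ D] seg_subset_net[OF i] by simp
  qed
qed

context
  fixes H :: "'p set"
  assumes H[measurable]: "H \<in> space HH"
begin

interpretation V: marked_line "loc \<kappa>" B tm \<nu> len pt "srate H" "smark H"
  by (rule marked_line[OF H])

text \<open>\<open>w\<close> is the value of a state: \<psi> once the loop has ended, the value at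
  the current time if no point lies later than that, and 0 for the states the algorithm does not
  reach, where nothing is to be shown. On a live state with a value, \<open>val_thinning\<close>
  shows that one iteration preserves it exactly.\<close>

lemma ogata_step_ge:
  assumes bounds: "ogata_bounds L \<kappa> lam i Ls Ms" and \<psi>[measurable]: "\<psi> \<in> borel_measurable S"
    and st: "st \<in> space SS"
  defines "w \<equiv> \<lambda>(e, t, Y). if e then \<psi> Y else if 0 \<le> t \<and> t < len \<and> last_time tm Y \<le> t then V.val \<psi> Y t else 0"
  shows "w st \<le> (\<integral>\<^sup>+x. w x \<partial>ogata_step L \<kappa> mk lam Ls Ms i H st)"
proof -
  obtain e t Y where st_eq: "st = (e, t, Y)" and Y[measurable]: "Y \<in> space S"
    using st by (auto simp: space_SS)
  have w[measurable]: "w \<in> borel_measurable SS"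
    unfolding w_def split_beta' by measurable
  have w_return: "(\<integral>\<^sup>+x. w x \<partial>return SS (e, r, Z)) = w (e, r, Z)" if "Z \<in> space S" for e r Z
    using that by (intro nn_integral_return) (simp_all add: space_SS w)
  consider "e" | "\<not> e" "0 \<le> t" "t < len" "last_time tm Y \<le> t" | "w st = 0"
    by (cases "e \<or> (0 \<le> t \<and> t < len \<and> last_time tm Y \<le> t)") (auto simp: w_def st_eq)
  then show ?thesis
  proof cases
    case 1
    then show ?thesis using Y by (simp add: st_eq ogata_step_eq w_return)
  next
    case 2
    let ?X = "up_part L \<kappa> i H \<union> Y"
    define l where "l = Ls t ?X"
    define m where "m = Ms t ?X"
    \<comment> \<open>The window in which a candidate is tested is cut off at the end of the
      segment; a longer waiting time leads to \<open>t + l\<close> or ends the loop, and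
      \<open>val\<close> at \<open>t + D\<close> is the value in both cases.\<close>
    define D where "D = min l (len - t)"
    have Yt: "tm q \<le> t" if "q \<in> Y" for q
      using 2(4) that by (simp add: last_time_le_iff space_S_D(1)[OF Y])
    have "loc \<kappa> ` Y \<subseteq> seg_pt L i ` {0<..t}"
    proof
      fix u assume "u \<in> loc \<kappa> ` Y"
      then obtain q where q: "q \<in> Y" "u = loc \<kappa> q" by auto
      then have "q \<in> space B" using space_S_D(2)[OF Y] by auto
      from tm_eq[OF this] Yt[OF q(1)] q(2) show "u \<in> seg_pt L i ` {0<..t}" by auto
    qed
    then have lm: "0 < l" "0 < m" "\<And>s. s \<in> {t..t + l} \<Longrightarrow> seg_rate L \<kappa> lam i ?X s \<le> m"
      using bounds up_part_in_patterns[OF H] 2 Y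
      unfolding ogata_bounds_def l_def m_def patterns_seg by (auto simp: atLeastLessThan_iff)
    \<comment> \<open>The bounds are assumed for the upstream part of \<open>H\<close>; the rate is
      the same for all of \<open>H\<close>, as other points are not in the past.\<close>
    have rate_le: "seg_rate L \<kappa> lam i (H \<union> Y) s \<le> m" if "t \<le> s" "s \<le> t + l" for s
    proof (cases "0 < s \<and> s < len")
      case True
      have "seg_rate L \<kappa> lam i (H \<union> Y) s = seg_rate L \<kappa> lam i ?X s"
        using True by (intro srate_cong H Y HH_subset[OF H]) (auto simp: up_part_def)
      then show ?thesis using lm(3)[of s] that by simp
    qed (use lm(2) in \<open>auto simp: seg_rate_def\<close>)
    have D: "0 < D" "t + D \<le> len" using lm 2 by (auto simp: D_def)
    define body where "body T U = (if t + T > len \<and> t + l \<ge> len then return SS (True, t, Y)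
       else if T > l then return SS (False, t + l, Y)
       else if U > seg_rate L \<kappa> lam i (H \<union> Y) (t + T) / m then return SS (False, t + T, Y)
       else put H (t + T) Y (t + T))" for T U
    have body: "(\<lambda>z. body (fst z) (snd z)) \<in> borel \<Otimes>\<^sub>M borel \<rightarrow>\<^sub>M subprob_algebra SS"
      unfolding body_def l_def m_def
      by (intro measurable_ogata_body[OF bounds] measurable_const H Y) (use 2 in measurable)
    have body1: "body T \<in> borel \<rightarrow>\<^sub>M subprob_algebra SS" for T
      using measurable_compose[OF measurable_Pair1'[of T borel] body] by simp
    have K: "(\<lambda>T. uniform01 \<bind> body T) \<in> borel \<rightarrow>\<^sub>M subprob_algebra SS"
      by (rule measurable_bind[where N="borel :: real measure"])
         (use uniform01_in body in \<open>simp_all add: measurable_const\<close>)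
    have uniform_m: "body T \<in> uniform01 \<rightarrow>\<^sub>M subprob_algebra SS" for T
      using body1[of T] by (simp cong: measurable_cong_sets)
    have step: "ogata_step L \<kappa> mk lam Ls Ms i H st = exp_law m \<bind> (\<lambda>T. uniform01 \<bind> body T)"
      using 2(1) by (simp add: st_eq ogata_step_eq body_def[abs_def] l_def m_def cong: if_cong)
    have "(\<integral>\<^sup>+x. w x \<partial>ogata_step L \<kappa> mk lam Ls Ms i H st) =
        (\<integral>\<^sup>+T. (\<integral>\<^sup>+x. w x \<partial>(uniform01 \<bind> body T)) \<partial>exp_law m)"
      unfolding step by (rule nn_integral_bind[OF w]) (use K in \<open>simp cong: measurable_cong_sets\<close>)
    also have "\<dots> = (\<integral>\<^sup>+T. ennreal (exponential_density m T) * (\<integral>\<^sup>+x. w x \<partial>(uniform01 \<bind> body T)) \<partial>lborel)"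
      by (rule nn_integral_exp_law) (rule measurable_compose[OF K nn_integral_measurable_subprob_algebra[OF w]])
    \<comment> \<open>Two waiting times are excluded as null events: at \<open>T = 0\<close> a
      candidate could coincide with the last point, and at \<open>T = len - t\<close> it would sit
      at the endpoint, outside of the open segment.\<close>
    also have "\<dots> = (\<integral>\<^sup>+x. ennreal (exponential_density m x) *
      (if x \<le> D then (1 - srate H Y (t + x) / ennreal m) * V.val \<psi> Y (t + x) +
          srate H Y (t + x) / ennreal m * V.mean_after \<psi> Y (t + x)
       else V.val \<psi> Y (t + D)) \<partial>lborel)"
      using AE_lborel_singleton[of 0] AE_lborel_singleton[of "len - t"]
    proof (intro nn_integral_cong_AE, eventually_elim)
      fix T :: real assume T: "T \<noteq> 0" "T \<noteq> len - t"
      have u1: "emeasure uniform01 UNIV = 1"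
        using prob_space.emeasure_space_1[OF prob_space_uniform01] by simp
      have inner: "(\<integral>\<^sup>+x. w x \<partial>(uniform01 \<bind> body T)) = (\<integral>\<^sup>+U. (\<integral>\<^sup>+x. w x \<partial>body T U) \<partial>uniform01)"
        by (rule nn_integral_bind[OF w uniform_m])
      consider "T < 0" | "D < T" "len \<le> t + l" | "D < T" "t + l < len" | "0 < T" "T \<le> D"
        using T by force
      then show "ennreal (exponential_density m T) * (\<integral>\<^sup>+x. w x \<partial>(uniform01 \<bind> body T)) =
        ennreal (exponential_density m T) *
        (if T \<le> D then (1 - srate H Y (t + T) / ennreal m) * V.val \<psi> Y (t + T) +
            srate H Y (t + T) / ennreal m * V.mean_after \<psi> Y (t + T)
         else V.val \<psi> Y (t + D))"
      proof cases
        case 1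
        then show ?thesis by (simp add: exponential_density_def)
      next
        case c: 2
        then have D_eq: "t + D = len" and "t + T > len" by (auto simp: D_def)
        then have "body T U = return SS (True, t, Y)" for U using c by (simp add: body_def)
        then have "(\<integral>\<^sup>+x. w x \<partial>(uniform01 \<bind> body T)) = \<psi> Y"
          unfolding inner by (simp add: w_return[OF Y] u1) (simp add: w_def)
        then show ?thesis using c D_eq by (simp add: V.val_len[OF \<psi> Y])
      next
        case c: 3
        then have D_eq: "D = l" by (auto simp: D_def)
        then have "body T U = return SS (False, t + l, Y)" for U using c by (simp add: body_def)
        then have "(\<integral>\<^sup>+x. w x \<partial>(uniform01 \<bind> body T)) = V.val \<psi> Y (t + l)"
          unfolding inner using c 2 lm(1) by (simp add: w_return[OF Y] u1) (simp add: w_def)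
        then show ?thesis using c D_eq by simp
      next
        case c: 4
        let ?q = "seg_rate L \<kappa> lam i (H \<union> Y) (t + T) / m"
        have tT: "0 < t + T" "t + T < len" "T \<le> l" "t < t + T"
          using c T 2 by (auto simp: D_def)
        have q: "?q \<le> 1" using rate_le[of "t + T"] tT lm(2) c by (simp add: divide_le_eq)
        have a: "w (False, t + T, Y) = V.val \<psi> Y (t + T)"
          using tT 2 by (simp add: w_def)
        have b: "(\<integral>\<^sup>+x. w x \<partial>put H (t + T) Y (t + T)) = V.mean_after \<psi> Y (t + T)"
        proof -
          have less: "\<forall>q\<in>Y. tm q < t + T" using Yt c by force
          have "(\<integral>\<^sup>+x. w x \<partial>put H (t + T) Y (t + T)) =
            (\<integral>\<^sup>+m. smark H Y (t + T) m * w (False, t + T, V.add_pt (t + T) m Y) \<partial>\<nu>)"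
            unfolding nn_integral_put[OF H Y w] using tT less by simp
          also have "\<dots> = V.mean_after \<psi> Y (t + T)"
            unfolding V.mean_after_def
          proof (intro nn_integral_cong)
            fix m assume m: "m \<in> space \<nu>"
            have Z: "V.add_pt (t + T) m Y \<in> space S" by (rule V.add_pt_in_S[OF m Y])
            have "last_time tm (V.add_pt (t + T) m Y) \<le> t + T"
              unfolding last_time_le_iff[OF space_S_D(1)[OF Z]]
              using tT less m by (auto simp: V.add_pt_def add_last_def V.tm_pt less_imp_le)
            then show "smark H Y (t + T) m * w (False, t + T, V.add_pt (t + T) m Y) =
                smark H Y (t + T) m * V.val \<psi> (V.add_pt (t + T) m Y) (t + T)"
              using tT by (simp add: w_def)
          qed
          finally show ?thesis .
        qed
        have "(\<integral>\<^sup>+x. w x \<partial>(uniform01 \<bind> body T)) =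
          (\<integral>\<^sup>+U. (if ?q < U then V.val \<psi> Y (t + T) else V.mean_after \<psi> Y (t + T)) \<partial>uniform01)"
          unfolding inner using tT
          by (intro nn_integral_cong) (simp add: body_def w_return[OF Y] a b)
        also have "\<dots> = (1 - srate H Y (t + T) / ennreal m) * V.val \<psi> Y (t + T) +
            srate H Y (t + T) / ennreal m * V.mean_after \<psi> Y (t + T)"
          unfolding nn_integral_uniform01_test[OF q] srate_def ennreal_divide_pos[OF lm(2)] ..
        finally show ?thesis using c by simp
      qed
    qed
    also have "\<dots> = V.val \<psi> Y t"
      using D lm(2) rate_le
      by (intro V.val_thinning[symmetric] \<psi> Y) (auto simp: srate_def D_def intro!: ennreal_leI)
    finally show ?thesis using 2 by (simp add: w_def st_eq)
  qed simp
qed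

text \<open>A live state has a value only if the running sum \<open>s\<close> is the cumulative rate
  up to its last point and it has exactly \<open>k\<close> points. Almost surely an iteration either
  ends the loop or adds a point strictly after the last one, so \<open>k\<close> advances with the
  iterations, and \<open>val_inverse\<close> gives the inequality.\<close>

lemma inverse_step_ge:
  assumes \<psi>[measurable]: "\<psi> \<in> borel_measurable S" and st: "st \<in> space SS"
  defines "w \<equiv> \<lambda>k (e, s, Y). if e then \<psi> Y else if 0 \<le> s \<and> ivl 0 (last_time tm Y) (srate H Y) = ennreal s \<and> card Y = k
    then V.val \<psi> Y (last_time tm Y) else 0"
  shows "w k \<in> borel_measurable SS" "w k st \<le> (\<integral>\<^sup>+x. w (Suc k) x \<partial>inverse_step L \<kappa> mk lam i H st)"
proof -
  obtain e s Y where st_eq: "st = (e, s, Y)" and Y[measurable]: "Y \<in> space S"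
    using st by (auto simp: space_SS)
  show w[measurable]: "w k \<in> borel_measurable SS" for k
    unfolding w_def split_beta' by measurable
  have w_return: "(\<integral>\<^sup>+x. w k x \<partial>return SS (e, r, Z)) = w k (e, r, Z)" if "Z \<in> space S" for k e r Z
    using that by (intro nn_integral_return) (simp_all add: space_SS w)
  let ?t = "last_time tm Y"
  consider "e" | "\<not> e" "0 \<le> s" "ivl 0 ?t (srate H Y) = ennreal s" "card Y = k" | "w k st = 0"
    by (cases "e \<or> (0 \<le> s \<and> ivl 0 ?t (srate H Y) = ennreal s \<and> card Y = k)") (auto simp: w_def st_eq)
  then show "w k st \<le> (\<integral>\<^sup>+x. w (Suc k) x \<partial>inverse_step L \<kappa> mk lam i H st)"
  proof cases
    case 1
    have "w k (True, s, Y) = w (Suc k) (True, s, Y)" by (simp add: w_def)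
    then show ?thesis using 1 Y by (simp add: st_eq inverse_step_eq[OF H Y] w_return)
  next
    case 2
    let ?L = "\<lambda>y. level_set len (srate H Y) (s + y)"
    have t: "0 \<le> ?t" "\<And>q. q \<in> Y \<Longrightarrow> tm q \<le> ?t"
      using last_time_le_iff[OF space_S_D(1)[OF Y], of tm ?t] by auto
    have t_len: "?t \<le> len"
      unfolding last_time_le_iff[OF space_S_D(1)[OF Y]]
      using V.tm_range space_S_D(2)[OF Y] V.len_pos by (auto simp: less_imp_le)
    define K where "K y = (if ?L y \<noteq> {} then put H (Inf (?L y)) Y (s + y) else return SS (True, s + y, Y))" for y
    have K: "K \<in> borel \<rightarrow>\<^sub>M subprob_algebra SS"
    proof -
      have h: "(\<lambda>(y::real, r). srate H Y r) \<in> borel_measurable (borel \<Otimes>\<^sub>M borel)" by measurable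
      have a: "(\<lambda>y. s + y) \<in> borel_measurable borel" by measurable
      note [measurable] = pred_level_set[OF h a V.len_pos] measurable_Inf_level_set[OF h a V.len_pos]
      show ?thesis unfolding K_def by measurable
    qed
    have step: "inverse_step L \<kappa> mk lam i H st = exp_law 1 \<bind> K"
      using 2(1) by (simp add: st_eq inverse_step_eq[OF H Y] K_def[abs_def] cong: if_cong)
    have "w k st = V.val \<psi> Y ?t" using 2 by (simp add: st_eq w_def)
    also have "\<dots> \<le> (\<integral>\<^sup>+y. ennreal (exponential_density 1 y) *
        (if ?L y \<noteq> {} then V.mean_after \<psi> Y (Inf (?L y)) else \<psi> Y) \<partial>lborel)"
      by (rule V.val_inverse[OF \<psi> Y t(1) t_len 2(2,3)])
    \<comment> \<open>The null event \<open>y = 0\<close> is left out, since a solution at the old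
      level need not lie after the last point.\<close>
    also have "\<dots> = (\<integral>\<^sup>+y. ennreal (exponential_density 1 y) * (\<integral>\<^sup>+x. w (Suc k) x \<partial>K y) \<partial>lborel)"
      using AE_lborel_singleton[of 0]
    proof (intro nn_integral_cong_AE, eventually_elim)
      fix y :: real assume "y \<noteq> 0"
      show "ennreal (exponential_density 1 y) * (if ?L y \<noteq> {} then V.mean_after \<psi> Y (Inf (?L y)) else \<psi> Y) =
        ennreal (exponential_density 1 y) * (\<integral>\<^sup>+x. w (Suc k) x \<partial>K y)"
      proof (cases "y < 0")
        case True
        then show ?thesis by (simp add: exponential_density_def)
      next
        case False
        with \<open>y \<noteq> 0\<close> have y: "0 < y" by simp
        have "(\<integral>\<^sup>+x. w (Suc k) x \<partial>K y) = (if ?L y \<noteq> {} then V.mean_after \<psi> Y (Inf (?L y)) else \<psi> Y)"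
        proof (cases "?L y = {}")
          case True
          then show ?thesis by (simp add: K_def w_return[OF Y]) (simp add: w_def)
        next
          case ne: False
          let ?z = "Inf (?L y)"
          have "?z \<in> ?L y"
            by (rule Inf_level_set(4)[OF _ ne]) (use y 2 in simp_all)
          then have z: "0 < ?z" "?z < len" "ivl 0 ?z (srate H Y) = ennreal (s + y)"
            by (auto simp: level_set_def)
          have tz: "?t < ?z"
          proof (rule ccontr)
            assume "\<not> ?t < ?z"
            then have "ennreal (s + y) \<le> ennreal s"
              using ivl_mono_bound[of ?z ?t 0 "srate H Y"] z(3) 2(3) by simp
            then show False using y 2(2) by simp
          qed
          have less: "\<forall>q\<in>Y. tm q < ?z" using t(2) tz by force
          have "(\<integral>\<^sup>+x. w (Suc k) x \<partial>K y) =
              (\<integral>\<^sup>+m. smark H Y ?z m * w (Suc k) (False, s + y, V.add_pt ?z m Y) \<partial>\<nu>)"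
            unfolding K_def if_P[OF ne] nn_integral_put[OF H Y w] using z less by simp
          also have "\<dots> = V.mean_after \<psi> Y ?z"
            unfolding V.mean_after_def
          proof (intro nn_integral_cong)
            fix m assume m: "m \<in> space \<nu>"
            let ?Y = "V.add_pt ?z m Y"
            have Z: "?Y \<in> space S" by (rule V.add_pt_in_S[OF m Y])
            have ins: "?Y = insert (pt ?z m) Y" and tmz: "tm (pt ?z m) = ?z"
              using z less V.tm_pt[OF z(1,2) m] by (auto simp: V.add_pt_def add_last_def)
            have card: "card ?Y = Suc k"
              using less tmz 2(4) space_S_D(1)[OF Y] unfolding ins by (subst card_insert_disjoint) auto
            have last: "last_time tm ?Y = ?z"
              unfolding last_time_def ins
              using space_S_D(1)[OF Y] tmz less z by (intro Max_eqI) (auto simp: less_imp_le)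
            \<comment> \<open>The rates before \<open>?z\<close> do not see a point at
              \<open>?z\<close>, so the running sum is the cumulative rate also for the extended
              pattern.\<close>
            have "ivl 0 ?z (srate H ?Y) = ivl 0 ?z (srate H Y)"
            proof (rule ivl_cong_less)
              fix r assume r: "0 < r" "r < ?z"
              have "before tm r ?Y = before tm r Y" using r tmz unfolding ins before_def by auto
              from srate_cong[OF H H Z Y r(1) less_trans[OF r(2) z(2)] refl this]
              have "seg_rate L \<kappa> lam i (H \<union> ?Y) r = seg_rate L \<kappa> lam i (H \<union> Y) r" .
              then show "srate H ?Y r = srate H Y r" unfolding srate_def by (rule arg_cong)
            qed
            then show "smark H Y ?z m * w (Suc k) (False, s + y, ?Y) = smark H Y ?z m * V.val \<psi> ?Y ?z"
              using z card y 2(2) by (simp add: w_def last)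
          qed
          finally show ?thesis using ne by simp
        qed
        then show ?thesis by simp
      qed
    qed
    also have "\<dots> = (\<integral>\<^sup>+y. (\<integral>\<^sup>+x. w (Suc k) x \<partial>K y) \<partial>exp_law 1)"
      by (rule nn_integral_exp_law[symmetric]) (rule measurable_compose[OF K nn_integral_measurable_subprob_algebra[OF w]])
    also have "\<dots> = (\<integral>\<^sup>+x. w (Suc k) x \<partial>inverse_step L \<kappa> mk lam i H st)"
      unfolding step by (rule nn_integral_bind[OF w, symmetric]) (use K in \<open>simp cong: measurable_cong_sets\<close>)
    finally show ?thesis .
  qed simp
qed

end

end

section \<open>From one iteration to the law of the output\<close>

lemma loop_law_cong:
  assumes "step \<in> SS \<rightarrow>\<^sub>M subprob_algebra SS" "s0 \<in> space SS" "\<And>x. x \<in> space SS \<Longrightarrow> step x = step' x"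
  shows "loop_law SS step s0 n = loop_law SS step' s0 n"
proof (induction n)
  case (Suc n)
  have "loop_law SS step s0 n \<bind> step = loop_law SS step s0 n \<bind> step'"
    using sets_eq_imp_space_eq[OF sets_loop_law[OF assms(1,2)]] assms(3) by (intro bind_cong refl) auto
  then show ?case using Suc by simp
qed simp

context segment_simulation
begin

lemma start_in_SS: "(False, 0, {}) \<in> space SS"
  by (simp add: space_SS)

lemma up_part_up_part[simp]: "up_part L \<kappa> i (up_part L \<kappa> i H) = up_part L \<kappa> i H"
  by (auto simp: up_part_def)

lemma up_part_HH: "H \<in> space HH \<Longrightarrow> up_part L \<kappa> i H \<in> space HH"
  by (rule HH_subset) (auto simp: up_part_def)

lemma past_up_part:
  assumes "H \<in> space HH" "Y \<in> space S" "0 < t" "t < len"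
  shows "past L \<kappa> (seg_pt L i t) (up_part L \<kappa> i H \<union> Y) = past L \<kappa> (seg_pt L i t) (H \<union> Y)"
  using assms up_part_HH[OF assms(1)] by (simp add: past_eq) (simp add: up_part_def)

text \<open>The existence of a law is given for upstream patterns, while the recursion supplies
  patterns on all segments simulated so far. The additional points are never in the past of a point
  of this segment.\<close>

lemma seg_process_up_part:
  assumes H: "H \<in> space HH"
  shows "seg_process L \<kappa> g i (up_part L \<kappa> i H) P \<longleftrightarrow> seg_process L \<kappa> g i H P"
proof (cases "sets P = sets S")
  case True
  then have sp: "space P = space S" by (rule sets_eq_imp_space_eq)
  have "past L \<kappa> (loc \<kappa> p) (up_part L \<kappa> i H \<union> {q \<in> X. tm q < tm p}) = past L \<kappa> (loc \<kappa> p) (H \<union> {q \<in> X. tm q < tm p})"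
    if "X \<in> space P" "p \<in> space B" for X p
    using past_up_part[OF H, of "{q \<in> X. tm q < tm p}" "tm p"] before_in_S[of X "tm p"] tm_eq[OF that(2)] that(1)
    by (simp add: sp before_def)
  then have "(\<integral>\<^sup>+X. (\<integral>\<^sup>+p. indicator D (p, {q \<in> X. tm q < tm p}) *
        ennreal (g p (past L \<kappa> (loc \<kappa> p) (up_part L \<kappa> i H \<union> {q \<in> X. tm q < tm p}))) \<partial>B) \<partial>P) =
      (\<integral>\<^sup>+X. (\<integral>\<^sup>+p. indicator D (p, {q \<in> X. tm q < tm p}) *
        ennreal (g p (past L \<kappa> (loc \<kappa> p) (H \<union> {q \<in> X. tm q < tm p}))) \<partial>B) \<partial>P)" for D
    by (intro nn_integral_cong) simp
  then show ?thesis unfolding seg_process_def has_cond_intensity_def by simp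
qed (simp add: seg_process_def has_cond_intensity_def)

text \<open>Transfers the end of the loop, assumed for upstream patterns, to patterns on all of
  \<open>C\<close>.\<close>

lemma ogata_step_up_part:
  assumes H: "H \<in> space HH" and st: "st \<in> space SS"
  shows "ogata_step L \<kappa> mk lam Ls Ms i (up_part L \<kappa> i H) st = ogata_step L \<kappa> mk lam Ls Ms i H st"
proof -
  obtain e t Y where st_eq: "st = (e, t, Y)" and Y: "Y \<in> space S" using st by (auto simp: space_SS)
  have rate: "seg_rate L \<kappa> lam i (up_part L \<kappa> i H \<union> Y) r = seg_rate L \<kappa> lam i (H \<union> Y) r" for r
    using past_up_part[OF H Y, of r] by (simp add: seg_rate_def)
  have mark: "smark (up_part L \<kappa> i H) Y r = smark H Y r" for r
    using past_up_part[OF H Y, of r] by (auto simp: smark_def)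
  have put: "put (up_part L \<kappa> i H) r Y c = put H r Y c" for r c
    unfolding put_eq[OF H Y] put_eq[OF up_part_HH[OF H] Y] mark ..
  show ?thesis unfolding st_eq ogata_step_eq rate up_part_up_part put by (rule refl)
qed

text \<open>The test functions: for growing \<open>N\<close> they increase to the indicator of
  \<open>A\<close> on patterns, as these are finite.\<close>

definition capped :: "'p set set \<Rightarrow> nat \<Rightarrow> 'p set \<Rightarrow> ennreal" where
  "capped A N Y = (if Y \<in> A \<and> card Y \<le> N then 1 else 0)"

lemma capped_measurable:
  assumes [measurable]: "A \<in> sets S"
  shows "capped A N \<in> borel_measurable S"
  unfolding capped_def by measurable

lemma capped_card: "N < card Y \<Longrightarrow> capped A N Y = 0"
  by (simp add: capped_def)

lemma capped_le: "capped A N Y \<le> indicator A Y"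
  by (simp add: capped_def indicator_def)

lemma ended_sets: "A \<in> sets S \<Longrightarrow> {True} \<times> UNIV \<times> A \<in> sets SS"
  unfolding SS_eq by (intro pair_measureI) auto

context
  fixes H :: "'p set"
  assumes H[measurable]: "H \<in> space HH"
begin

interpretation V: marked_line "loc \<kappa>" B tm \<nu> len pt "srate H" "smark H"
  by (rule marked_line[OF H])

text \<open>After \<open>Suc N\<close> iterations a live state with a value would have
  \<open>Suc N\<close> points, where the value is 0 by the cap. So the initial value is carried by
  ended states alone, and no assumption on the end of the loop is made.\<close>

lemma inverse_loop_ge:
  assumes A: "A \<in> sets S"
  shows "V.val (capped A N) {} 0 \<le>
    (SUP n. emeasure (loop_law SS (inverse_step L \<kappa> mk lam i H) (False, 0, {}) n) ({True} \<times> UNIV \<times> A))"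
proof -
  let ?w = "\<lambda>k (e, s, Y). if e then capped A N Y
    else if 0 \<le> s \<and> ivl 0 (last_time tm Y) (srate H Y) = ennreal s \<and> card Y = k
    then V.val (capped A N) Y (last_time tm Y) else 0"
  let ?law = "loop_law SS (inverse_step L \<kappa> mk lam i H) (False, 0, {})"
  have step: "inverse_step L \<kappa> mk lam i H \<in> SS \<rightarrow>\<^sub>M subprob_algebra SS"
    using measurable_compose[OF measurable_Pair1'[OF H] measurable_inverse_step] by simp
  note law = sets_loop_law[OF step start_in_SS]
  have "?w 0 (False, 0, {}) \<le> (\<integral>\<^sup>+x. ?w (Suc N) x \<partial>?law (Suc N))"
    by (rule loop_law_ge[OF step start_in_SS])
       (use inverse_step_ge[OF H capped_measurable[OF A]] start_in_SS in auto)
  also have "?w 0 (False, 0, {}) = V.val (capped A N) {} 0"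
    by (simp add: last_time_def)
  also have "(\<integral>\<^sup>+x. ?w (Suc N) x \<partial>?law (Suc N)) \<le> (\<integral>\<^sup>+x. indicator ({True} \<times> UNIV \<times> A) x \<partial>?law (Suc N))"
  proof (rule nn_integral_mono)
    fix x assume "x \<in> space (?law (Suc N))"
    then have "x \<in> space SS" unfolding sets_eq_imp_space_eq[OF law] .
    then obtain e s Y where x: "x = (e, s, Y)" and Y: "Y \<in> space S" by (auto simp: space_SS)
    have "card Y = Suc N \<Longrightarrow> V.val (capped A N) Y r = 0" for r
      by (rule V.val_eq_0[of N, OF capped_card Y]) auto
    then show "?w (Suc N) x \<le> indicator ({True} \<times> UNIV \<times> A) x"
      using capped_le[of A N Y] by (auto simp: x indicator_def)
  qed
  also have "\<dots> = emeasure (?law (Suc N)) ({True} \<times> UNIV \<times> A)"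
    using ended_sets[OF A] by (intro nn_integral_indicator) (simp only: law)
  also have "\<dots> \<le> (SUP n. emeasure (?law n) ({True} \<times> UNIV \<times> A))"
    by (rule SUP_upper) simp
  finally show ?thesis .
qed

text \<open>Rejections make the number of iterations independent of the number of points, so live
  states keep a value after any number of iterations. That value is at most 1, and their mass tends
  to 0 because the loop ends almost surely.\<close>

lemma ogata_loop_ge:
  assumes bounds: "ogata_bounds L \<kappa> lam i Ls Ms" and ends: "loop_ends L \<kappa> i (ogata_step L \<kappa> mk lam Ls Ms i H)"
    and A: "A \<in> sets S"
  shows "V.val (capped A N) {} 0 \<le>
    (SUP n. emeasure (loop_law SS (ogata_step L \<kappa> mk lam Ls Ms i H) (False, 0, {}) n) ({True} \<times> UNIV \<times> A))"
    (is "?v \<le> (SUP n. ?m n A)")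
proof -
  let ?w = "\<lambda>(e, t, Y). if e then capped A N Y
    else if 0 \<le> t \<and> t < len \<and> last_time tm Y \<le> t then V.val (capped A N) Y t else 0"
  let ?law = "loop_law SS (ogata_step L \<kappa> mk lam Ls Ms i H) (False, 0, {})"
  have step: "ogata_step L \<kappa> mk lam Ls Ms i H \<in> SS \<rightarrow>\<^sub>M subprob_algebra SS"
    using measurable_compose[OF measurable_Pair1'[OF H] measurable_ogata_step[OF bounds]] by simp
  note law = sets_loop_law[OF step start_in_SS]
  note [measurable] = capped_measurable[OF A]
  have wm: "?w \<in> borel_measurable SS" unfolding split_beta' by measurable
  have le: "?v \<le> ?m n A + (1 - ?m n (space S))" for n
  proof -
    have "?w (False, 0, {}) \<le> (\<integral>\<^sup>+x. ?w x \<partial>?law n)"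
      by (rule loop_law_ge[OF step start_in_SS, of "\<lambda>_. ?w"])
         (use wm ogata_step_ge[OF H bounds capped_measurable[OF A]] in auto)
    also have "?w (False, 0, {}) = ?v"
      using V.len_pos by (simp add: last_time_def)
    \<comment> \<open>The second indicator covers the live states, with their value bounded by
      1.\<close>
    also have "(\<integral>\<^sup>+x. ?w x \<partial>?law n) \<le>
        (\<integral>\<^sup>+x. indicator ({True} \<times> UNIV \<times> A) x + indicator (space SS - {True} \<times> UNIV \<times> space S) x \<partial>?law n)"
    proof (rule nn_integral_mono)
      fix x assume "x \<in> space (?law n)"
      then have "x \<in> space SS" using sets_eq_imp_space_eq[OF law] by simp
      then obtain e t Y where x: "x = (e, t, Y)" and Y: "Y \<in> space S" by (auto simp: space_SS)
      have "V.val (capped A N) Y t \<le> 1" if "0 \<le> t" "t < len"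
        using that Y by (intro V.val_le_1) (auto simp: capped_def)
      then show "?w x \<le> indicator ({True} \<times> UNIV \<times> A) x + indicator (space SS - {True} \<times> UNIV \<times> space S) x"
        using capped_le[of A N Y] Y by (auto simp: x indicator_def space_SS)
    qed
    also have "\<dots> = ?m n A + emeasure (?law n) (space SS - {True} \<times> UNIV \<times> space S)"
    proof -
      have s: "{True} \<times> UNIV \<times> A \<in> sets (?law n)" "space SS - {True} \<times> UNIV \<times> space S \<in> sets (?law n)"
        using ended_sets[OF A] ended_sets[OF sets.top] by (auto simp: law)
      show ?thesis
        unfolding nn_integral_add[OF borel_measurable_indicator[OF s(1)] borel_measurable_indicator[OF s(2)]]
        by (simp only: nn_integral_indicator[OF s(1)] nn_integral_indicator[OF s(2)])
    qed
    also have "emeasure (?law n) (space SS - {True} \<times> UNIV \<times> space S) \<le> 1 - ?m n (space S)"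
    proof -
      interpret subprob_space "?law n"
        using loop_law_subprob[OF step start_in_SS, of n] by (simp add: space_subprob_algebra)
      have sp: "space (?law n) = space SS" using sets_eq_imp_space_eq[OF law] .
      have "emeasure (?law n) (space SS - {True} \<times> UNIV \<times> space S) = emeasure (?law n) (space SS) - ?m n (space S)"
        using ended_sets[OF sets.top] emeasure_compl[of "{True} \<times> UNIV \<times> space S" "?law n"] by (simp add: law sp)
      also have "\<dots> \<le> 1 - ?m n (space S)"
        using emeasure_space_le_1 by (intro ennreal_minus_mono) (simp_all add: sp)
      finally show ?thesis .
    qed
    finally show ?thesis by (simp add: add_left_mono)
  qed
  have ends': "(SUP n. ?m n (space S)) = 1"
    using ends by (simp add: loop_ends_def patterns_seg)
  have "?v \<le> (SUP n. ?m n A)"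
  proof (rule ennreal_le_epsilon)
    fix e :: real assume e: "0 < e"
    \<comment> \<open>Since the ended mass increases to 1, some iteration leaves at most
      \<open>e\<close> outside of the ended states.\<close>
    have "1 - ennreal e < 1" using e by (intro ennreal_between) auto
    then obtain n where n: "1 - ennreal e < ?m n (space S)"
      unfolding ends'[symmetric] less_SUP_iff by auto
    have "1 - ?m n (space S) \<le> ennreal e"
      using less_imp_le[OF n] by (simp add: ennreal_minus_le_iff add.commute)
    with le[of n] have "?v \<le> ?m n A + ennreal e" by (meson add_left_mono order_trans)
    also have "\<dots> \<le> (SUP n. ?m n A) + ennreal e" by (intro add_right_mono SUP_upper) simp
    finally show "?v \<le> (SUP n. ?m n A) + ennreal e" .
  qed
  then show ?thesis .
qed

text \<open>By \<open>integral_intensity\<close> the value in the hypothesis \<open>ge\<close> is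
  the mean of \<open>capped A N\<close> under \<open>P\<close>. Letting \<open>N\<close> grow shows
  that each event is at least as likely for the loop as under \<open>P\<close>, and
  \<open>loop_output_eq\<close> makes this an equality. The second claim keeps the explicit limit
  for the measurability in \<open>H\<close>.\<close>

lemma loop_eq_law:
  assumes step: "step \<in> SS \<rightarrow>\<^sub>M subprob_algebra SS"
    and stop: "\<And>r Y. Y \<in> space S \<Longrightarrow> step (True, r, Y) = return SS (True, r, Y)"
    and ge: "\<And>A N. A \<in> sets S \<Longrightarrow> V.val (capped A N) {} 0 \<le>
      (SUP n. emeasure (loop_law SS step (False, 0, {}) n) ({True} \<times> UNIV \<times> A))"
    and P: "seg_process L \<kappa> g i H P"
    and g: "(\<lambda>(p, X). g p (past L \<kappa> (loc \<kappa> p) X)) \<in> borel_measurable (points_on L \<kappa> (net L) \<Otimes>\<^sub>M patterns_on L \<kappa> (net L))"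
    and g_eq: "\<And>u m X. u \<in> net L \<Longrightarrow> m \<in> space \<nu> \<Longrightarrow> X \<in> space (patterns_on L \<kappa> (net L)) \<Longrightarrow>
      ennreal (g (mkp u m) (past L \<kappa> u X)) = ennreal (lam u (past L \<kappa> u X)) * ennreal (fm u (past L \<kappa> u X) m)"
  shows "loop_output L \<kappa> i step = P"
    and "A \<in> sets S \<Longrightarrow> emeasure P A = (SUP n. emeasure (loop_law SS step (False, 0, {}) n) ({True} \<times> UNIV \<times> A))"
proof -
  let ?m = "\<lambda>n A. emeasure (loop_law SS step (False, 0, {}) n) ({True} \<times> UNIV \<times> A)"
  have P': "has_cond_intensity (loc \<kappa>) B tm P (\<lambda>p Y. g p (past L \<kappa> (loc \<kappa> p) (H \<union> Y)))"
    using P by (simp add: seg_process_def)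
  then have prob: "prob_space P" and sets_P[measurable_cong]: "sets P = sets S" by (auto simp: has_cond_intensity_def)
  interpret P: prob_space P by fact
  have g': "(\<lambda>(p, Y). g p (past L \<kappa> (loc \<kappa> p) (H \<union> Y))) \<in> borel_measurable (B \<Otimes>\<^sub>M S)"
  proof -
    have "(\<lambda>(p, Y). (p, H \<union> Y)) \<in> B \<Otimes>\<^sub>M S \<rightarrow>\<^sub>M points_on L \<kappa> (net L) \<Otimes>\<^sub>M patterns_on L \<kappa> (net L)"
      unfolding split_beta'
      by (intro measurable_Pair measurable_Un_net measurable_const H measurable_snd
          measurable_compose[OF measurable_fst points_on_inclusion])
    from measurable_compose[OF this g] show ?thesis by (simp add: split_beta')
  qed
  have g_eq': "ennreal (g (pt t m) (past L \<kappa> (loc \<kappa> (pt t m)) (H \<union> Y))) = srate H Y t * smark H Y t m"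
    if "Y \<in> space S" "0 < t" "t < len" "m \<in> space \<nu>" for Y t m
    using that g_eq[OF _ that(4) Un_in_net[OF H that(1)], of "seg_pt L i t"] seg_pt_in_seg[OF i that(2,3)] seg_subset_net[OF i]
    by (auto simp: loc_mkp srate_def seg_rate_def smark_def)
  have P_test: "(\<integral>\<^sup>+X. capped A N X \<partial>P) = V.val (capped A N) {} 0" if "A \<in> sets S" for A N
    by (rule V.integral_intensity[OF P' sigma_finite_points_on g' g_eq' capped_measurable[OF that], where N=N])
       (use i in \<open>auto simp: capped_def seg_subset_net\<close>)
  have P_le: "emeasure P A \<le> (SUP n. ?m n A)" if A: "A \<in> sets S" for A
  proof -
    have "emeasure P A = (\<integral>\<^sup>+X. (SUP N. capped A N X) \<partial>P)"
    proof -
      have "(SUP N. capped A N X) = indicator A X" for X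
        by (rule antisym[OF SUP_least SUP_upper2[of "card X"]]) (auto simp: capped_def indicator_def)
      then show ?thesis using A by (simp add: sets_P)
    qed
    also have "\<dots> = (SUP N. \<integral>\<^sup>+X. capped A N X \<partial>P)"
      using A by (intro nn_integral_monotone_convergence_SUP)
        (auto simp: incseq_def le_fun_def capped_def)
    also have "\<dots> \<le> (SUP n. ?m n A)"
      unfolding P_test[OF A] by (intro SUP_least ge A)
    finally show ?thesis .
  qed
  note out = loop_output_eq[OF _ _ _ prob sets_P, of step "(False, 0, {})", folded SS_eq, OF step start_in_SS stop P_le]
    loop_output_emeasure[OF _ _ _ prob sets_P, of step "(False, 0, {})", folded SS_eq, OF step start_in_SS stop P_le]
  show "loop_output L \<kappa> i step = P"
    unfolding loop_output_def patterns_seg by (rule out(1))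
  show "A \<in> sets S \<Longrightarrow> emeasure P A = (SUP n. ?m n A)"
    by (rule out(2)[symmetric])
qed

end

lemma alg_loop_ge:
  assumes H: "H \<in> space HH" and alg: "alg_applicable L \<kappa> mk lam alg i"
    and A: "A \<in> sets S"
  shows "marked_line.val tm \<nu> len pt (srate H) (smark H) (capped A N) {} 0 \<le>
      (SUP n. emeasure (loop_law SS (alg_step L \<kappa> mk lam alg i H) (False, 0, {}) n) ({True} \<times> UNIV \<times> A))"
proof (cases alg)
  case Inverse
  then show ?thesis using inverse_loop_ge[OF H A] by (simp add: alg_step_def)
next
  case (Ogata Ls Ms)
  with alg have b: "ogata_bounds L \<kappa> lam i Ls Ms"
    and e: "loop_ends L \<kappa> i (ogata_step L \<kappa> mk lam Ls Ms i (up_part L \<kappa> i H))"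
    using up_part_in_patterns[OF H] by (auto simp: alg_applicable_def)
  have step: "ogata_step L \<kappa> mk lam Ls Ms i (up_part L \<kappa> i H) \<in> SS \<rightarrow>\<^sub>M subprob_algebra SS"
    using measurable_compose[OF measurable_Pair1'[OF up_part_HH[OF H]] measurable_ogata_step[OF b]] by simp
  have "loop_law SS (ogata_step L \<kappa> mk lam Ls Ms i (up_part L \<kappa> i H)) (False, 0, {}) n =
      loop_law SS (ogata_step L \<kappa> mk lam Ls Ms i H) (False, 0, {}) n" for n
    by (rule loop_law_cong[OF step start_in_SS ogata_step_up_part[OF H]])
  then have "loop_ends L \<kappa> i (ogata_step L \<kappa> mk lam Ls Ms i H)"
    using e by (simp only: loop_ends_def)
  from ogata_loop_ge[OF H b this A] show ?thesis by (simp add: alg_step_def Ogata)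
qed

lemma measurable_alg_step:
  assumes "alg_applicable L \<kappa> mk lam alg i"
  shows "(\<lambda>(H, st). alg_step L \<kappa> mk lam alg i H st) \<in> HH \<Otimes>\<^sub>M SS \<rightarrow>\<^sub>M subprob_algebra SS"
  using assms measurable_inverse_step measurable_ogata_step
  by (cases alg) (auto simp: alg_step_def alg_applicable_def)

lemma alg_step_stop:
  "H \<in> space HH \<Longrightarrow> Y \<in> space S \<Longrightarrow> alg_step L \<kappa> mk lam alg i H (True, r, Y) = return SS (True, r, Y)"
  by (cases alg) (simp_all add: alg_step_def inverse_step_eq ogata_step_eq)

text \<open>For each \<open>H\<close> the output is some law with the right intensity, but these
  laws come from a bare existence statement that says nothing about their dependence on
  \<open>H\<close>. Measurability of the kernel is instead read off from the limit of the loop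
  laws.\<close>

lemma segment_kernel:
  assumes alg: "alg_applicable L \<kappa> mk lam alg i"
    and g: "(\<lambda>(p, X). g p (past L \<kappa> (loc \<kappa> p) X)) \<in> borel_measurable (points_on L \<kappa> (net L) \<Otimes>\<^sub>M patterns_on L \<kappa> (net L))"
    and g_eq: "\<And>u m X. u \<in> net L \<Longrightarrow> m \<in> space \<nu> \<Longrightarrow> X \<in> space (patterns_on L \<kappa> (net L)) \<Longrightarrow>
      ennreal (g (mkp u m) (past L \<kappa> u X)) = ennreal (lam u (past L \<kappa> u X)) * ennreal (fm u (past L \<kappa> u X) m)"
    and ex: "\<And>H. H \<in> space (patterns_on L \<kappa> (up_seg L i)) \<Longrightarrow> \<exists>P. seg_process L \<kappa> g i H P"
  defines "K \<equiv> \<lambda>H. loop_output L \<kappa> i (alg_step L \<kappa> mk lam alg i H)"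
  shows "H \<in> space HH \<Longrightarrow> seg_process L \<kappa> g i H (K H)"
    and "K \<in> HH \<rightarrow>\<^sub>M prob_algebra (patterns_on L \<kappa> (seg L i))"
proof -
  have step: "alg_step L \<kappa> mk lam alg i H \<in> SS \<rightarrow>\<^sub>M subprob_algebra SS" if "H \<in> space HH" for H
    using measurable_compose[OF measurable_Pair1'[OF that] measurable_alg_step[OF alg]] by simp
  have *: "seg_process L \<kappa> g i H (K H) \<and> (\<forall>A\<in>sets S. emeasure (K H) A =
      (SUP n. emeasure (loop_law SS (alg_step L \<kappa> mk lam alg i H) (False, 0, {}) n) ({True} \<times> UNIV \<times> A)))"
    if H: "H \<in> space HH" for H
  proof -
    obtain P where "seg_process L \<kappa> g i (up_part L \<kappa> i H) P"
      using ex[OF up_part_in_patterns[OF H]] by blast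
    then have P: "seg_process L \<kappa> g i H P" by (simp add: seg_process_up_part[OF H])
    note L = loop_eq_law[OF H step[OF H] alg_step_stop[OF H] alg_loop_ge[OF H alg] P g g_eq]
    have "K H = P" unfolding K_def by (rule L(1))
    then show ?thesis using P L(2) by simp
  qed
  then show "H \<in> space HH \<Longrightarrow> seg_process L \<kappa> g i H (K H)" by simp
  have prob: "prob_space (K H)" "sets (K H) = sets S" if "H \<in> space HH" for H
    using *[OF that] by (auto simp: seg_process_def has_cond_intensity_def)
  show "K \<in> HH \<rightarrow>\<^sub>M prob_algebra (patterns_on L \<kappa> (seg L i))"
    unfolding patterns_seg
  proof (intro measurable_prob_algebraI measurable_subprob_algebra)
    fix A assume A: "A \<in> sets S"
    have [measurable]: "(\<lambda>H. emeasure (loop_law SS (alg_step L \<kappa> mk lam alg i H) (False, 0, {}) n) ({True} \<times> UNIV \<times> A))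
        \<in> borel_measurable HH" for n
      by (rule measurable_compose[OF measurable_loop_law[OF measurable_alg_step[OF alg] start_in_SS]
            measurable_emeasure_subprob_algebra[OF ended_sets[OF A]]])
    have "(\<lambda>H. SUP n. emeasure (loop_law SS (alg_step L \<kappa> mk lam alg i H) (False, 0, {}) n) ({True} \<times> UNIV \<times> A))
        \<in> borel_measurable HH" by measurable
    then show "(\<lambda>H. emeasure (K H) A) \<in> borel_measurable HH"
      using * A by (simp cong: measurable_cong)
  qed (auto simp: prob prob_space_imp_subprob_space)
qed

end

section \<open>The recursion over the segments\<close>

lemma first_segs_Suc: "first_segs L \<omega> (Suc k) = first_segs L \<omega> k \<union> seg L (\<omega> (Suc k))"
  by (simp add: first_segs_def atLeastAtMostSuc_conv Un_commute)

lemma first_segs_all: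
  assumes "\<omega> \<in> seg_orders L"
  shows "first_segs L \<omega> (nseg L) = net L"
proof -
  have "\<omega> ` {1..nseg L} = {1..nseg L}"
    using assms by (simp add: seg_orders_def bij_betw_def)
  moreover have "first_segs L \<omega> (nseg L) = (\<Union>j\<in>\<omega> ` {1..nseg L}. seg L j)"
    unfolding first_segs_def by blast
  ultimately show ?thesis by (simp only: net_def)
qed

locale network_simulation = marking_model L \<nu> \<kappa> mkp mk lam fm
  for L :: "'a::euclidean_space network" and \<nu> :: "'m measure" and \<kappa> :: "('a, 'p) point_kind"
    and mkp :: "'a \<Rightarrow> 'm \<Rightarrow> 'p" and mk lam fm +
  fixes g :: "'p \<Rightarrow> 'p set \<Rightarrow> real" and alg :: "nat \<Rightarrow> 'p sim_alg" and \<omega> :: "nat \<Rightarrow> nat"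
  assumes g: "cond_intensity_function L \<kappa> g"
    and g_eq: "\<And>u m X. u \<in> net L \<Longrightarrow> m \<in> space \<nu> \<Longrightarrow> X \<in> space (patterns_on L \<kappa> (net L)) \<Longrightarrow>
      ennreal (g (mkp u m) (past L \<kappa> u X)) = ennreal (lam u (past L \<kappa> u X)) * ennreal (fm u (past L \<kappa> u X) m)"
    and \<omega>: "\<omega> \<in> seg_orders L"
    and alg: "\<And>i. i \<in> {1..nseg L} \<Longrightarrow> alg_applicable L \<kappa> mk lam (alg i) i"
begin

lemma \<omega>_bij: "bij_betw \<omega> {1..nseg L} {1..nseg L}"
  using \<omega> by (simp add: seg_orders_def)

lemma \<omega>_in: "j \<in> {1..nseg L} \<Longrightarrow> \<omega> j \<in> {1..nseg L}"
  using \<omega>_bij by (rule bij_betwE[THEN bspec])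

lemma borel_part_first_segs: "k \<le> nseg L \<Longrightarrow> borel_part (first_segs L \<omega> k)"
proof (induction k)
  case (Suc k)
  then show ?case
    unfolding first_segs_Suc by (intro borel_part_Un borel_part_seg \<omega>_in) auto
qed (simp add: first_segs_def borel_part_def)

text \<open>Injectivity of \<omega> keeps the next segment apart from the earlier ones, and its
  order condition places all upstream segments among them.\<close>

lemma segment_simulation:
  assumes k: "Suc k \<le> nseg L"
  shows "segment_simulation L \<nu> \<kappa> mkp mk lam fm (\<omega> (Suc k)) (first_segs L \<omega> k)"
proof
  have k': "Suc k \<in> {1..nseg L}" using k by simp
  show i: "\<omega> (Suc k) \<in> {1..nseg L}" by (rule \<omega>_in[OF k'])
  show "borel_part (first_segs L \<omega> k)" using k by (intro borel_part_first_segs) simp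
  show "first_segs L \<omega> k \<inter> seg L (\<omega> (Suc k)) = {}"
  proof -
    have False if u: "u \<in> seg L (\<omega> j)" "u \<in> seg L (\<omega> (Suc k))" and j: "j \<in> {1..k}" for u j
    proof -
      have j': "j \<in> {1..nseg L}" using j k by auto
      have "\<omega> j = \<omega> (Suc k)" using seg_unique[OF u \<omega>_in[OF j'] i] .
      with bij_betw_imp_inj_on[OF \<omega>_bij] have "j = Suc k" by (rule inj_onD) (fact j' k')+
      then show False using j by simp
    qed
    then show ?thesis unfolding first_segs_def by blast
  qed
  show "up_seg L (\<omega> (Suc k)) \<subseteq> first_segs L \<omega> k"
  proof
    fix u assume "u \<in> up_seg L (\<omega> (Suc k))"
    then obtain j where j: "j \<in> {1..nseg L}" "seg_before L j (\<omega> (Suc k))" "u \<in> seg L j"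
      unfolding up_seg_def by blast
    obtain j' where j': "j' \<in> {1..nseg L}" "j = \<omega> j'"
      using \<omega>_bij j(1) unfolding bij_betw_def by blast
    then have "j' < Suc k"
      using \<omega> j(2) k' unfolding seg_orders_def by blast
    then have "j' \<in> {1..k}" using j'(1) by simp
    then show "u \<in> first_segs L \<omega> k" using j(3) j'(2) unfolding first_segs_def by blast
  qed
qed

text \<open>That the law lies in \<open>prob_algebra\<close> is carried along in the induction,
  because the next bind is controlled only for such laws.\<close>

lemma simulate_upto_process:
  "k \<le> nseg L \<Longrightarrow> process_upto L \<kappa> g \<omega> k (simulate_upto L \<kappa> mk lam alg \<omega> k) \<and>
    simulate_upto L \<kappa> mk lam alg \<omega> k \<in> space (prob_algebra (patterns_on L \<kappa> (first_segs L \<omega> k)))"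
proof (induction k)
  case 0
  have "{} \<in> space (patterns_on L \<kappa> (first_segs L \<omega> 0))"
    by (simp add: patterns_on_def space_pattern_space)
  then show ?case by (simp add: space_prob_algebra prob_space_return)
next
  case (Suc k)
  let ?i = "\<omega> (Suc k)"
  let ?P = "simulate_upto L \<kappa> mk lam alg \<omega> k"
  let ?K = "\<lambda>H. loop_output L \<kappa> ?i (alg_step L \<kappa> mk lam (alg ?i) ?i H)"
  let ?N = "patterns_on L \<kappa> (first_segs L \<omega> (Suc k))"
  interpret seg: segment_simulation L \<nu> \<kappa> mkp mk lam fm ?i "first_segs L \<omega> k"
    by (rule segment_simulation) (use Suc.prems in simp)
  have ex: "\<exists>P. seg_process L \<kappa> g ?i H P" if "H \<in> space (patterns_on L \<kappa> (up_seg L ?i))" for H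
    using g seg.i that by (auto simp: cond_intensity_function_def)
  have gm: "(\<lambda>(p, X). g p (past L \<kappa> (loc \<kappa> p) X)) \<in> borel_measurable (points_on L \<kappa> (net L) \<Otimes>\<^sub>M patterns_on L \<kappa> (net L))"
    using g by (simp add: cond_intensity_function_def)
  note K = seg.segment_kernel[OF alg[OF seg.i] gm g_eq ex]
  have IH: "process_upto L \<kappa> g \<omega> k ?P" "?P \<in> space (prob_algebra (patterns_on L \<kappa> (first_segs L \<omega> k)))"
    using Suc by auto
  have upto: "process_upto L \<kappa> g \<omega> (Suc k) (simulate_upto L \<kappa> mk lam alg \<omega> (Suc k))"
    unfolding process_upto.simps
  proof (intro exI conjI ballI)
    show "process_upto L \<kappa> g \<omega> k ?P" by fact
    show "?K \<in> patterns_on L \<kappa> (first_segs L \<omega> k) \<rightarrow>\<^sub>M prob_algebra (patterns_on L \<kappa> (seg L ?i))" by (rule K(2))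
    show "seg_process L \<kappa> g ?i H (?K H)" if "H \<in> space (patterns_on L \<kappa> (first_segs L \<omega> k))" for H
      by (rule K(1)) (assumption | rule that)+
  qed simp
  have un: "(\<lambda>(H, Y). return ?N (H \<union> Y)) \<in>
      patterns_on L \<kappa> (first_segs L \<omega> k) \<Otimes>\<^sub>M patterns_on L \<kappa> (seg L ?i) \<rightarrow>\<^sub>M prob_algebra ?N"
    unfolding split_beta'
  proof (rule measurable_compose[OF _ measurable_return_prob_space])
    show "(\<lambda>x. fst x \<union> snd x) \<in>
        patterns_on L \<kappa> (first_segs L \<omega> k) \<Otimes>\<^sub>M patterns_on L \<kappa> (seg L ?i) \<rightarrow>\<^sub>M ?N"
    proof (rule measurable_pattern_Un[OF seg.C(1) seg.BS borel_part_first_segs[OF Suc.prems] seg.C(2)])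
      show "first_segs L \<omega> k \<subseteq> first_segs L \<omega> (Suc k)" "seg L ?i \<subseteq> first_segs L \<omega> (Suc k)"
        by (simp_all add: first_segs_Suc)
    qed (rule measurable_fst, rule measurable_snd)
  qed
  have kern: "(\<lambda>H. ?K H \<bind> (\<lambda>Y. return ?N (H \<union> Y))) \<in> patterns_on L \<kappa> (first_segs L \<omega> k) \<rightarrow>\<^sub>M prob_algebra ?N"
    by (rule measurable_bind_prob_space2[OF K(2) un])
  have "simulate_upto L \<kappa> mk lam alg \<omega> (Suc k) \<in> space (prob_algebra ?N)"
    using prob_space_bind'[OF IH(2) kern] sets_bind'[OF IH(2) kern]
    by (simp add: add_segment_def space_prob_algebra)
  with upto show ?case by blast
qed

theorem network_process_simulation: "network_process L \<kappa> g \<omega> (simulation L \<kappa> mk lam alg \<omega>)"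
  using simulate_upto_process[of "nseg L"] \<omega>
  by (simp add: network_process_def simulation_def first_segs_all space_prob_algebra)

end

section \<open>The two kinds of points\<close>

lemma (in network_geometry) up_pt_borel_subset:
  assumes "u \<in> net L"
  shows "up_pt L u \<in> sets borel" "up_pt L u \<subseteq> net L"
proof -
  obtain i where i: "i \<in> {1..nseg L}" "u \<in> seg L i" using assms by (auto simp: net_def)
  obtain t where t: "0 < t" "t < seg_len L i" "u = seg_pt L i t" by (rule segE[OF i])
  have part: "seg_part L i 0 t \<subseteq> seg L i"
    using t seg_eq_image[OF ends_neq[OF i(1)]] by (auto simp: seg_part_def)
  \<comment> \<open>Time on the segment is the distance from its lower end, so an initial part is
    cut out by an open ball and is Borel.\<close>
  have "seg_part L i 0 t = seg L i \<inter> ball (lower L i) t"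
    using part seg_part_iff[OF i(1), of _ t] t by auto
  then have "seg_part L i 0 t \<in> sets borel" by simp
  then show "up_pt L u \<in> sets borel" "up_pt L u \<subseteq> net L"
    using part seg_subset_net[OF i(1)] up_seg_subset_net[of L i]
    unfolding t(3) up_pt_eq[OF i(1) t(1,2)] by auto
qed

lemma (in point_model) past_in_patterns:
  assumes "u \<in> net L" "X \<in> space (patterns_on L \<kappa> (net L))"
  shows "past L \<kappa> u X \<in> space (patterns_on L \<kappa> (up_pt L u))"
  using assms up_pt_borel_subset[OF assms(1)]
  by (auto simp: space_patterns_on borel_part_def past_def intro: inj_on_subset)

text \<open>A point without mark is a point with the only mark in \<open>unit\<close>, of density 1.
  Drawing that mark changes nothing, because the counting measure on \<open>unit\<close> has mass 1
  and the rest of the program ignores the mark.\<close>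

lemma (in network_geometry) network_process_unmarked:
  assumes g: "cond_intensity_function L unmarked lam" and \<omega>: "\<omega> \<in> seg_orders L"
    and alg: "\<And>i. i \<in> {1..nseg L} \<Longrightarrow> alg_applicable L unmarked no_mark lam (alg i) i"
  shows "network_process L unmarked lam \<omega> (simulation L unmarked no_mark lam alg \<omega>)"
proof -
  let ?\<nu> = "count_space (UNIV :: unit set)"
  interpret point_model L ?\<nu> unmarked "\<lambda>u m. u" by (rule point_model_unmarked)
  have prob: "prob_space ?\<nu>" by (rule prob_spaceI) simp
  have "network_simulation L ?\<nu> unmarked (\<lambda>u m. u) no_mark lam (\<lambda>_ _ _. 1) lam alg \<omega>"
  proof
    have "sets (restrict_space borel (net L) \<Otimes>\<^sub>M patterns_on L unmarked (net L)) =
        sets (points_on L unmarked (net L) \<Otimes>\<^sub>M patterns_on L unmarked (net L))"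
      by (rule sets_pair_measure_cong) (simp_all add: points_on_unmarked sets_restrict_length)
    then show "(\<lambda>(u, X). lam u (past L unmarked u X)) \<in>
        borel_measurable (restrict_space borel (net L) \<Otimes>\<^sub>M patterns_on L unmarked (net L))"
      using g by (simp add: cond_intensity_function_def unmarked_def cong: measurable_cong_sets)
    show "no_mark u X rest = density ?\<nu> (\<lambda>m. ennreal 1) \<bind> (\<lambda>m. rest u)"
      if "\<And>p. subprob_space (rest p)" for u :: 'a and X and rest :: "'a \<Rightarrow> 'a sim_state measure"
      using bind_const'[OF prob that[of u]] by (simp add: no_mark_def density_1)
  qed (use g \<omega> alg in \<open>simp_all add: split_beta' nn_integral_count_space_finite\<close>)
  then show ?thesis by (rule network_simulation.network_process_simulation)
qed

text \<open>For the intensity, sign and measurability are given for the product of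
  \<open>lam\<close> and \<open>f\<close> only. Those of \<open>lam\<close> on the pasts have to be
  recovered from it by means of the normalisation of \<open>f\<close>.\<close>

lemma (in network_geometry) network_process_marked:
  assumes \<nu>: "sigma_finite_measure \<nu>" and f: "mark_density L \<nu> f"
    and g: "cond_intensity_function L (marked \<nu>) (marked_intensity lam f)" and \<omega>: "\<omega> \<in> seg_orders L"
    and alg: "\<And>i. i \<in> {1..nseg L} \<Longrightarrow> alg_applicable L (marked \<nu>) (draw_mark \<nu> f) lam (alg i) i"
  shows "network_process L (marked \<nu>) (marked_intensity lam f) \<omega> (simulation L (marked \<nu>) (draw_mark \<nu> f) lam alg \<omega>)"
proof -
  let ?\<kappa> = "marked \<nu> :: ('a, 'a \<times> 'b) point_kind"
  let ?PN = "patterns_on L ?\<kappa> (net L)"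
  let ?RN = "restrict_space borel (net L)"
  interpret point_model L \<nu> ?\<kappa> Pair by (rule point_model_marked[OF \<nu>])
  have f_nonneg: "0 \<le> f u (past L ?\<kappa> u X) m" if "u \<in> net L" "X \<in> space ?PN" "m \<in> space \<nu>" for u X m
    using f past_in_patterns[OF that(1,2)] that by (simp add: mark_density_def)
  have f_prob: "(\<integral>\<^sup>+m. ennreal (f u (past L ?\<kappa> u X) m) \<partial>\<nu>) = 1" if "u \<in> net L" "X \<in> space ?PN" for u X
    using f past_in_patterns[OF that] that by (simp add: mark_density_def)
  have f_meas: "(\<lambda>((u, X), m). f u (past L ?\<kappa> u X) m) \<in> borel_measurable ((?RN \<Otimes>\<^sub>M ?PN) \<Otimes>\<^sub>M \<nu>)"
    using f by (simp add: mark_density_def)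
  have space_RN: "space (?RN \<Otimes>\<^sub>M ?PN) = net L \<times> space ?PN"
    by (simp add: space_pair_measure space_restrict_space)
  have g_eq: "ennreal (marked_intensity lam f (u, m) (past L ?\<kappa> u X)) =
      ennreal (lam u (past L ?\<kappa> u X)) * ennreal (f u (past L ?\<kappa> u X) m)"
    if "u \<in> net L" "m \<in> space \<nu>" "X \<in> space ?PN" for u m X
    using f_nonneg[OF that(1,3,2)] by (simp add: marked_intensity_def ennreal_mult'')
  \<comment> \<open>A negative value of \<open>lam\<close> would make \<open>f\<close> nonpositive
    for every mark, against its integral 1.\<close>
  have lam_nonneg: "0 \<le> lam u (past L ?\<kappa> u X)" if u: "u \<in> net L" and X: "X \<in> space ?PN" for u X
  proof (rule ccontr)
    assume neg: "\<not> 0 \<le> lam u (past L ?\<kappa> u X)"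
    have "f u (past L ?\<kappa> u X) m \<le> 0" if m: "m \<in> space \<nu>" for m
    proof -
      have "(u, m) \<in> space (points_on L ?\<kappa> (net L))"
        using u m by (simp add: points_on_marked space_pair_measure space_restrict_space space_length_measure)
      moreover have "past L ?\<kappa> u X \<in> space (patterns_on L ?\<kappa> (up_pt L (loc ?\<kappa> (u, m))))"
        using past_in_patterns[OF u X] by (simp add: loc_mkp)
      ultimately have "0 \<le> marked_intensity lam f (u, m) (past L ?\<kappa> u X)"
        using g unfolding cond_intensity_function_def by blast
      then show ?thesis using neg by (simp add: marked_intensity_def zero_le_mult_iff)
    qed
    then have "(\<integral>\<^sup>+m. ennreal (f u (past L ?\<kappa> u X) m) \<partial>\<nu>) = (\<integral>\<^sup>+m. 0 \<partial>\<nu>)"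
      by (intro nn_integral_cong) (simp add: ennreal_neg)
    then show False using f_prob[OF u X] by simp
  qed
  have lam_meas: "(\<lambda>(u, X). lam u (past L ?\<kappa> u X)) \<in> borel_measurable (?RN \<Otimes>\<^sub>M ?PN)"
  proof -
    \<comment> \<open>The integral of the product over the marks gives back \<open>lam\<close>, and
      integrals with a parameter are measurable.\<close>
    let ?g = "\<lambda>x m. ennreal (marked_intensity lam f (fst x, m) (past L ?\<kappa> (fst x) (snd x)))"
    have s: "sets (points_on L ?\<kappa> (net L)) = sets (?RN \<Otimes>\<^sub>M \<nu>)"
      unfolding points_on_marked by (rule sets_pair_measure_cong) (simp_all add: sets_restrict_length)
    have gm: "(\<lambda>(p, X). marked_intensity lam f p (past L ?\<kappa> (loc ?\<kappa> p) X)) \<in> borel_measurable ((?RN \<Otimes>\<^sub>M \<nu>) \<Otimes>\<^sub>M ?PN)"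
      using g sets_pair_measure_cong[OF s refl, of ?PN]
      by (simp add: cond_intensity_function_def cong: measurable_cong_sets)
    have "(\<lambda>(x, m). ((fst x, m), snd x)) \<in> (?RN \<Otimes>\<^sub>M ?PN) \<Otimes>\<^sub>M \<nu> \<rightarrow>\<^sub>M (?RN \<Otimes>\<^sub>M \<nu>) \<Otimes>\<^sub>M ?PN" by measurable
    from measurable_compose[OF this gm]
    have [measurable]: "(\<lambda>(x, m). ?g x m) \<in> borel_measurable ((?RN \<Otimes>\<^sub>M ?PN) \<Otimes>\<^sub>M \<nu>)"
      by (simp add: split_beta' loc_mkp)
    have "(\<lambda>x. enn2real (\<integral>\<^sup>+m. ?g x m \<partial>\<nu>)) \<in> borel_measurable (?RN \<Otimes>\<^sub>M ?PN)" by measurable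
    moreover have "enn2real (\<integral>\<^sup>+m. ?g x m \<partial>\<nu>) = (case x of (u, X) \<Rightarrow> lam u (past L ?\<kappa> u X))"
      if x: "x \<in> space (?RN \<Otimes>\<^sub>M ?PN)" for x
    proof -
      obtain u X where x_eq: "x = (u, X)" and u: "u \<in> net L" and X: "X \<in> space ?PN"
        using x unfolding space_RN by auto
      have fm: "(\<lambda>m. f u (past L ?\<kappa> u X) m) \<in> borel_measurable \<nu>"
        using measurable_compose[OF measurable_Pair1'[of "(u, X)" "?RN \<Otimes>\<^sub>M ?PN"] f_meas] u X space_RN by simp
      have "(\<integral>\<^sup>+m. ?g x m \<partial>\<nu>) = (\<integral>\<^sup>+m. ennreal (lam u (past L ?\<kappa> u X)) * ennreal (f u (past L ?\<kappa> u X) m) \<partial>\<nu>)"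
        unfolding x_eq by (intro nn_integral_cong) (simp add: g_eq[OF u _ X])
      also have "\<dots> = ennreal (lam u (past L ?\<kappa> u X))"
        using fm f_prob[OF u X] by (subst nn_integral_cmult) auto
      finally show ?thesis using lam_nonneg[OF u X] by (simp add: x_eq)
    qed
    ultimately show ?thesis by (simp cong: measurable_cong)
  qed
  have "network_simulation L \<nu> ?\<kappa> Pair (draw_mark \<nu> f) lam f (marked_intensity lam f) alg \<omega>"
  proof
    show "draw_mark \<nu> f u X rest = density \<nu> (\<lambda>m. ennreal (f u X m)) \<bind> (\<lambda>m. rest (u, m))" for u X rest
      by (rule draw_mark_def)
  qed (fact lam_meas f_meas f_prob g g_eq \<omega> alg)+
  then show ?thesis by (rule network_simulation.network_process_simulation)
qed

theorem proposition2:
  fixes L :: "'a::euclidean_space network" and \<omega> :: "nat \<Rightarrow> nat"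
    and lam :: "'a \<Rightarrow> 'a set \<Rightarrow> real" and alg :: "nat \<Rightarrow> 'a sim_alg"
    and \<nu> :: "'m measure" and mlam :: "'a \<Rightarrow> ('a \<times> 'm) set \<Rightarrow> real"
    and f :: "'a \<Rightarrow> ('a \<times> 'm) set \<Rightarrow> 'm \<Rightarrow> real" and malg :: "nat \<Rightarrow> ('a \<times> 'm) sim_alg"
  assumes "2 \<le> DIM('a)" and "daln L" and "\<omega> \<in> seg_orders L"
  shows "(cond_intensity_function L unmarked lam \<and>
          (\<forall>i\<in>{1..nseg L}. alg_applicable L unmarked no_mark lam (alg i) i)
          \<longrightarrow> network_process L unmarked lam \<omega> (simulation L unmarked no_mark lam alg \<omega>)) \<and>
         (sigma_finite_measure \<nu> \<and> mark_density L \<nu> f \<and>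
          cond_intensity_function L (marked \<nu>) (marked_intensity mlam f) \<and>
          (\<forall>i\<in>{1..nseg L}. alg_applicable L (marked \<nu>) (draw_mark \<nu> f) mlam (malg i) i)
          \<longrightarrow> network_process L (marked \<nu>) (marked_intensity mlam f) \<omega>
                (simulation L (marked \<nu>) (draw_mark \<nu> f) mlam malg \<omega>))"
proof -
  interpret network_geometry L
    using assms(2) by (simp add: network_geometry_def daln_def)
  show ?thesis
    using network_process_unmarked[of lam \<omega> alg] network_process_marked[of \<nu> f mlam \<omega> malg] assms(3)
    by blast
qed

end
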